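(* Let $d\ge 3$, let $\mu$ be a positive finite Borel measure in $\mathbb{R}^d$, let $u(x)=\int_{\mathbb{R}^d}\frac{1}{|x-y|^{d-2}}\,d\mu(y)$, $x\in\mathbb{R}^d$, be its Riesz potential, and let $a\in\mathbb{R}^d$. Then $u$ is differentiable in the capacity sense at the point $a$ if and only if $$\lim_{r\to 0}\frac{\mu(B(a,r))}{r^{d-1}}=0$$ and the principal value $$\operatorname{p.v.}\int\frac{a-y}{|a-y|^d}\,d\mu(y)=\lim_{\varepsilon\to 0}\int_{|y-a|>\varepsilon}\frac{a-y}{|a-y|^d}\,d\mu(y)$$ exists (as a limit in $\mathbb{R}^d$).
   Context: $B(a,r)$ is the ball of center $a$ and radius $r$. Newtonian capacity ($d\ge3$): for compact $E\subset\mathbb{R}^d$, $\operatorname{Cap}(E)=\sup\nu(E)$, the supremum being over all positive finite Borel measures $\nu$ supported on $E$ with $\int\frac{d\nu(y)}{|x-y|^{d-2}}\le 1$ for all $x\in\mathbb{R}^d$. For a non-compact Borel set, $\operatorname{Cap}$ is the supremum of the capacities of its compact subsets. Differentiability in the capacity sense: a real function $u$ is differentiable in the capacity sense at $a$ if there exist real numbers $A_1,\dots,A_d$ such that, with $Q(x)=\frac{|u(x)-u(a)-\sum_{i=1}^d A_i(x_i-a_i)|}{|x-a|}$, $$\lim_{r\to0}\frac{\sup_{t>0}t\,\operatorname{Cap}(\{x\in B(a,r):Q(x)>t\})}{\operatorname{Cap}(B(a,r))}=0.$$ In particular $u(a)$ is required to be finite. The potential $u$ is finite outside a set of capacity zero;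 points $x$ where $u$ is not finite play no role in the definition. *)

theory Defs
  imports "HOL-Analysis.Analysis"
begin

text \<open>The division is taken in \<^typ>\<open>ennreal\<close>, so the kernel is infinite on the diagonal
  (for \<open>d \<ge> 3\<close>).\<close>

definition newton_potential :: "(real ^ 'd) measure \<Rightarrow> real ^ 'd \<Rightarrow> ennreal" where
  "newton_potential \<mu> x =
     (\<integral>\<^sup>+ y. 1 / ennreal (norm (x - y) ^ (CARD('d) - 2)) \<partial>\<mu>)"

definition compact_capacity :: "(real ^ 'd) set \<Rightarrow> ennreal" where
  "compact_capacity E = Sup {emeasure \<nu> UNIV |\<nu>.
     finite_measure \<nu> \<and> sets \<nu> = sets borel \<and> emeasure \<nu> (- E) = 0 \<and>
     (\<forall>x. newton_potential \<nu> x \<le> 1)}"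

definition capacity :: "(real ^ 'd) set \<Rightarrow> ennreal" where
  "capacity B = (SUP K \<in> {K. compact K \<and> K \<subseteq> B}. compact_capacity K)"

lemma compact_capacity_mono:
  fixes E F :: "(real ^ 'd) set"
  assumes "E \<subseteq> F" "compact E" "compact F"
  shows "compact_capacity E \<le> compact_capacity F"
  unfolding compact_capacity_def
proof (rule Sup_subset_mono, rule subsetI)
  fix c
  assume "c \<in> {emeasure \<nu> UNIV |\<nu> :: (real ^ 'd) measure.
    finite_measure \<nu> \<and> sets \<nu> = sets borel \<and> emeasure \<nu> (- E) = 0 \<and>
    (\<forall>x. newton_potential \<nu> x \<le> 1)}"
  then obtain \<nu> :: "(real ^ 'd) measure" where \<nu>:
    "c = emeasure \<nu> UNIV" "finite_measure \<nu>" "sets \<nu> = sets borel"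
    "emeasure \<nu> (- E) = 0" "\<forall>x. newton_potential \<nu> x \<le> 1"
    by blast
  have "- E \<in> sets \<nu>"
    using \<nu>(3) assms(2) by (simp add: borel_open compact_imp_closed open_Compl)
  then have "emeasure \<nu> (- F) \<le> emeasure \<nu> (- E)"
    using assms(1) by (intro emeasure_mono) auto
  with \<nu>(4) have "emeasure \<nu> (- F) = 0"
    by simp
  with \<nu> show "c \<in> {emeasure \<nu> UNIV |\<nu> :: (real ^ 'd) measure.
    finite_measure \<nu> \<and> sets \<nu> = sets borel \<and> emeasure \<nu> (- F) = 0 \<and>
    (\<forall>x. newton_potential \<nu> x \<le> 1)}"
    by blast
qed

lemma capacity_compact:
  assumes "compact E"
  shows "capacity E = compact_capacity E"
  unfolding capacity_def
  by (rule antisym)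
    (use assms in \<open>auto intro!: SUP_least SUP_upper compact_capacity_mono\<close>)

text \<open>Points where \<open>u\<close> is infinite are left out of the exceptional set; \<open>x = a\<close> drops out
  as well, since the quotient there is \<open>0 / 0 = 0\<close>.\<close>

definition capacity_differentiable_at :: "(real ^ 'd \<Rightarrow> ereal) \<Rightarrow> real ^ 'd \<Rightarrow> bool" where
  "capacity_differentiable_at u a \<longleftrightarrow> \<bar>u a\<bar> \<noteq> \<infinity> \<and>
     (\<exists>A :: real ^ 'd.
       let Q = (\<lambda>x. \<bar>real_of_ereal (u x) - real_of_ereal (u a)
                      - (\<Sum>i\<in>UNIV. A $ i * (x $ i - a $ i))\<bar> / norm (x - a))
       in ((\<lambda>r. (SUP t\<in>{0<..}. ennreal t *
                    capacity {x \<in> ball a r. \<bar>u x\<bar> \<noteq> \<infinity> \<and> Q x > t})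
                  / capacity (ball a r)) \<longlongrightarrow> 0) (at_right (0::real)))"

end

theory Submission
  imports Defs
begin

text \<open>Write \<open>d\<close> for the dimension, \<open>k = d - 2\<close>, \<open>u\<close> for the potential of \<open>\<mu>\<close>, and \<open>G \<epsilon>\<close> for the integral of
\<open>(a - y) / |a - y|^d\<close> over \<open>|y - a| > \<epsilon>\<close>. Since the kernel \<open>|x - y|^(-k)\<close> has gradient
\<open>- k (a - y) / |a - y|^d\<close> in \<open>x\<close> at \<open>x = a\<close>, the differential of \<open>u\<close> at \<open>a\<close> can only be \<open>- k\<close> times the
principal value \<open>lim G\<close>.

The common core of both directions is an expansion. If \<open>\<mu> (B(a,s)) \<le> e s^(d-1)\<close> for small \<open>s\<close>, then
\<open>u x - u a + k G(2|x-a|) \<bullet> (x - a)\<close> equals \<open>|x - a|\<close> times a quantity of order \<open>e\<close>, up to the potential at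
\<open>x\<close> of the part of \<open>\<mu>\<close> in \<open>|y - a| \<le> 2|x - a|\<close>: the points \<open>y\<close> far from \<open>a\<close> are handled by Taylor's formula
and a dyadic summation (\<open>first_order_remainder_le\<close>). The near potential need not be small at any given
point, but it is small after integration against every measure \<open>\<nu>\<close> whose own potential is at most \<open>1\<close>:
Tonelli's theorem moves the kernel to the potential of \<open>\<nu>\<close> and leaves the integral of \<open>2 / |y - a|\<close>
against \<open>\<mu>\<close>, which is \<open>O(e r^k)\<close> (\<open>near_part_integral_le\<close>, \<open>field_remainder_integral_le\<close>). Capacity
is a supremum over such \<open>\<nu>\<close>, so \<open>t Cap {Q > t}\<close> is at most the supremum of the integrals of \<open>Q\<close> (\<open>times_capacity_le\<close>).
As \<open>Cap (B(a,r))\<close> is comparable to \<open>r^k\<close>, a density of order \<open>o(r^(d-1))\<close> and convergence of \<open>G\<close> give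
differentiability.

Conversely, let \<open>u\<close> be differentiable with coefficients \<open>A\<close>. A set \<open>E\<close> satisfies
\<open>|E| \<le> C Cap(E)^(d/(d-2))\<close> (\<open>lborel_le_of_capacity_le\<close>); since this exponent exceeds \<open>1\<close>, the weak bound on \<open>Cap {Q > t}\<close> becomes a
strong one: the Lebesgue mean of \<open>Q\<close> over \<open>B(a,r)\<close> tends to \<open>0\<close>
(\<open>nn_integral_lborel_le_of_weak_capacity\<close>). Integrate \<open>u\<close> against the Laplacian of the bump
\<open>(r^2 - |x-a|^2)_+^3\<close>. Affine functions are annihilated, so only the deviation of \<open>u\<close> from its affine
approximation contributes, while \<open>u\<close> itself, being superharmonic with Laplacian \<open>- c \<mu>\<close>, contributes at least
a multiple of \<open>\<mu> (B(a,r/2))\<close>. Comparison gives \<open>\<mu> (B(a,r)) = o(r^(d-1))\<close>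
(\<open>measure_ball_le_affine_deviation\<close>). Now the expansion above is available; subtracting it
from differentiability shows that \<open>(A + k G(2|x-a|)) \<bullet> (x - a) / |x - a|\<close> is small in the mean, and as
\<open>G\<close> hardly changes on dyadic scales, \<open>A + k G(2r)\<close> tends to \<open>0\<close> (\<open>field_limit_of_mean_remainder\<close>).\<close>

section \<open>Capacity and measures of potential at most one\<close>

text \<open>The measures competing for capacity, freed of the condition on their support.\<close>

definition admissible :: "(real ^ 'd) measure \<Rightarrow> bool" where
  "admissible \<nu> \<longleftrightarrow> finite_measure \<nu> \<and> sets \<nu> = sets borel \<and> (\<forall>x. newton_potential \<nu> x \<le> 1)"

lemma one_divide_ennreal:
  "0 < x \<Longrightarrow> 1 / ennreal x = ennreal (1 / x)"
  "1 / (0 :: ennreal) = \<infinity>"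
  by (simp_all add: divide_ennreal flip: ennreal_1)

lemma newton_potential_measurable [measurable]:
  fixes \<mu> :: "(real ^ 'd) measure"
  assumes "finite_measure \<mu>" "sets \<mu> = sets borel"
  shows "newton_potential \<mu> \<in> borel_measurable borel"
proof -
  interpret finite_measure \<mu> by fact
  have [measurable_cong]: "sets \<mu> = sets borel" by fact
  show ?thesis
    unfolding newton_potential_def by measurable
qed

text \<open>Restricting a measure only lowers its potential; this is how a measure is turned into a
competitor for the capacity of a compact set.\<close>

lemma admissible_density:
  fixes \<nu> :: "(real ^ 'd) measure"
  assumes "admissible \<nu>" "K \<in> sets borel"
  shows "admissible (density \<nu> (indicator K))"
proof -
  have s [measurable_cong]: "sets \<nu> = sets borel" and f: "finite_measure \<nu>"
    using assms by (auto simp: admissible_def)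
  interpret finite_measure \<nu> by fact
  have [measurable]: "K \<in> sets borel" by fact
  have KM: "K \<in> sets \<nu>" using s by simp
  have "finite_measure (density \<nu> (indicator K))"
    using KM by (intro finite_measureI) (simp add: emeasure_density emeasure_finite)
  moreover have "newton_potential (density \<nu> (indicator K)) x \<le> 1" for x
  proof -
    have "newton_potential (density \<nu> (indicator K)) x
        = (\<integral>\<^sup>+ y. indicator K y * (1 / ennreal (norm (x - y) ^ (CARD('d) - 2))) \<partial>\<nu>)"
      unfolding newton_potential_def by (subst nn_integral_density) auto
    also have "\<dots> \<le> newton_potential \<nu> x"
      unfolding newton_potential_def by (intro nn_integral_mono) (auto simp: indicator_def)
    also have "\<dots> \<le> 1" using assms by (auto simp: admissible_def)
    finally show ?thesis .
  qed
  ultimately show ?thesis using s by (simp add: admissible_def)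
qed

text \<open>Inner regularity reduces the claim to compact subsets, on which the restricted measure competes.\<close>

lemma emeasure_le_capacity:
  fixes \<nu> :: "(real ^ 'd) measure"
  assumes "admissible \<nu>" "E \<in> sets borel"
  shows "emeasure \<nu> E \<le> capacity E"
proof -
  have s: "sets \<nu> = sets borel" and f: "finite_measure \<nu>"
    using assms by (auto simp: admissible_def)
  interpret finite_measure \<nu> by fact
  have "emeasure \<nu> K \<le> capacity E" if K: "K \<subseteq> E" "compact K" for K
  proof -
    have Kb: "K \<in> sets borel" using K by (simp add: borel_compact)
    let ?N = "density \<nu> (indicator K)"
    have "emeasure \<nu> K = emeasure ?N UNIV"
      using Kb s sets_eq_imp_space_eq[OF s] by (simp add: emeasure_density)
    also have "\<dots> \<le> compact_capacity K"
      unfolding compact_capacity_def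
    proof (rule Sup_upper, rule CollectI, intro exI conjI)
      show "emeasure ?N (- K) = 0"
        using Kb s by (subst emeasure_density) (auto simp flip: indicator_inter_arith)
    qed (use admissible_density[OF assms(1) Kb] in \<open>auto simp: admissible_def\<close>)
    also have "\<dots> \<le> capacity E"
      unfolding capacity_def using K by (intro SUP_upper) auto
    finally show ?thesis .
  qed
  moreover have "emeasure \<nu> E = (SUP K\<in>{K. K \<subseteq> E \<and> compact K}. emeasure \<nu> K)"
    using assms s by (intro inner_regular) (auto simp: emeasure_finite)
  ultimately show ?thesis by (auto intro!: SUP_least)
qed

text \<open>A Chebyshev inequality for capacity: it is the only way in which capacities are bounded from above here,
always by way of a bound on integrals that is uniform in the admissible measures.\<close>

lemma times_capacity_le:
  fixes E :: "(real ^ 'd) set" and f :: "real ^ 'd \<Rightarrow> ennreal"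
  assumes "\<And>\<nu>. admissible \<nu> \<Longrightarrow> (\<integral>\<^sup>+ x \<in> B. f x \<partial>\<nu>) \<le> c"
    and "E \<subseteq> B" "\<And>x. x \<in> E \<Longrightarrow> t \<le> f x"
  shows "t * capacity E \<le> c"
proof -
  have "t * emeasure \<nu> UNIV \<le> c"
    if K: "compact K" "K \<subseteq> E" and \<nu>: "admissible \<nu>" "emeasure \<nu> (- K) = 0" for K \<nu>
  proof -
    have s: "sets \<nu> = sets borel" using \<nu> by (simp add: admissible_def)
    have Kb: "K \<in> sets \<nu>" using K by (simp add: s borel_compact)
    have "emeasure \<nu> UNIV = emeasure \<nu> K + emeasure \<nu> (- K)"
      using Kb by (subst plus_emeasure) (auto simp: s)
    then have "t * emeasure \<nu> UNIV = (\<integral>\<^sup>+ x \<in> K. t \<partial>\<nu>)"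
      using \<nu>(2) Kb by (simp add: nn_integral_cmult_indicator)
    also have "\<dots> \<le> (\<integral>\<^sup>+ x \<in> B. f x \<partial>\<nu>)"
      using K assms(2,3) by (intro nn_integral_mono) (auto simp: indicator_def)
    also have "\<dots> \<le> c" using assms(1) \<nu> by auto
    finally show ?thesis .
  qed
  then have "t * Sup {emeasure \<nu> UNIV |\<nu> :: (real ^ 'd) measure. finite_measure \<nu> \<and> sets \<nu> = sets borel \<and>
      emeasure \<nu> (- K) = 0 \<and> (\<forall>x. newton_potential \<nu> x \<le> 1)} \<le> c" if "compact K" "K \<subseteq> E" for K
    using that by (subst SUP_mult_left_ennreal[of t "\<lambda>x. x", simplified])
      (auto simp: admissible_def intro!: SUP_least)
  then show ?thesis
    unfolding capacity_def compact_capacity_def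
    by (auto simp: SUP_mult_left_ennreal intro!: SUP_least)
qed

text \<open>On the ball the kernel seen from the centre is at least \<open>1 / r^(d-2)\<close>, and its integral is at most \<open>1\<close>.\<close>

lemma admissible_ball:
  fixes \<nu> :: "(real ^ 'd) measure"
  assumes "admissible \<nu>" "0 < r"
  shows "emeasure \<nu> (ball a r) \<le> ennreal (r ^ (CARD('d) - 2))"
proof -
  let ?k = "CARD('d) - 2"
  have s: "sets \<nu> = sets borel" using assms by (simp add: admissible_def)
  have rk: "0 < r ^ ?k" using assms by simp
  have "ennreal (1 / r ^ ?k) * emeasure \<nu> (ball a r) = (\<integral>\<^sup>+ y \<in> ball a r. ennreal (1 / r ^ ?k) \<partial>\<nu>)"
    by (simp add: nn_integral_cmult_indicator s)
  also have "\<dots> \<le> newton_potential \<nu> a"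
    unfolding newton_potential_def
  proof (intro nn_integral_mono)
    fix y
    have "ennreal (1 / r ^ ?k) \<le> 1 / ennreal (norm (a - y) ^ ?k)" if "y \<in> ball a r"
    proof -
      have "norm (a - y) ^ ?k \<le> r ^ ?k"
        using that by (intro power_mono) (auto simp: dist_norm)
      then show ?thesis
      proof (cases "norm (a - y) ^ ?k = 0")
        case True
        then show ?thesis by (simp only: True) simp
      next
        case False
        with \<open>norm (a - y) ^ ?k \<le> r ^ ?k\<close> show ?thesis
          by (subst one_divide_ennreal) (auto intro!: ennreal_leI frac_le)
      qed
    qed
    then show "ennreal (1 / r ^ ?k) * indicator (ball a r) y \<le> 1 / ennreal (norm (a - y) ^ ?k)"
      by (auto simp: indicator_def)
  qed
  also have "\<dots> \<le> 1" using assms by (simp add: admissible_def)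
  finally have "ennreal (r ^ ?k) * (ennreal (1 / r ^ ?k) * emeasure \<nu> (ball a r)) \<le> ennreal (r ^ ?k) * 1"
    by (rule mult_left_mono) simp
  also have "ennreal (r ^ ?k) * (ennreal (1 / r ^ ?k) * emeasure \<nu> (ball a r)) = emeasure \<nu> (ball a r)"
    using rk by (simp flip: mult.assoc ennreal_mult')
  finally show ?thesis by simp
qed

lemma capacity_ball_le:
  fixes a :: "real ^ 'd"
  assumes "0 < r"
  shows "capacity (ball a r) \<le> ennreal (r ^ (CARD('d) - 2))"
  using times_capacity_le[of "\<lambda>_. 1" "ball a r" "ennreal (r ^ (CARD('d) - 2))" "ball a r" 1]
    admissible_ball[OF _ assms, of _ a]
  by (auto simp: admissible_def)

section \<open>Integrals of negative powers of the distance\<close>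

text \<open>The summation behind every dyadic estimate below: a function dominated by weighted indicators whose
integrals decay geometrically.\<close>

lemma nn_integral_geometric_shells:
  fixes M :: "(real ^ 'd) measure" and U :: "nat \<Rightarrow> (real ^ 'd) set"
  assumes s: "sets M = sets borel" and c: "0 \<le> c" and w: "\<And>j. 0 \<le> w j"
    and U: "\<And>j. U j \<in> sets borel"
    and f: "AE y in M. f y \<le> (\<Sum>j. ennreal (w j) * indicator (U j) y)"
    and b: "\<And>j. emeasure M (U j) \<le> ennreal (v j)" 
    and g: "\<And>j. w j * v j \<le> c * (1 / 2) ^ j"
  shows "(\<integral>\<^sup>+ y. f y \<partial>M) \<le> ennreal (2 * c)"
proof -
  have [measurable]: "\<And>j. U j \<in> sets M" using s U by auto
  have "(\<integral>\<^sup>+ y. f y \<partial>M) \<le> (\<integral>\<^sup>+ y. (\<Sum>j. ennreal (w j) * indicator (U j) y) \<partial>M)"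
    by (rule nn_integral_mono_AE[OF f])
  also have "\<dots> = (\<Sum>j. ennreal (w j) * emeasure M (U j))"
    by (subst nn_integral_suminf) (auto simp: nn_integral_cmult_indicator)
  also have "\<dots> \<le> (\<Sum>j. ennreal (c * (1 / 2) ^ j))"
  proof (intro suminf_le allI)
    fix j
    have "ennreal (w j) * emeasure M (U j) \<le> ennreal (w j) * ennreal (v j)"
      by (intro mult_left_mono b) auto
    also have "\<dots> = ennreal (w j * v j)" by (simp add: ennreal_mult' w)
    also have "\<dots> \<le> ennreal (c * (1 / 2) ^ j)" by (rule ennreal_leI[OF g])
    finally show "ennreal (w j) * emeasure M (U j) \<le> ennreal (c * (1 / 2) ^ j)" .
  qed auto
  also have "\<dots> = ennreal (\<Sum>j. c * (1 / 2) ^ j)"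
    using c by (intro suminf_ennreal_eq) (auto intro!: summable_sums summable_mult summable_geometric)
  also have "(\<Sum>j. c * (1 / 2) ^ j) = 2 * c"
    by (subst suminf_mult) (auto simp: suminf_geometric summable_geometric)
  finally show ?thesis .
qed

lemma single_le_suminf_ennreal:
  fixes f :: "nat \<Rightarrow> ennreal"
  shows "f n \<le> (\<Sum>j. f j)"
  using sum_le_suminf[of f "{n}"] by simp

text \<open>A measure of dimension \<open>q\<close> at \<open>a\<close> integrates \<open>|a - y|^(-p)\<close> near \<open>a\<close> for \<open>p < q\<close>: cut the ball into the shells
between \<open>r / 2^(j+1)\<close> and \<open>r / 2^j\<close>. The gap \<open>q - p \<ge> 1\<close> supplies the geometric factor.\<close>

lemma nn_integral_power_ball_le:
  fixes M :: "(real ^ 'd) measure"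
  assumes s: "sets M = sets borel" and e: "0 \<le> e" and r: "0 < r" and pq: "p < q"
    and M: "\<And>t. 0 < t \<Longrightarrow> t \<le> r \<Longrightarrow> emeasure M (ball a t) \<le> ennreal (e * t ^ q)"
  shows "(\<integral>\<^sup>+ y \<in> ball a r. 1 / ennreal (norm (a - y) ^ p) \<partial>M)
    \<le> ennreal (2 * (2 ^ p * e * r ^ (q - p)))"
proof (rule nn_integral_geometric_shells[OF s])
  let ?U = "\<lambda>j::nat. ball a (r / 2 ^ j)"
  let ?w = "\<lambda>j::nat. (2 ^ Suc j / r) ^ p"
  show "emeasure M (?U j) \<le> ennreal (e * (r / 2 ^ j) ^ q)" for j
    using r by (intro M) (auto simp: field_simps)
  show "0 \<le> ?w j" for j using r by simp
  show "?U j \<in> sets borel" for j by simp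
  show "0 \<le> 2 ^ p * e * r ^ (q - p)" using e r by simp
  show "?w j * (e * (r / 2 ^ j) ^ q) \<le> 2 ^ p * e * r ^ (q - p) * (1 / 2) ^ j" for j
  proof -
    obtain n where n: "q = p + Suc n" using pq less_imp_Suc_add by auto
    have "?w j * (e * (r / 2 ^ j) ^ q) = 2 ^ p * e * r ^ (q - p) * ((1 / 2) ^ j) ^ Suc n"
      using r by (simp add: n power_add power_mult_distrib power_divide field_simps)
    also have "\<dots> \<le> 2 ^ p * e * r ^ (q - p) * (1 / 2) ^ j"
      using e r by (intro mult_left_mono) (auto simp: mult_le_cancel_left1 power_le_one_iff intro!: mult_left_le power_le_one)
    finally show ?thesis .
  qed
  \<comment> \<open>The kernel is infinite at \<open>a\<close>, so that point must be a null set.\<close>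
  have "emeasure M {a} = 0"
  proof -
    have "emeasure M {a} \<le> ennreal x" if x: "0 < x" for x
    proof -
      have "eventually (\<lambda>j. e * (r / 2 ^ j) ^ q < x) sequentially"
      proof (rule order_tendstoD)
        have "(\<lambda>j. e * (r * (1 / 2) ^ j) ^ q) \<longlonglongrightarrow> e * (r * 0) ^ q"
          by (intro tendsto_intros LIMSEQ_power_zero) auto
        then show "(\<lambda>j. e * (r / 2 ^ j) ^ q) \<longlonglongrightarrow> 0"
          using pq by (simp add: power_one_over power_0_left)
      qed (rule x)
      then obtain j where j: "e * (r / 2 ^ j) ^ q < x" by (auto simp: eventually_sequentially)
      have "emeasure M {a} \<le> emeasure M (?U j)"
        using r s by (intro emeasure_mono) auto
      also have "\<dots> \<le> ennreal (e * (r / 2 ^ j) ^ q)"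
        using r by (intro M) (auto simp: field_simps)
      also have "\<dots> \<le> ennreal x" using j by (intro ennreal_leI) simp
      finally show ?thesis .
    qed
    then have "emeasure M {a} \<le> 0 + ennreal x" if "0 < x" for x using that by simp
    then show ?thesis using ennreal_le_epsilon[of 0 "emeasure M {a}"] by simp
  qed
  then have "AE y in M. y \<noteq> a"
    using s by (intro AE_I[of _ _ "{a}"]) auto
  then show "AE y in M. 1 / ennreal (norm (a - y) ^ p) * indicator (ball a r) y
      \<le> (\<Sum>j. ennreal (?w j) * indicator (?U j) y)"
  proof eventually_elim
    fix y assume ya: "y \<noteq> a"
    let ?P = "\<lambda>j. r / 2 ^ Suc j \<le> norm (a - y)"
    show "1 / ennreal (norm (a - y) ^ p) * indicator (ball a r) y
      \<le> (\<Sum>j. ennreal (?w j) * indicator (?U j) y)"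
    proof (cases "y \<in> ball a r")
      case True
      have "\<exists>j. ?P j"
      proof -
        obtain j where "(1 / 2) ^ j < norm (a - y) / r"
          using real_arch_pow_inv[of "norm (a - y) / r" "1 / 2"] ya r by auto
        then have "(1 / 2) ^ j * r < norm (a - y)" by (simp only: pos_less_divide_eq[OF r])
        moreover have "r / 2 ^ Suc j \<le> (1 / 2) ^ j * r" using r by (simp add: power_one_over field_simps)
        ultimately show ?thesis by (intro exI[of _ j]) linarith
      qed
      define j where "j = (LEAST j. ?P j)"
      have j: "?P j" unfolding j_def using \<open>\<exists>j. ?P j\<close> by (rule LeastI_ex)
      have yU: "y \<in> ?U j"
      proof (cases j)
        case 0 then show ?thesis using True by simp
      next
        case (Suc i)
        then have "\<not> ?P i" unfolding j_def using not_less_Least[of i ?P] by (auto simp: j_def)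
        then show ?thesis by (simp add: Suc dist_norm)
      qed
      have "1 / norm (a - y) ^ p \<le> ?w j"
      proof -
        have "1 / norm (a - y) \<le> 2 ^ Suc j / r"
          using j r ya by (simp add: field_simps)
        then have "(1 / norm (a - y)) ^ p \<le> ?w j"
          by (intro power_mono) auto
        then show ?thesis by (simp add: power_one_over)
      qed
      then have "1 / ennreal (norm (a - y) ^ p) \<le> ennreal (?w j)"
        using ya by (subst one_divide_ennreal) (auto intro: ennreal_leI)
      also have "\<dots> = ennreal (?w j) * indicator (?U j) y" using yU by simp
      also have "\<dots> \<le> (\<Sum>j. ennreal (?w j) * indicator (?U j) y)"
        by (rule single_le_suminf_ennreal)
      finally show ?thesis using True by simp
    qed auto
  qed
qed

text \<open>The counterpart outside a ball, with the exponent one above the dimension, by shells of radii \<open>2^j r\<close>.\<close>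

lemma nn_integral_power_far_le:
  fixes M :: "(real ^ 'd) measure"
  assumes s: "sets M = sets borel" and e: "0 \<le> e" and r: "0 < r" and pq: "p = Suc q"
    and M: "\<And>t. r \<le> t \<Longrightarrow> emeasure M (ball a t) \<le> ennreal (e * t ^ q)"
  shows "(\<integral>\<^sup>+ y \<in> - ball a r. 1 / ennreal (norm (a - y) ^ p) \<partial>M)
    \<le> ennreal (2 * (2 ^ q * e / r))"
proof (rule nn_integral_geometric_shells[OF s])
  let ?U = "\<lambda>j::nat. ball a (2 ^ Suc j * r)"
  let ?w = "\<lambda>j::nat. 1 / (2 ^ j * r) ^ p"
  show "emeasure M (?U j) \<le> ennreal (e * (2 ^ Suc j * r) ^ q)" for j
  proof (intro M)
    have "1 * r \<le> 2 ^ Suc j * r" using r by (intro mult_right_mono one_le_power) auto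
    then show "r \<le> 2 ^ Suc j * r" by simp
  qed
  show "0 \<le> ?w j" for j using r by simp
  show "?U j \<in> sets borel" for j by simp
  show "0 \<le> 2 ^ q * e / r" using e r by simp
  show "?w j * (e * (2 ^ Suc j * r) ^ q) \<le> 2 ^ q * e / r * (1 / 2) ^ j" for j
    using r by (simp add: pq power_mult_distrib power_divide field_simps)
  show "AE y in M. 1 / ennreal (norm (a - y) ^ p) * indicator (- ball a r) y
      \<le> (\<Sum>j. ennreal (?w j) * indicator (?U j) y)"
  proof (intro AE_I2)
    fix y
    let ?P = "\<lambda>j. norm (a - y) < 2 ^ Suc j * r"
    show "1 / ennreal (norm (a - y) ^ p) * indicator (- ball a r) y
      \<le> (\<Sum>j. ennreal (?w j) * indicator (?U j) y)"
    proof (cases "y \<in> - ball a r")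
      case True
      then have ry: "r \<le> norm (a - y)" by (simp add: dist_norm)
      have "\<exists>j. ?P j"
      proof -
        obtain j where "norm (a - y) / r < 2 ^ j" using real_arch_pow[of 2] by auto
        then have "norm (a - y) < 2 ^ j * r" by (simp only: pos_divide_less_eq[OF r])
        also have "\<dots> \<le> 2 ^ Suc j * r" using r by simp
        finally show ?thesis ..
      qed
      define j where "j = (LEAST j. ?P j)"
      have j: "?P j" unfolding j_def using \<open>\<exists>j. ?P j\<close> by (rule LeastI_ex)
      have yU: "2 ^ j * r \<le> norm (a - y)"
      proof (cases j)
        case 0 then show ?thesis using ry by simp
      next
        case (Suc i)
        then have "\<not> ?P i" unfolding j_def using not_less_Least[of i ?P] by (auto simp: j_def)
        then show ?thesis by (simp add: Suc)
      qed
      have "1 / norm (a - y) ^ p \<le> ?w j"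
        using r yU by (intro frac_le power_mono) auto
      then have "1 / ennreal (norm (a - y) ^ p) \<le> ennreal (?w j)"
        using ry r order.strict_trans2[OF r ry]
        by (subst one_divide_ennreal) (auto intro!: ennreal_leI zero_less_power)
      also have "\<dots> = ennreal (?w j) * indicator (?U j) y" using j by (simp add: dist_norm)
      also have "\<dots> \<le> (\<Sum>j. ennreal (?w j) * indicator (?U j) y)"
        by (rule single_le_suminf_ennreal)
      finally show ?thesis using True by simp
    qed auto
  qed
qed

section \<open>Lebesgue measure and capacity\<close>

lemma power_split_two:
  fixes r :: real
  assumes "2 \<le> n"
  shows "r ^ n = r ^ (n - 2) * r\<^sup>2"
  using assms by (metis le_add_diff_inverse2 power_add)

lemma ennreal_one_divide_mult_cancel:
  assumes "0 < t"
  shows "ennreal (1 / t) * (ennreal t * c) = c"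
  using assms by (simp flip: mult.assoc ennreal_mult')

lemma emeasure_lborel_ball:
  fixes a :: "real ^ 'd"
  assumes "0 \<le> r"
  shows "emeasure lborel (ball a r) = ennreal (unit_ball_vol (real CARD('d)) * r ^ CARD('d))"
  using assms by (simp add: emeasure_ball)

text \<open>Among the points of \<open>E\<close>, those within \<open>R\<close> of \<open>x\<close> contribute at most the integral over the whole ball, and the
others see a kernel of at most \<open>R^(-k)\<close>. The radius \<open>R\<close> is left free for later optimisation.\<close>

lemma nn_integral_lborel_kernel_le:
  fixes x :: "real ^ 'd"
  assumes d: "CARD('d) \<ge> 3" and E: "E \<in> sets borel" and R: "0 < R"
  shows "(\<integral>\<^sup>+ y \<in> E. 1 / ennreal (norm (x - y) ^ (CARD('d) - 2)) \<partial>lborel)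
    \<le> ennreal (2 ^ CARD('d) * unit_ball_vol (real CARD('d)) * R\<^sup>2)
      + ennreal (1 / R ^ (CARD('d) - 2)) * emeasure lborel E"
proof -
  let ?k = "CARD('d) - 2"
  let ?f = "\<lambda>y. 1 / ennreal (norm (x - y) ^ ?k)"
  have [measurable]: "E \<in> sets borel" "ball x R \<in> sets borel" using E by auto
  have "(\<integral>\<^sup>+ y \<in> E. ?f y \<partial>lborel)
      \<le> (\<integral>\<^sup>+ y. ?f y * indicator (ball x R) y + ennreal (1 / R ^ ?k) * indicator E y \<partial>lborel)"
  proof (intro nn_integral_mono)
    fix y
    show "?f y * indicator E y \<le> ?f y * indicator (ball x R) y + ennreal (1 / R ^ ?k) * indicator E y"
    proof (cases "y \<in> ball x R")
      case False
      then have "R \<le> norm (x - y)" by (simp add: dist_norm)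
      then have "?f y \<le> ennreal (1 / R ^ ?k)"
        using R order.strict_trans2[OF R, of "norm (x - y)"]
        by (subst one_divide_ennreal) (auto intro!: ennreal_leI zero_less_power frac_le power_mono)
      then show ?thesis by (auto simp: indicator_def)
    qed (auto simp: indicator_def)
  qed
  also have "\<dots> = (\<integral>\<^sup>+ y \<in> ball x R. ?f y \<partial>lborel) + ennreal (1 / R ^ ?k) * emeasure lborel E"
  proof -
    have "(\<lambda>y. ?f y * indicator (ball x R) y) \<in> borel_measurable lborel" by measurable
    then show ?thesis by (subst nn_integral_add) (simp_all add: nn_integral_cmult_indicator E)
  qed
  also have "(\<integral>\<^sup>+ y \<in> ball x R. ?f y \<partial>lborel)
      \<le> ennreal (2 * (2 ^ ?k * unit_ball_vol (real CARD('d)) * R ^ (CARD('d) - ?k)))"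
    using d R by (intro nn_integral_power_ball_le) (auto simp: emeasure_lborel_ball)
  also have "2 * (2 ^ ?k * unit_ball_vol (real CARD('d)) * R ^ (CARD('d) - ?k))
      = 2 * 2 ^ ?k * unit_ball_vol (real CARD('d)) * R\<^sup>2"
    using d by simp
  also have "\<dots> \<le> 2 ^ CARD('d) * unit_ball_vol (real CARD('d)) * R\<^sup>2"
  proof -
    have "(2 :: real) ^ Suc ?k \<le> 2 ^ CARD('d)" using d by (intro power_increasing) auto
    then show ?thesis by (intro mult_right_mono) auto
  qed
  finally show ?thesis by (simp add: ennreal_leI add_mono)
qed

lemma admissible_lborel:
  fixes E :: "(real ^ 'd) set"
  assumes d: "CARD('d) \<ge> 3" and E: "E \<in> sets borel" "emeasure lborel E < \<infinity>" and R: "0 < R"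
    and c: "0 \<le> c" "c * (2 ^ CARD('d) * unit_ball_vol (real CARD('d)) * R\<^sup>2
      + measure lborel E / R ^ (CARD('d) - 2)) \<le> 1"
  shows "admissible (density lborel (\<lambda>y. ennreal c * indicator E y))" (is "admissible ?N")
    "A \<in> sets borel \<Longrightarrow> emeasure (density lborel (\<lambda>y. ennreal c * indicator E y)) A
      = ennreal c * emeasure lborel (A \<inter> E)"
proof -
  let ?k = "CARD('d) - 2"
  have [measurable]: "E \<in> sets borel" by fact
  show em: "emeasure ?N A = ennreal c * emeasure lborel (A \<inter> E)" if "A \<in> sets borel" for A
  proof -
    have "emeasure ?N A = (\<integral>\<^sup>+ y. ennreal c * indicator (A \<inter> E) y \<partial>lborel)"
      using that by (subst emeasure_density) (auto simp: indicator_def intro!: nn_integral_cong)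
    then show ?thesis using that by (subst (asm) nn_integral_cmult_indicator) auto
  qed
  show "admissible ?N"
    unfolding admissible_def
  proof (intro conjI allI)
    show "finite_measure ?N"
      using E by (intro finite_measureI) (auto simp: em ennreal_mult_eq_top_iff)
    fix x
    have "newton_potential ?N x = (\<integral>\<^sup>+ y. ennreal c * indicator E y * (1 / ennreal (norm (x - y) ^ ?k)) \<partial>lborel)"
      unfolding newton_potential_def by (subst nn_integral_density) auto
    also have "\<dots> = ennreal c * (\<integral>\<^sup>+ y \<in> E. 1 / ennreal (norm (x - y) ^ ?k) \<partial>lborel)"
      by (subst nn_integral_cmult[symmetric]) (auto simp: ac_simps)
    also have "\<dots> \<le> ennreal c * (ennreal (2 ^ CARD('d) * unit_ball_vol (real CARD('d)) * R\<^sup>2)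
      + ennreal (1 / R ^ (CARD('d) - 2)) * emeasure lborel E)"
      by (intro mult_left_mono nn_integral_lborel_kernel_le d R) auto
    also have "emeasure lborel E = ennreal (measure lborel E)"
      using E(2) by (simp add: emeasure_eq_ennreal_measure)
    also have "ennreal c * (ennreal (2 ^ CARD('d) * unit_ball_vol (real CARD('d)) * R\<^sup>2)
      + ennreal (1 / R ^ (CARD('d) - 2)) * ennreal (measure lborel E))
      = ennreal (c * (2 ^ CARD('d) * unit_ball_vol (real CARD('d)) * R\<^sup>2
      + measure lborel E / R ^ (CARD('d) - 2)))"
      using c R by (simp flip: ennreal_mult' ennreal_plus)
    also have "\<dots> \<le> 1" using c(2) by (metis ennreal_leI ennreal_1)
    finally show "newton_potential ?N x \<le> 1" .
  qed simp
qed

text \<open>The isocapacitary inequality \<open>|E| \<le> C Cap(E)^(d/(d-2))\<close>, phrased with an auxiliary radius so that no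
fractional power occurs: with \<open>Cap E\<close> at most \<open>R^(d-2) / 2\<close>, the term \<open>|E| / R^(d-2)\<close> in the
bound on the potential of Lebesgue measure on \<open>E\<close> can be absorbed.\<close>

lemma lborel_le_of_capacity_le:
  fixes E :: "(real ^ 'd) set"
  assumes d: "CARD('d) \<ge> 3" and E: "E \<in> sets borel" "emeasure lborel E < \<infinity>" and R: "0 < R"
    and cap: "capacity E \<le> ennreal (R ^ (CARD('d) - 2) / 2)"
  shows "measure lborel E \<le> 2 ^ CARD('d) * unit_ball_vol (real CARD('d)) * R ^ CARD('d)"
proof -
  let ?k = "CARD('d) - 2"
  let ?C = "2 ^ CARD('d) * unit_ball_vol (real CARD('d))"
  define m where "m = measure lborel E"
  \<comment> \<open>An upper bound for the potential of Lebesgue measure on \<open>E\<close>.\<close>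
  define S where "S = ?C * R\<^sup>2 + m / R ^ ?k"
  have S: "0 < S" unfolding S_def m_def using R by (intro add_pos_nonneg) auto
  have adm: "admissible (density lborel (\<lambda>y. ennreal (1 / S) * indicator E y))"
    and em: "emeasure (density lborel (\<lambda>y. ennreal (1 / S) * indicator E y)) E
      = ennreal (1 / S) * emeasure lborel E"
    using admissible_lborel[OF d E R, of "1 / S"] S E(1) by (auto simp: S_def m_def)
  have "ennreal (1 / S * m) = ennreal (1 / S) * emeasure lborel E"
    unfolding m_def using E(2) S by (subst emeasure_eq_ennreal_measure) (auto simp flip: ennreal_mult')
  also have "\<dots> \<le> capacity E"
    using emeasure_le_capacity[OF adm E(1)] by (simp add: em)
  also note cap
  finally have "m / S \<le> R ^ ?k / 2" using R by (subst (asm) ennreal_le_iff) auto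
  then have "m \<le> R ^ ?k / 2 * S" using S by (simp add: pos_divide_le_eq)
  also have "\<dots> = ?C * (R ^ ?k * R\<^sup>2) / 2 + m / 2"
    using R by (simp add: S_def field_simps)
  also have "R ^ ?k * R\<^sup>2 = R ^ CARD('d)"
    using d by (intro power_split_two[symmetric]) simp
  finally show ?thesis by (simp add: m_def)
qed

lemma uniform_ball_admissible:
  fixes a :: "real ^ 'd"
  assumes d: "CARD('d) \<ge> 3" and r: "0 < r"
  shows "admissible (density lborel (\<lambda>y. ennreal (1 / ((2 ^ CARD('d) + 1) * unit_ball_vol (real CARD('d)) * r\<^sup>2))
    * indicator (ball a r) y))"
proof (rule admissible_lborel(1)[OF d _ _ r])
  let ?k = "CARD('d) - 2" and ?v = "unit_ball_vol (real CARD('d))"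
  have p: "0 < (2 ^ CARD('d) + 1) * ?v * r\<^sup>2" using r by (intro mult_pos_pos) (auto intro!: add_pos_pos)
  have rr: "r ^ CARD('d) = r ^ ?k * r\<^sup>2" using d by (intro power_split_two) simp
  have m: "measure lborel (ball a r) = ?v * r ^ CARD('d)"
    using emeasure_lborel_ball[of r a] r by (simp add: measure_def)
  show "0 \<le> 1 / ((2 ^ CARD('d) + 1) * ?v * r\<^sup>2)" using p by simp
  show "1 / ((2 ^ CARD('d) + 1) * ?v * r\<^sup>2) * (2 ^ CARD('d) * ?v * r\<^sup>2 + measure lborel (ball a r) / r ^ ?k) \<le> 1"
    using r p unfolding m rr by (simp add: distrib_right)
qed (use r in \<open>auto simp: emeasure_lborel_ball\<close>)

lemma capacity_ball_ge:
  fixes a :: "real ^ 'd"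
  assumes d: "CARD('d) \<ge> 3" and r: "0 < r"
  shows "ennreal (r ^ (CARD('d) - 2) / (2 ^ CARD('d) + 1)) \<le> capacity (ball a r)"
proof -
  let ?k = "CARD('d) - 2" and ?v = "unit_ball_vol (real CARD('d))"
  let ?p = "(2 ^ CARD('d) + 1) * ?v * r\<^sup>2"
  have p: "0 < ?p" using r by (intro mult_pos_pos) (auto intro!: add_pos_pos)
  have "1 / ?p * (?v * r ^ CARD('d)) = r ^ ?k / (2 ^ CARD('d) + 1)"
  proof -
    have "1 / (T * v * s) * (v * (q * s)) = q / T" if "v \<noteq> 0" "s \<noteq> 0" for T v s q :: real
      using that by simp
    moreover have "?v \<noteq> 0" "r\<^sup>2 \<noteq> 0" using p by auto
    moreover have "r ^ CARD('d) = r ^ ?k * r\<^sup>2" using d by (intro power_split_two) simp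
    ultimately show ?thesis by metis
  qed
  then have "ennreal (r ^ ?k / (2 ^ CARD('d) + 1)) = ennreal (1 / ?p * (?v * r ^ CARD('d)))"
    by simp
  also have "\<dots> = ennreal (1 / ?p) * emeasure lborel (ball a r)"
    using p r by (subst ennreal_mult') (auto simp: emeasure_lborel_ball)
  also have "\<dots> = emeasure (density lborel (\<lambda>y. ennreal (1 / ?p) * indicator (ball a r) y)) (ball a r)"
  proof -
    have "emeasure (density lborel (\<lambda>y. ennreal (1 / ?p) * indicator (ball a r) y)) (ball a r)
      = (\<integral>\<^sup>+ y. ennreal (1 / ?p) * indicator (ball a r) y \<partial>lborel)"
      by (subst emeasure_density) (auto simp: indicator_def intro!: nn_integral_cong)
    then show ?thesis by (simp add: nn_integral_cmult_indicator)
  qed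
  also have "\<dots> \<le> capacity (ball a r)"
    by (intro emeasure_le_capacity uniform_ball_admissible d r) simp
  finally show ?thesis .
qed

text \<open>A weak-type bound in capacity is a strong bound in the mean: at \<open>2^(j k)\<close> times a base level the
isocapacitary inequality gives a set of measure \<open>O((r / 2^j)^d)\<close>, and \<open>d > k\<close> makes the sum
over the levels converge.\<close>

lemma nn_integral_lborel_le_of_weak_capacity:
  fixes Q :: "real ^ 'd \<Rightarrow> real"
  assumes d: "CARD('d) \<ge> 3" and Q: "Q \<in> borel_measurable borel" and e: "0 < e" and r: "0 < r"
    and cap: "\<And>t. 0 < t \<Longrightarrow> ennreal t * capacity {x \<in> ball a r. Q x > t} \<le> ennreal (e * r ^ (CARD('d) - 2))"
  shows "(\<integral>\<^sup>+ x \<in> ball a r. ennreal (Q x) \<partial>lborel)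
    \<le> ennreal (4 ^ (CARD('d) + 1) * unit_ball_vol (real CARD('d)) * e * r ^ CARD('d))"
proof -
  let ?k = "CARD('d) - 2" and ?v = "unit_ball_vol (real CARD('d))"
  \<comment> \<open>Levels at which the capacity bound becomes \<open>(r / 2^j)^k / 2\<close>, so that \<open>r / 2^j\<close> is the radius to use.\<close>
  let ?t = "\<lambda>j::nat. 2 ^ (j * ?k) * (2 * e)"
  let ?U = "\<lambda>j. {x \<in> ball a r. Q x > ?t j}"
  let ?c = "4 ^ CARD('d) * ?v * e * r ^ CARD('d)"
  have [measurable]: "Q \<in> borel_measurable borel" by fact
  have U: "?U j \<in> sets borel" for j by measurable
  have k: "1 \<le> ?k" using d by simp
  have B: "(\<integral>\<^sup>+ x \<in> ?U 0. ennreal (Q x) \<partial>lborel) \<le> ennreal (2 * ?c)"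
  proof (rule nn_integral_geometric_shells)
    show "emeasure lborel (?U j) \<le> ennreal (2 ^ CARD('d) * ?v * (r / 2 ^ j) ^ CARD('d))" for j
    proof -
      have "emeasure lborel (?U j) \<le> emeasure lborel (ball a r)"
        using U by (intro emeasure_mono) auto
      then have fin: "emeasure lborel (?U j) < \<infinity>"
        using r by (auto simp: emeasure_lborel_ball intro: le_less_trans)
      have t: "0 < ?t j" using e by simp
      have "capacity (?U j) = ennreal (1 / ?t j) * (ennreal (?t j) * capacity (?U j))"
        by (rule ennreal_one_divide_mult_cancel[OF t, symmetric])
      also have "\<dots> \<le> ennreal (1 / ?t j) * ennreal (e * r ^ ?k)"
        using cap[OF t] by (intro mult_left_mono) auto
      also have "\<dots> = ennreal (1 / ?t j * (e * r ^ ?k))"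
        using t by (subst ennreal_mult') (auto intro: less_imp_le)
      also have "1 / ?t j * (e * r ^ ?k) = (r / 2 ^ j) ^ ?k / 2"
        using e by (simp add: power_divide power_mult field_simps)
      finally have "measure lborel (?U j) \<le> 2 ^ CARD('d) * ?v * (r / 2 ^ j) ^ CARD('d)"
        using r by (intro lborel_le_of_capacity_le d U fin) auto
      then show ?thesis
        using fin by (subst emeasure_eq_ennreal_measure) (auto intro: ennreal_leI)
    qed
    show "0 \<le> ?t (Suc j)" for j using e by simp
    show "?t (Suc j) * (2 ^ CARD('d) * ?v * (r / 2 ^ j) ^ CARD('d)) \<le> ?c * (1 / 2) ^ j" for j
    proof -
      obtain n where n: "CARD('d) = n + 2" using d by (metis add.commute le_add_diff_inverse2 numeral_2_eq_2 Suc_leD numeral_3_eq_3)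
      have "?t (Suc j) * (2 ^ CARD('d) * ?v * (r / 2 ^ j) ^ CARD('d))
        = 2 ^ Suc ?k * 2 ^ CARD('d) * ?v * e * r ^ CARD('d) * (2 ^ (j * ?k) / (2 ^ j) ^ CARD('d))"
        by (simp add: power_divide power_add)
      also have "2 ^ (j * ?k) / (2 ^ j) ^ CARD('d) = ((1 / 2) ^ j * (1 / 2) ^ j :: real)"
        unfolding n by (simp add: power_add power_mult power2_eq_square power_one_over field_simps)
      also have "2 ^ Suc ?k * 2 ^ CARD('d) * ?v * e * r ^ CARD('d) * ((1 / 2) ^ j * (1 / 2) ^ j)
        \<le> 2 ^ CARD('d) * 2 ^ CARD('d) * ?v * e * r ^ CARD('d) * ((1 / 2) ^ j * 1)"
      proof (rule mult_mono)
        show "2 ^ Suc ?k * 2 ^ CARD('d) * ?v * e * r ^ CARD('d)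
          \<le> 2 ^ CARD('d) * 2 ^ CARD('d) * ?v * e * r ^ CARD('d)"
          using d e r by (intro mult_right_mono power_increasing) auto
        show "(1 / 2) ^ j * (1 / 2) ^ j \<le> (1 / 2) ^ j * (1 :: real)"
          by (intro mult_left_mono power_le_one) auto
      qed (use e r in auto)
      also have "\<dots> = ?c * (1 / 2) ^ j" by (simp flip: power_mult_distrib)
      finally show ?thesis .
    qed
    show "AE x in lborel. ennreal (Q x) * indicator (?U 0) x
      \<le> (\<Sum>j. ennreal (?t (Suc j)) * indicator (?U j) x)"
    proof (intro AE_I2)
      fix x
      show "ennreal (Q x) * indicator (?U 0) x
        \<le> (\<Sum>j. ennreal (?t (Suc j)) * indicator (?U j) x)"
      proof (cases "x \<in> ball a r \<and> 2 * e < Q x")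
        case True
        let ?P = "\<lambda>j. Q x \<le> ?t j"
        have "\<exists>j. ?P j"
        proof -
          obtain j where j: "Q x / (2 * e) < 2 ^ j" using real_arch_pow[of 2] by auto
          have "(2 :: real) ^ j \<le> 2 ^ (j * ?k)" using k by (intro power_increasing) auto
          with j have "Q x / (2 * e) \<le> 2 ^ (j * ?k)" by linarith
          then have "Q x \<le> ?t j" using e by (simp only: pos_divide_le_eq[of "2 * e"] mult_pos_pos zero_less_numeral)
          then show ?thesis ..
        qed
        define n where "n = (LEAST j. ?P j)"
        have n: "?P n" unfolding n_def using \<open>\<exists>j. ?P j\<close> by (rule LeastI_ex)
        obtain j where j: "n = Suc j" using n True by (cases n) auto
        then have "\<not> ?P j" using not_less_Least[of j ?P] by (auto simp: n_def)
        then have xU: "x \<in> ?U j" using True by simp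
        have "ennreal (Q x) \<le> ennreal (?t (Suc j)) * indicator (?U j) x"
          using n xU unfolding j by (simp add: ennreal_leI)
        also have "\<dots> \<le> (\<Sum>j. ennreal (?t (Suc j)) * indicator (?U j) x)"
          by (rule single_le_suminf_ennreal)
        finally show ?thesis using True by simp
      qed auto
    qed
  qed (use e r U in \<open>auto intro!: mult_nonneg_nonneg\<close>)
  have "(\<integral>\<^sup>+ x \<in> ball a r. ennreal (Q x) \<partial>lborel)
      \<le> (\<integral>\<^sup>+ x. ennreal (2 * e) * indicator (ball a r) x + ennreal (Q x) * indicator (?U 0) x \<partial>lborel)"
    by (intro nn_integral_mono) (auto simp: indicator_def intro: ennreal_leI)
  also have "\<dots> = ennreal (2 * e) * emeasure lborel (ball a r) + (\<integral>\<^sup>+ x \<in> ?U 0. ennreal (Q x) \<partial>lborel)"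
  proof -
    have "(\<lambda>x. ennreal (Q x) * indicator (?U 0) x) \<in> borel_measurable lborel"
      using U[of 0] by (intro borel_measurable_times_ennreal borel_measurable_indicator) simp_all
    moreover have "(\<lambda>x. ennreal (2 * e) * indicator (ball a r) x) \<in> borel_measurable lborel"
      by (intro borel_measurable_times_ennreal borel_measurable_indicator) simp_all
    ultimately show ?thesis by (subst nn_integral_add) (simp_all add: nn_integral_cmult_indicator)
  qed
  also have "\<dots> \<le> ennreal (2 * e) * emeasure lborel (ball a r) + ennreal (2 * ?c)"
    by (intro add_left_mono B)
  also have "\<dots> = ennreal (2 * e * ?v * r ^ CARD('d) + 2 * ?c)"
    using e r by (simp add: emeasure_lborel_ball mult.assoc flip: ennreal_mult' ennreal_plus)
  also have "\<dots> \<le> ennreal (4 * ?c)"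
  proof (rule ennreal_leI)
    have "1 * (?v * e * r ^ CARD('d)) \<le> 4 ^ CARD('d) * (?v * e * r ^ CARD('d))"
      using e r by (intro mult_right_mono one_le_power mult_nonneg_nonneg) auto
    then show "2 * e * ?v * r ^ CARD('d) + 2 * ?c \<le> 4 * ?c" by (simp add: ac_simps)
  qed
  finally show ?thesis by (simp add: ac_simps)
qed

section \<open>The Laplacian of a bump function\<close>

lemma continuous_compact_support_integrable:
  fixes F :: "real ^ 'd \<Rightarrow> real"
  assumes F: "continuous_on UNIV F" and supp: "\<And>x. x \<notin> cball a R \<Longrightarrow> F x = 0"
  shows "integrable lborel F"
proof -
  have "integrable lborel (\<lambda>x. indicator (cball a R) x *\<^sub>R F x)"
    by (intro borel_integrable_compact continuous_on_subset[OF F]) auto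
  also have "(\<lambda>x. indicator (cball a R) x *\<^sub>R F x) = F"
    using supp by (auto simp: indicator_def fun_eq_iff)
  finally show ?thesis .
qed

text \<open>The difference quotients of \<open>F\<close> have integral zero because Lebesgue measure is translation invariant, and
they converge to the derivative boundedly. This replaces the divergence theorem.\<close>

lemma integral_directional_derivative_eq_zero:
  fixes F F' :: "real ^ 'd \<Rightarrow> real"
  assumes der: "\<And>x. ((\<lambda>h. F (x + h *\<^sub>R b)) has_real_derivative F' x) (at 0)"
    and F: "continuous_on UNIV F" "continuous_on UNIV F'"
    and supp: "\<And>x. x \<notin> cball a R \<Longrightarrow> F x = 0" "\<And>x. x \<notin> cball a R \<Longrightarrow> F' x = 0"
  shows "integral\<^sup>L lborel F' = 0"
proof -
  have [measurable]: "F \<in> borel_measurable borel" "F' \<in> borel_measurable borel"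
    using F by (auto intro: borel_measurable_continuous_onI)
  have der': "((\<lambda>h. F (x + h *\<^sub>R b)) has_real_derivative F' (x + h *\<^sub>R b)) (at h)" for x h
  proof -
    have "((\<lambda>t. F (x + (t + h) *\<^sub>R b)) has_real_derivative F' (x + h *\<^sub>R b)) (at 0)"
      using der[of "x + h *\<^sub>R b"] by (simp add: scaleR_add_left ac_simps)
    then show ?thesis using DERIV_shift[of "\<lambda>h. F (x + h *\<^sub>R b)" "F' (x + h *\<^sub>R b)" 0 h] by simp
  qed
  have "bounded (F' ` cball a R)"
    by (intro compact_imp_bounded compact_continuous_image continuous_on_subset[OF F(2)]) auto
  then obtain B where B: "0 < B" "\<And>x. x \<in> cball a R \<Longrightarrow> \<bar>F' x\<bar> \<le> B"
    unfolding bounded_pos by auto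
  have B': "\<bar>F' x\<bar> \<le> B" for x using B supp(2)[of x] by (cases "x \<in> cball a R") auto
  define h :: "nat \<Rightarrow> real" where "h n = 1 / real (Suc n)" for n
  have h: "0 < h n" "h n \<le> 1" for n by (auto simp: h_def)
  define D where "D n x = (F (h n *\<^sub>R b + x) - F x) / h n" for n x
  have D_bound: "\<bar>D n x\<bar> \<le> B * indicator (cball a (R + norm b)) x" for n x
  proof (cases "x \<in> cball a (R + norm b)")
    case True
    obtain z where "F (x + h n *\<^sub>R b) - F (x + 0 *\<^sub>R b) = (h n - 0) * F' (x + z *\<^sub>R b)"
      using MVT2[of 0 "h n" "\<lambda>t. F (x + t *\<^sub>R b)" "\<lambda>t. F' (x + t *\<^sub>R b)"] der' h by blast
    then have "D n x = F' (x + z *\<^sub>R b)" using h[of n] by (simp add: D_def add.commute)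
    then show ?thesis using B' True by simp
  next
    case False
    have "norm (h n *\<^sub>R b) \<le> norm b" using h[of n] by (simp add: mult_left_le_one_le)
    moreover have "dist a x \<le> dist a (h n *\<^sub>R b + x) + norm (h n *\<^sub>R b)"
      using dist_triangle[of a x "h n *\<^sub>R b + x"] by (simp add: dist_norm)
    ultimately have "h n *\<^sub>R b + x \<notin> cball a R" using False by auto
    moreover have "x \<notin> cball a R" using False norm_ge_zero[of b] by (auto simp del: norm_ge_zero)
    ultimately show ?thesis using supp B(1) by (simp add: D_def)
  qed
  have int_F: "integrable lborel F" by (rule continuous_compact_support_integrable[OF F(1) supp(1)])
  have shift: "integrable lborel (\<lambda>x. F (c + x))" "integral\<^sup>L lborel (\<lambda>x. F (c + x)) = integral\<^sup>L lborel F" for c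
  proof -
    show "integrable lborel (\<lambda>x. F (c + x))"
      using int_F by (subst (asm) lborel_distr_plus[of c, symmetric]) (subst (asm) integrable_distr_eq, auto)
    show "integral\<^sup>L lborel (\<lambda>x. F (c + x)) = integral\<^sup>L lborel F"
      by (subst (2) lborel_distr_plus[of c, symmetric]) (subst integral_distr, auto)
  qed
  have "(\<lambda>n. integral\<^sup>L lborel (D n)) \<longlonglongrightarrow> integral\<^sup>L lborel F'"
  proof (rule integral_dominated_convergence[where w = "\<lambda>x. B * indicator (cball a (R + norm b)) x"])
    show "integrable lborel (\<lambda>x. B * indicator (cball a (R + norm b)) x)"
      using emeasure_bounded_finite[OF bounded_cball, of a "R + norm b"]
      by (intro integrable_mult_right integrable_real_indicator) auto
    show "AE x in lborel. (\<lambda>n. D n x) \<longlonglongrightarrow> F' x"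
    proof (intro AE_I2)
      fix x
      have "((\<lambda>t. (F (x + t *\<^sub>R b) - F x) / t) \<longlongrightarrow> F' x) (at 0)"
        using der[of x] by (simp add: has_field_derivative_iff)
      moreover have "filterlim h (at 0) sequentially"
      proof (rule filterlim_atI)
        have "h = (\<lambda>n. inverse (real (Suc n)))" by (auto simp: h_def inverse_eq_divide)
        then show "h \<longlonglongrightarrow> 0" using LIMSEQ_inverse_real_of_nat by simp
        show "\<forall>\<^sub>F n in sequentially. h n \<noteq> 0" by (simp add: h_def)
      qed
      ultimately have "((\<lambda>n. (F (x + h n *\<^sub>R b) - F x) / h n) \<longlongrightarrow> F' x) sequentially"
        by (rule filterlim_compose)
      then show "(\<lambda>n. D n x) \<longlonglongrightarrow> F' x" by (simp add: D_def add.commute)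
    qed
    show "AE x in lborel. norm (D n x) \<le> B * indicator (cball a (R + norm b)) x" for n
      using D_bound by simp
    show "D n \<in> borel_measurable lborel" for n unfolding D_def by measurable
  qed simp
  moreover have "integral\<^sup>L lborel (D n) = 0" for n
    unfolding D_def using shift int_F by simp
  ultimately show ?thesis by (simp add: LIMSEQ_const_iff)
qed

lemma DERIV_pos_part_power:
  "((\<lambda>t :: real. max 0 t ^ Suc (Suc n)) has_real_derivative real (Suc (Suc n)) * max 0 t ^ Suc n) (at t)"
proof -
  consider "t < 0" | "t = 0" | "0 < t" by linarith
  then show ?thesis
  proof cases
    case 1
    have "((\<lambda>_. 0) has_real_derivative 0) (at t)" by simp
    then have "((\<lambda>t :: real. max 0 t ^ Suc (Suc n)) has_real_derivative 0) (at t)"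
      by (rule has_field_derivative_transform_within_open[of _ _ _ "{..<0}"]) (use 1 in auto)
    then show ?thesis using 1 by simp
  next
    case 3
    have "((\<lambda>t. t ^ Suc (Suc n)) has_real_derivative real (Suc (Suc n)) * t ^ Suc n) (at t)"
      using DERIV_pow[of "Suc (Suc n)" t] by simp
    then have "((\<lambda>t :: real. max 0 t ^ Suc (Suc n)) has_real_derivative real (Suc (Suc n)) * t ^ Suc n) (at t)"
      by (rule has_field_derivative_transform_within_open[of _ _ _ "{0<..}"]) (use 3 in auto)
    then show ?thesis using 3 by simp
  next
    case 2
    have "((\<lambda>h :: real. max 0 h ^ Suc (Suc n) / h) \<longlongrightarrow> 0) (at 0)"
    proof (rule Lim_null_comparison)
      show "eventually (\<lambda>h :: real. norm (max 0 h ^ Suc (Suc n) / h) \<le> \<bar>h\<bar> ^ Suc n) (at 0)"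
      proof (intro always_eventually allI)
        fix h :: real
        show "norm (max 0 h ^ Suc (Suc n) / h) \<le> \<bar>h\<bar> ^ Suc n"
          using zero_le_power_abs[of h "Suc n"]
          by (cases "0 < h") (simp_all del: zero_le_power_abs)
      qed
      show "((\<lambda>h :: real. \<bar>h\<bar> ^ Suc n) \<longlongrightarrow> 0) (at 0)"
        by (auto intro!: tendsto_eq_intros)
    qed
    then show ?thesis using 2 by (simp add: has_field_derivative_iff)
  qed
qed

lemma DERIV_norm_power2_line:
  fixes x y :: "real ^ 'd"
  shows "((\<lambda>h. (norm (x + h *\<^sub>R axis i 1 - y))\<^sup>2) has_real_derivative 2 * (x $ i - y $ i)) (at 0)"
proof -
  have "(norm (x + h *\<^sub>R axis i 1 - y))\<^sup>2 = (norm (x - y))\<^sup>2 + 2 * h * (x $ i - y $ i) + h\<^sup>2" for h :: real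
  proof -
    have "x + h *\<^sub>R axis i 1 - y = (x - y) + h *\<^sub>R axis i 1" by simp
    then show ?thesis
      by (simp only: power2_norm_eq_inner)
        (simp add: inner_add_left inner_add_right inner_axis inner_commute[of "axis i 1"] power2_eq_square algebra_simps)
  qed
  then show ?thesis by (auto intro!: derivative_eq_intros)
qed

text \<open>The case \<open>n = 3\<close> is the test function, twice continuously differentiable; the cases \<open>n = 2\<close> and \<open>n = 1\<close>
occur in its derivatives.\<close>

definition bump :: "real ^ 'd \<Rightarrow> real \<Rightarrow> nat \<Rightarrow> real ^ 'd \<Rightarrow> real" where
  "bump a r n x = max 0 (r\<^sup>2 - (norm (x - a))\<^sup>2) ^ n"

text \<open>The Laplacian of \<open>bump a r 3\<close>.\<close>

definition bump_laplacian :: "real ^ 'd \<Rightarrow> real \<Rightarrow> real ^ 'd \<Rightarrow> real" where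
  "bump_laplacian a r x = 24 * (norm (x - a))\<^sup>2 * bump a r 1 x - 6 * real CARD('d) * bump a r 2 x"

lemma continuous_bump [continuous_intros]: "continuous_on S (bump a r n)"
  unfolding bump_def by (intro continuous_intros)

lemma continuous_bump_laplacian [continuous_intros]: "continuous_on S (bump_laplacian a r)"
  unfolding bump_laplacian_def by (intro continuous_intros)

lemma bump_outside:
  assumes "0 < r" "0 < n" "x \<notin> ball a r"
  shows "bump a r n x = 0"
proof -
  have "r\<^sup>2 \<le> (norm (x - a))\<^sup>2"
    using assms by (intro power_mono) (auto simp: dist_norm norm_minus_commute)
  then show ?thesis using assms by (simp add: bump_def)
qed

lemma bump_bounds:
  assumes "0 < r"
  shows "0 \<le> bump a r n x" "bump a r n x \<le> (r\<^sup>2) ^ n"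
  using assms unfolding bump_def by (auto intro!: power_mono)

lemma bump_laplacian_outside:
  assumes "0 < r" "x \<notin> ball a r"
  shows "bump_laplacian a r x = 0"
  using assms by (simp add: bump_laplacian_def bump_outside)

lemma bump_laplacian_bound:
  fixes a :: "real ^ 'd"
  assumes "0 < r"
  shows "\<bar>bump_laplacian a r x\<bar> \<le> (24 + 6 * real CARD('d)) * r ^ 4 * indicator (ball a r) x"
proof (cases "x \<in> ball a r")
  case True
  have n: "(norm (x - a))\<^sup>2 \<le> r\<^sup>2"
    using True by (intro power_mono) (auto simp: dist_norm norm_minus_commute)
  have r4: "r ^ 4 = r\<^sup>2 * r\<^sup>2" by (simp flip: power_add)
  have 1: "(norm (x - a))\<^sup>2 * bump a r 1 x \<le> r ^ 4" "0 \<le> (norm (x - a))\<^sup>2 * bump a r 1 x"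
    using mult_mono[OF n bump_bounds(2)[OF assms, of a 1 x]] bump_bounds(1)[OF assms, of a 1 x]
    unfolding r4 by simp_all
  have 2: "real CARD('d) * bump a r 2 x \<le> real CARD('d) * r ^ 4" "0 \<le> real CARD('d) * bump a r 2 x"
    using bump_bounds[OF assms, of a 2 x] by (auto simp flip: power_mult intro!: mult_left_mono)
  have "\<bar>bump_laplacian a r x\<bar> \<le> 24 * ((norm (x - a))\<^sup>2 * bump a r 1 x) + 6 * (real CARD('d) * bump a r 2 x)"
    unfolding bump_laplacian_def abs_le_iff using 1(2) 2(2) by (simp only: mult.assoc) linarith
  also have "\<dots> \<le> 24 * r ^ 4 + 6 * (real CARD('d) * r ^ 4)"
    using 1 2 by linarith
  finally show ?thesis using True by (simp add: algebra_simps)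
qed (use bump_laplacian_outside[OF assms] in simp)

text \<open>Green's second identity, the bump having compact support: the field with components \<open>f p\<^sub>i - \<psi> f\<^sub>i\<close>, where \<open>\<psi>\<close> is the
bump and \<open>p\<^sub>i\<close> and \<open>f\<^sub>i\<close> are the partial derivatives of \<open>\<psi>\<close> and \<open>f\<close>, has divergence \<open>f \<Delta>\<psi> - \<psi> \<Delta>f\<close>.\<close>

lemma integral_bump_laplacian:
  fixes f :: "real ^ 'd \<Rightarrow> real"
  assumes r: "0 < r"
    and f1: "\<And>i x. ((\<lambda>h. f (x + h *\<^sub>R axis i 1)) has_real_derivative f1 i x) (at 0)"
    and f2: "\<And>i x. ((\<lambda>h. f1 i (x + h *\<^sub>R axis i 1)) has_real_derivative f2 i x) (at 0)"
    and c: "continuous_on UNIV f" "\<And>i. continuous_on UNIV (f1 i)" "\<And>i. continuous_on UNIV (f2 i)"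
  shows "(LINT x|lborel. f x * bump_laplacian a r x) = (LINT x|lborel. bump a r 3 x * (\<Sum>i\<in>UNIV. f2 i x))"
proof -
  define p where "p i x = - 6 * bump a r 2 x * (x $ i - a $ i)" for i x
  define q where "q i x = 24 * bump a r 1 x * (x $ i - a $ i)\<^sup>2 - 6 * bump a r 2 x" for i x
  have db: "((\<lambda>h. bump a r (Suc (Suc n)) (x + h *\<^sub>R axis i 1)) has_real_derivative
      - 2 * real (Suc (Suc n)) * bump a r (Suc n) x * (x $ i - a $ i)) (at 0)" for i x n
  proof -
    have "((\<lambda>h. r\<^sup>2 - (norm (x + h *\<^sub>R axis i 1 - a))\<^sup>2) has_real_derivative - (2 * (x $ i - a $ i))) (at 0)"
      using DERIV_diff[OF DERIV_const DERIV_norm_power2_line] by simp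
    then have "((\<lambda>h. max 0 (r\<^sup>2 - (norm (x + h *\<^sub>R axis i 1 - a))\<^sup>2) ^ Suc (Suc n)) has_real_derivative
        real (Suc (Suc n)) * max 0 (r\<^sup>2 - (norm (x - a))\<^sup>2) ^ Suc n * - (2 * (x $ i - a $ i))) (at 0)"
      using DERIV_chain2[OF DERIV_pos_part_power] by fastforce
    then show ?thesis unfolding bump_def by (simp only: mult_ac mult_minus_left mult_minus_right)
  qed
  have dp: "((\<lambda>h. p i (x + h *\<^sub>R axis i 1)) has_real_derivative q i x) (at 0)" for i x
  proof -
    have "((\<lambda>h. bump a r 2 (x + h *\<^sub>R axis i 1)) has_real_derivative
      - 4 * bump a r 1 x * (x $ i - a $ i)) (at 0)"
      using db[of 0] by (simp add: numeral_2_eq_2)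
    moreover have "((\<lambda>h. (x + h *\<^sub>R axis i 1) $ i - a $ i) has_real_derivative 1) (at 0)"
      by (auto intro!: derivative_eq_intros simp: axis_def)
    ultimately show ?thesis unfolding p_def q_def
      by (auto intro!: derivative_eq_intros simp: power2_eq_square algebra_simps)
  qed
  have dbump: "((\<lambda>h. bump a r 3 (x + h *\<^sub>R axis i 1)) has_real_derivative p i x) (at 0)" for i x
    using db[of 1] by (simp add: numeral_3_eq_3 numeral_2_eq_2 p_def)
  have cpq: "continuous_on UNIV (p i)" "continuous_on UNIV (q i)" for i
    unfolding p_def q_def by (intro continuous_intros)+
  have b0: "bump a r 1 x = 0" "bump a r 2 x = 0" "bump a r 3 x = 0" if "x \<notin> cball a r" for x
    using that r by (auto intro!: bump_outside)
  have pq0: "p i x = 0" "q i x = 0" if "x \<notin> cball a r" for i x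
    using b0[OF that] by (auto simp: p_def q_def)
  have zero: "(LINT x|lborel. f x * q i x - bump a r 3 x * f2 i x) = 0" for i
  proof (rule integral_directional_derivative_eq_zero[where a = a and R = r])
    show "((\<lambda>h. f (x + h *\<^sub>R axis i 1) * p i (x + h *\<^sub>R axis i 1)
        - bump a r 3 (x + h *\<^sub>R axis i 1) * f1 i (x + h *\<^sub>R axis i 1)) has_real_derivative
        f x * q i x - bump a r 3 x * f2 i x) (at 0)" for x
      by (rule derivative_eq_intros f1 f2 dp dbump refl)+ simp
    show "continuous_on UNIV (\<lambda>x. f x * p i x - bump a r 3 x * f1 i x)"
      "continuous_on UNIV (\<lambda>x. f x * q i x - bump a r 3 x * f2 i x)"
      by (intro continuous_intros c cpq)+
  qed (simp_all add: b0 pq0)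
  have int1: "integrable lborel (\<lambda>x. f x * q i x - bump a r 3 x * f2 i x)" for i
    by (rule continuous_compact_support_integrable[of _ a r])
      (auto intro!: continuous_intros c cpq simp: b0 pq0)
  have "0 = (LINT x|lborel. (\<Sum>i\<in>UNIV. f x * q i x - bump a r 3 x * f2 i x))"
    using int1 zero by (subst Bochner_Integration.integral_sum) auto
  also have "(\<lambda>x. \<Sum>i\<in>UNIV. f x * q i x - bump a r 3 x * f2 i x)
      = (\<lambda>x. f x * bump_laplacian a r x - bump a r 3 x * (\<Sum>i\<in>UNIV. f2 i x))"
  proof
    fix x
    have "(norm (x - a))\<^sup>2 = (\<Sum>i\<in>UNIV. (x $ i - a $ i)\<^sup>2)"
      unfolding power2_norm_eq_inner by (simp add: inner_vec_def power2_eq_square)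
    then have "(\<Sum>i\<in>UNIV. q i x) = bump_laplacian a r x"
      by (simp add: q_def bump_laplacian_def sum_subtractf sum_distrib_left ac_simps)
    then show "(\<Sum>i\<in>UNIV. f x * q i x - bump a r 3 x * f2 i x)
      = f x * bump_laplacian a r x - bump a r 3 x * (\<Sum>i\<in>UNIV. f2 i x)"
      by (simp add: sum_subtractf flip: sum_distrib_left)
  qed
  also have "(LINT x|lborel. f x * bump_laplacian a r x - bump a r 3 x * (\<Sum>i\<in>UNIV. f2 i x))
      = (LINT x|lborel. f x * bump_laplacian a r x) - (LINT x|lborel. bump a r 3 x * (\<Sum>i\<in>UNIV. f2 i x))"
    by (intro Bochner_Integration.integral_diff; rule continuous_compact_support_integrable[of _ a r])
      (auto intro!: continuous_intros c simp: b0 bump_laplacian_outside r)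
  finally show ?thesis by simp
qed

lemma integral_affine_bump_laplacian:
  fixes v :: "real ^ 'd"
  assumes "0 < r"
  shows "(LINT x|lborel. (v \<bullet> x + c) * bump_laplacian a r x) = 0"
proof -
  have "(LINT x|lborel. (v \<bullet> x + c) * bump_laplacian a r x)
    = (LINT x|lborel. bump a r 3 x * (\<Sum>i::'d\<in>UNIV. 0))"
    by (rule integral_bump_laplacian[where ?f1.0 = "\<lambda>i x. v $ i"])
      (auto intro!: derivative_eq_intros continuous_intros assms simp: inner_add_right inner_axis)
  then show ?thesis by simp
qed

section \<open>The Newtonian kernel against the Laplacian of a bump\<close>

lemma DERIV_inverse_sqrt_power_line:
  fixes x y :: "real ^ 'd"
  assumes e: "0 < e"
  defines "s \<equiv> \<lambda>x :: real ^ 'd. sqrt ((norm (x - y))\<^sup>2 + e\<^sup>2)"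
  shows "((\<lambda>h. 1 / s (x + h *\<^sub>R axis i 1) ^ m) has_real_derivative
    - real m * (x $ i - y $ i) / s x ^ (m + 2)) (at 0)"
proof -
  have p: "0 < (norm (x - y))\<^sup>2 + e\<^sup>2" using e by (intro add_nonneg_pos) auto
  then have s0: "0 < s x" by (simp add: s_def)
  have "((\<lambda>h. (norm (x + h *\<^sub>R axis i 1 - y))\<^sup>2 + e\<^sup>2) has_real_derivative 2 * (x $ i - y $ i)) (at 0)"
    using DERIV_add[OF DERIV_norm_power2_line DERIV_const] by simp
  from DERIV_chain2[OF DERIV_real_sqrt this] p
  have "((\<lambda>h. s (x + h *\<^sub>R axis i 1)) has_real_derivative
      inverse (s x) / 2 * (2 * (x $ i - y $ i))) (at 0)"
    by (simp only: s_def scaleR_zero_left add_0_right)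
  moreover have "inverse q / 2 * (2 * D) = D / q" for q D :: real
    by (simp add: field_simps)
  ultimately have ds: "((\<lambda>h. s (x + h *\<^sub>R axis i 1)) has_real_derivative (x $ i - y $ i) / s x) (at 0)"
    by (simp only:)
  have "((\<lambda>t. inverse t ^ m) has_real_derivative - real m * inverse t ^ Suc m) (at t)" if "0 < t" for t :: real
  proof -
    have "((\<lambda>t. inverse t ^ m) has_real_derivative real m * inverse t ^ (m - 1) * - (inverse t * inverse t)) (at t)"
      using that by (auto intro!: derivative_eq_intros simp: power2_eq_square)
    moreover have "real m * inverse t ^ (m - 1) * - (inverse t * inverse t) = - real m * inverse t ^ Suc m"
      by (cases m) (auto simp: algebra_simps)
    ultimately show ?thesis by (simp only:)
  qed
  from DERIV_chain2[OF this[of "s (x + 0 *\<^sub>R axis i 1)"] ds] s0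
  have "((\<lambda>h. inverse (s (x + h *\<^sub>R axis i 1)) ^ m) has_real_derivative
    - real m * inverse (s x) ^ Suc m * ((x $ i - y $ i) / s x)) (at 0)" by simp
  then show ?thesis by (simp add: power_one_over inverse_eq_divide mult_ac)
qed

text \<open>Regularising the kernel to \<open>(|x - y|^2 + e^2)^(-k/2)\<close> makes it smooth, and its Laplacian is
\<open>- k d e^2 (|x - y|^2 + e^2)^(-d/2-1)\<close>, which is negative and concentrates at \<open>y\<close> as \<open>e\<close> tends to \<open>0\<close>.\<close>

lemma integral_regularised_kernel_bump_laplacian:
  fixes a y :: "real ^ 'd"
  assumes d: "CARD('d) \<ge> 3" and r: "0 < r" and e: "0 < e"
  defines "s \<equiv> \<lambda>x :: real ^ 'd. sqrt ((norm (x - y))\<^sup>2 + e\<^sup>2)"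
  shows "(LINT x|lborel. 1 / s x ^ (CARD('d) - 2) * bump_laplacian a r x)
    = - (real (CARD('d) - 2) * real CARD('d) * e\<^sup>2 * (LINT x|lborel. bump a r 3 x / s x ^ (CARD('d) + 2)))"
proof -
  let ?k = "CARD('d) - 2"
  have p: "0 < (norm (x - y))\<^sup>2 + e\<^sup>2" for x using e by (intro add_nonneg_pos) auto
  then have s0: "0 < s x" for x by (simp add: s_def)
  have cs: "continuous_on UNIV s" unfolding s_def by (intro continuous_intros)
  define f1 where "f1 i x = - real ?k * (x $ i - y $ i) / s x ^ (?k + 2)" for i x
  define f2 where "f2 i x = - real ?k / s x ^ (?k + 2)
    + real ?k * real (?k + 2) * (x $ i - y $ i)\<^sup>2 / s x ^ (?k + 4)" for i x
  have green: "(LINT x|lborel. 1 / s x ^ ?k * bump_laplacian a r x)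
      = (LINT x|lborel. bump a r 3 x * (\<Sum>i\<in>UNIV. f2 i x))"
  proof (rule integral_bump_laplacian[OF r])
    show "((\<lambda>h. 1 / s (x + h *\<^sub>R axis i 1) ^ ?k) has_real_derivative f1 i x) (at 0)" for i x
      using DERIV_inverse_sqrt_power_line[OF e] unfolding f1_def s_def by blast
    show "((\<lambda>h. f1 i (x + h *\<^sub>R axis i 1)) has_real_derivative f2 i x) (at 0)" for i x
    proof -
      have A: "((\<lambda>h. - real ?k * ((x + h *\<^sub>R axis i 1) $ i - y $ i)) has_real_derivative - real ?k) (at 0)"
        by (auto intro!: derivative_eq_intros simp: axis_def)
      have B: "((\<lambda>h. 1 / s (x + h *\<^sub>R axis i 1) ^ (?k + 2)) has_real_derivative
          - real (?k + 2) * (x $ i - y $ i) / s x ^ (?k + 2 + 2)) (at 0)"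
        using DERIV_inverse_sqrt_power_line[OF e, where m = "?k + 2"] unfolding s_def by simp
      have "- real ?k * (1 / s x ^ (?k + 2)) +
          (- real (?k + 2) * (x $ i - y $ i) / s x ^ (?k + 2 + 2)) * (- real ?k * (x $ i - y $ i)) = f2 i x"
      proof -
        have "- K * (1 / S) + (- L * z / T) * (- K * z) = - K / S + K * L * z\<^sup>2 / T" for K L S T z :: real
          by (simp add: power2_eq_square)
        moreover have "?k + 2 + 2 = ?k + 4" by simp
        ultimately show ?thesis unfolding f2_def by metis
      qed
      with DERIV_mult[OF A B] show ?thesis by (simp add: f1_def)
    qed
    show "continuous_on UNIV (\<lambda>x. 1 / s x ^ ?k)" "continuous_on UNIV (f1 i)" "continuous_on UNIV (f2 i)" for i
      unfolding f1_def f2_def using s0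
      by (auto intro!: continuous_intros cs simp: less_imp_neq[THEN not_sym])
  qed
  have lap: "(\<Sum>i\<in>UNIV. f2 i x) = - (real ?k * real CARD('d) * e\<^sup>2) / s x ^ (CARD('d) + 2)" for x
  proof -
    have n: "(\<Sum>i\<in>UNIV. (x $ i - y $ i)\<^sup>2) = (s x)\<^sup>2 - e\<^sup>2"
      using p[of x] unfolding s_def power2_norm_eq_inner by (simp add: inner_vec_def power2_eq_square)
    have k: "?k + 2 = CARD('d)" "?k + 4 = CARD('d) + 2" using d by auto
    have "(\<Sum>i\<in>UNIV. f2 i x) = - real ?k * real CARD('d) / s x ^ CARD('d)
        + real ?k * real CARD('d) * ((s x)\<^sup>2 - e\<^sup>2) / s x ^ (CARD('d) + 2)"
      unfolding f2_def k n[symmetric] by (simp add: sum.distrib sum_subtractf sum_distrib_left sum_divide_distrib)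
    also have "\<dots> = - (real ?k * real CARD('d) * e\<^sup>2) / s x ^ (CARD('d) + 2)"
    proof -
      have "(s x)\<^sup>2 / s x ^ (CARD('d) + 2) = 1 / s x ^ CARD('d)"
        using s0[of x] by (simp add: power_add power2_eq_square)
      moreover have "real ?k * real CARD('d) * ((s x)\<^sup>2 - e\<^sup>2) / s x ^ (CARD('d) + 2)
        = real ?k * real CARD('d) * ((s x)\<^sup>2 / s x ^ (CARD('d) + 2)) - real ?k * real CARD('d) * e\<^sup>2 / s x ^ (CARD('d) + 2)"
        by (simp add: diff_divide_distrib right_diff_distrib)
      ultimately show ?thesis by simp
    qed
    finally show ?thesis .
  qed
  have "(LINT x|lborel. bump a r 3 x * (- (real ?k * real CARD('d) * e\<^sup>2) / s x ^ (CARD('d) + 2)))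
      = - (real ?k * real CARD('d) * e\<^sup>2) * (LINT x|lborel. bump a r 3 x / s x ^ (CARD('d) + 2))"
    by (subst integral_mult_right_zero[symmetric]) (simp add: ac_simps)
  then show ?thesis unfolding green lap by simp
qed

lemma nn_integral_kernel_bump_laplacian_le:
  fixes a y :: "real ^ 'd"
  assumes d: "CARD('d) \<ge> 3" and r: "0 < r"
  shows "(\<integral>\<^sup>+ x. ennreal (1 / norm (x - y) ^ (CARD('d) - 2) * \<bar>bump_laplacian a r x\<bar>) \<partial>lborel)
    \<le> ennreal ((24 + 6 * real CARD('d)) * r ^ 4
        * ((2 ^ CARD('d) + 1) * unit_ball_vol (real CARD('d)) * r\<^sup>2))"
proof -
  let ?k = "CARD('d) - 2" and ?v = "unit_ball_vol (real CARD('d))"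
  let ?C = "(24 + 6 * real CARD('d)) * r ^ 4"
  have "(\<integral>\<^sup>+ x. ennreal (1 / norm (x - y) ^ ?k * \<bar>bump_laplacian a r x\<bar>) \<partial>lborel)
      \<le> (\<integral>\<^sup>+ x. ennreal ?C * (1 / ennreal (norm (y - x) ^ ?k) * indicator (ball a r) x) \<partial>lborel)"
  proof (intro nn_integral_mono)
    fix x
    show "ennreal (1 / norm (x - y) ^ ?k * \<bar>bump_laplacian a r x\<bar>)
        \<le> ennreal ?C * (1 / ennreal (norm (y - x) ^ ?k) * indicator (ball a r) x)"
    proof (cases "norm (x - y) ^ ?k = 0")
      case True
      then show ?thesis by (simp only: True) simp
    next
      case False
      have "1 / norm (x - y) ^ ?k * \<bar>bump_laplacian a r x\<bar>
          \<le> 1 / norm (x - y) ^ ?k * (?C * indicator (ball a r) x)"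
        by (intro mult_left_mono bump_laplacian_bound r) auto
      also have "\<dots> = ?C * (1 / norm (y - x) ^ ?k * indicator (ball a r) x)"
        by (simp add: norm_minus_commute)
      finally have "ennreal (1 / norm (x - y) ^ ?k * \<bar>bump_laplacian a r x\<bar>)
          \<le> ennreal (?C * (1 / norm (y - x) ^ ?k * indicator (ball a r) x))"
        by (rule ennreal_leI)
      also have "\<dots> = ennreal ?C * (ennreal (1 / norm (y - x) ^ ?k) * indicator (ball a r) x)"
        using r by (subst ennreal_mult') (auto simp: indicator_def)
      also have "ennreal (1 / norm (y - x) ^ ?k) = 1 / ennreal (norm (y - x) ^ ?k)"
        using False zero_le_power[OF norm_ge_zero, of "y - x" ?k]
        by (subst one_divide_ennreal) (auto simp only: norm_minus_commute order_le_less)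
      finally show ?thesis .
    qed
  qed
  also have "\<dots> = ennreal ?C * (\<integral>\<^sup>+ x \<in> ball a r. 1 / ennreal (norm (y - x) ^ ?k) \<partial>lborel)"
  proof -
    have [measurable]: "ball a r \<in> sets borel" by simp
    have "(\<lambda>x. 1 / ennreal (norm (y - x) ^ ?k) * indicator (ball a r) x) \<in> borel_measurable lborel"
      by measurable
    then show ?thesis by (rule nn_integral_cmult)
  qed
  also have "\<dots> \<le> ennreal ?C * (ennreal (2 ^ CARD('d) * ?v * r\<^sup>2)
      + ennreal (1 / r ^ ?k) * emeasure lborel (ball a r))"
    by (intro mult_left_mono nn_integral_lborel_kernel_le d r) auto
  also have "\<dots> = ennreal (?C * (2 ^ CARD('d) * ?v * r\<^sup>2 + 1 / r ^ ?k * (?v * r ^ CARD('d))))"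
    using r by (simp add: emeasure_lborel_ball flip: ennreal_mult' ennreal_plus)
  also have "1 / r ^ ?k * (?v * r ^ CARD('d)) = ?v * r\<^sup>2"
    using d r by (subst power_split_two[of "CARD('d)" r]) auto
  also have "2 ^ CARD('d) * ?v * r\<^sup>2 + ?v * r\<^sup>2 = (2 ^ CARD('d) + 1) * ?v * r\<^sup>2"
    by (simp add: algebra_simps)
  finally show ?thesis .
qed

text \<open>The kernel is superharmonic, with a point mass at \<open>y\<close> as its Laplacian up to a negative factor. The sign of the
Laplacian and a lower bound on its mass hold uniformly for the regularised kernels, and pass to the limit by
dominated convergence.\<close>

lemma kernel_bump_laplacian_integral:
  fixes a y :: "real ^ 'd"
  assumes d: "CARD('d) \<ge> 3" and r: "0 < r"
  shows "integrable lborel (\<lambda>x. 1 / norm (x - y) ^ (CARD('d) - 2) * bump_laplacian a r x)"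
    and "unit_ball_vol (real CARD('d)) / 2 ^ (CARD('d) + 10) * r ^ 6 * indicator (ball a (r / 2)) y
      \<le> - (LINT x|lborel. 1 / norm (x - y) ^ (CARD('d) - 2) * bump_laplacian a r x)"
proof -
  let ?k = "CARD('d) - 2" and ?v = "unit_ball_vol (real CARD('d))"
  let ?c = "?v / 2 ^ (CARD('d) + 10) * r ^ 6 * indicator (ball a (r / 2)) y"
  have [measurable]: "bump_laplacian a r \<in> borel_measurable borel"
    by (intro borel_measurable_continuous_onI continuous_intros)
  show int: "integrable lborel (\<lambda>x. 1 / norm (x - y) ^ ?k * bump_laplacian a r x)"
    using order.strict_trans1[OF nn_integral_kernel_bump_laplacian_le[OF d r, of y a] ennreal_less_top]
    by (intro integrableI_bounded) (auto simp: abs_mult)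
  define e where "e n = r / 4 / real (Suc n)" for n
  have e: "0 < e n" "e n \<le> r / 4" for n using r by (auto simp: e_def field_simps)
  have e_lim: "e \<longlonglongrightarrow> 0"
    unfolding e_def using tendsto_mult[OF tendsto_const LIMSEQ_inverse_real_of_nat, of "r / 4"]
    by (simp flip: divide_inverse)
  define s where "s n x = sqrt ((norm (x - y))\<^sup>2 + (e n)\<^sup>2)" for n x
  have s: "norm (x - y) \<le> s n x" "0 < s n x" for n x
  proof -
    have "sqrt ((norm (x - y))\<^sup>2) \<le> s n x" unfolding s_def by (intro real_sqrt_le_mono) auto
    then show "norm (x - y) \<le> s n x" by simp
    show "0 < s n x" unfolding s_def using e(1)[of n] by (auto intro!: add_nonneg_pos)
  qed
  have lower: "?c \<le> - (LINT x|lborel. 1 / s n x ^ ?k * bump_laplacian a r x)" for n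
  proof -
    let ?g = "\<lambda>x. bump a r 3 x / s n x ^ (CARD('d) + 2)"
    have eq: "- (LINT x|lborel. 1 / s n x ^ ?k * bump_laplacian a r x)
        = real ?k * real CARD('d) * (e n)\<^sup>2 * (LINT x|lborel. ?g x)"
      using integral_regularised_kernel_bump_laplacian[OF d r e(1)[of n], of y a]
      unfolding s_def by simp
    have g0: "0 \<le> ?g x" for x
      using s(2)[of n x] r by (intro divide_nonneg_nonneg bump_bounds zero_le_power) auto
    have "continuous_on UNIV (s n)" unfolding s_def by (intro continuous_intros)
    then have "continuous_on UNIV ?g"
      using s(2)[of n] by (intro continuous_intros) (auto simp: less_imp_neq[THEN not_sym])
    then have g_int: "integrable lborel ?g"
      using r by (rule_tac continuous_compact_support_integrable[of _ a r]) (auto simp: bump_outside)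
    show ?thesis
    proof (cases "y \<in> ball a (r / 2)")
      case False
      then show ?thesis unfolding eq using g0 by (auto intro!: mult_nonneg_nonneg integral_nonneg)
    next
      case True
      \<comment> \<open>The ball of radius \<open>e n\<close> around \<open>y\<close> already carries a fixed part of the mass of the regularised Laplacian.\<close>
      let ?B = "ball y (e n)"
      let ?m = "(r\<^sup>2 / 4) ^ 3 / (2 * e n) ^ (CARD('d) + 2)"
      have "?m * (?v * e n ^ CARD('d)) = (LINT x|lborel. ?m * indicator ?B x)"
        using e(1)[of n] by (simp add: measure_def emeasure_lborel_ball)
      also have "\<dots> \<le> (LINT x|lborel. ?g x)"
      proof (rule integral_mono[OF _ g_int])
        show "integrable lborel (\<lambda>x. ?m * indicator ?B x)"
          using emeasure_bounded_finite[OF bounded_ball, of y "e n"]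
          by (intro integrable_mult_right integrable_real_indicator) auto
        fix x
        show "?m * indicator ?B x \<le> ?g x"
        proof (cases "x \<in> ?B")
          case xB: True
          have "norm (x - a) \<le> 3 / 4 * r"
            using True xB e(2)[of n] dist_triangle[of a x y] by (simp add: dist_norm norm_minus_commute)
          then have "(norm (x - a))\<^sup>2 \<le> (3 / 4 * r)\<^sup>2" by (intro power_mono) auto
          then have "r\<^sup>2 / 4 \<le> r\<^sup>2 - (norm (x - a))\<^sup>2"
          proof -
            have "(3 / 4 * r)\<^sup>2 = 9 / 16 * r\<^sup>2" by (simp add: power2_eq_square)
            then show ?thesis
              using \<open>(norm (x - a))\<^sup>2 \<le> (3 / 4 * r)\<^sup>2\<close> zero_le_power2[of r] by linarith
          qed
          then have "(r\<^sup>2 / 4) ^ 3 \<le> bump a r 3 x" unfolding bump_def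
            by (intro power_mono order.trans[OF _ max.cobounded2]) auto
          moreover have "s n x \<le> 2 * e n"
          proof -
            have "(norm (x - y))\<^sup>2 \<le> (e n)\<^sup>2"
              using xB by (intro power_mono) (auto simp: dist_norm norm_minus_commute)
            then have "(norm (x - y))\<^sup>2 + (e n)\<^sup>2 \<le> (2 * e n)\<^sup>2"
              using zero_le_power2[of "e n"] four_x_squared[of "e n"] by linarith
            then show ?thesis unfolding s_def using e(1)[of n] by (intro real_le_lsqrt) auto
          qed
          then have "s n x ^ (CARD('d) + 2) \<le> (2 * e n) ^ (CARD('d) + 2)"
            using s(2)[of n x] by (intro power_mono) auto
          ultimately have "?m \<le> ?g x"
            using s(2)[of n x] r by (intro frac_le bump_bounds(1) zero_less_power)
          then show ?thesis using xB by simp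
        qed (use g0 in auto)
      qed
      finally have "(e n)\<^sup>2 * (?m * (?v * e n ^ CARD('d))) \<le> (e n)\<^sup>2 * (LINT x|lborel. ?g x)"
        by (intro mult_left_mono) auto
      also have "\<dots> \<le> real ?k * real CARD('d) * ((e n)\<^sup>2 * (LINT x|lborel. ?g x))"
      proof -
        have "1 * 1 \<le> real ?k * real CARD('d)" using d by (intro mult_mono) auto
        moreover have "0 \<le> (e n)\<^sup>2 * (LINT x|lborel. ?g x)" using g0 by (auto intro!: mult_nonneg_nonneg integral_nonneg)
        ultimately have "1 * 1 * ((e n)\<^sup>2 * (LINT x|lborel. ?g x))
            \<le> real ?k * real CARD('d) * ((e n)\<^sup>2 * (LINT x|lborel. ?g x))"
          by (rule mult_right_mono)
        then show ?thesis by (simp only: mult_1)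
      qed
      also have "(e n)\<^sup>2 * (?m * (?v * e n ^ CARD('d))) = ?v / 2 ^ (CARD('d) + 8) * r ^ 6"
      proof -
        have ratio: "(e n)\<^sup>2 * e n ^ CARD('d) / (2 * e n) ^ (CARD('d) + 2) = 1 / 2 ^ (CARD('d) + 2)"
          using e(1)[of n] by (simp add: power_add power_mult_distrib power2_eq_square)
        have cube: "(r\<^sup>2 / 4) ^ 3 = r ^ 6 / 2 ^ 6"
          by (simp add: power_divide flip: power_mult)
        have "(e n)\<^sup>2 * (?m * (?v * e n ^ CARD('d)))
          = (r\<^sup>2 / 4) ^ 3 * ?v * ((e n)\<^sup>2 * e n ^ CARD('d) / (2 * e n) ^ (CARD('d) + 2))"
          by simp
        also have "\<dots> = r ^ 6 / 2 ^ 6 * ?v * (1 / 2 ^ (CARD('d) + 2))"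
          by (simp only: ratio cube)
        also have "\<dots> = ?v / 2 ^ (CARD('d) + 8) * r ^ 6"
          by (simp add: power_add mult_ac)
        finally show ?thesis .
      qed
      finally have "?v / 2 ^ (CARD('d) + 8) * r ^ 6 \<le> - (LINT x|lborel. 1 / s n x ^ ?k * bump_laplacian a r x)"
        unfolding eq by (simp add: ac_simps)
      moreover have "?v / 2 ^ (CARD('d) + 10) * r ^ 6 \<le> ?v / 2 ^ (CARD('d) + 8) * r ^ 6"
        using r by (intro mult_right_mono frac_le power_increasing) auto
      ultimately show ?thesis using True by simp
    qed
  qed
  have "(\<lambda>n. LINT x|lborel. 1 / s n x ^ ?k * bump_laplacian a r x)
      \<longlonglongrightarrow> (LINT x|lborel. 1 / norm (x - y) ^ ?k * bump_laplacian a r x)"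
  proof (rule integral_dominated_convergence[where w = "\<lambda>x. norm (1 / norm (x - y) ^ ?k * bump_laplacian a r x)"])
    have ae: "AE x in lborel. x \<noteq> y" by (rule AE_lborel_singleton)
    show "AE x in lborel. (\<lambda>n. 1 / s n x ^ ?k * bump_laplacian a r x)
        \<longlonglongrightarrow> 1 / norm (x - y) ^ ?k * bump_laplacian a r x"
      using ae
    proof eventually_elim
      fix x assume "x \<noteq> y"
      have "(\<lambda>n. s n x) \<longlonglongrightarrow> sqrt ((norm (x - y))\<^sup>2 + 0\<^sup>2)"
        unfolding s_def by (intro tendsto_intros e_lim)
      then have "(\<lambda>n. s n x) \<longlonglongrightarrow> norm (x - y)" by simp
      then show "(\<lambda>n. 1 / s n x ^ ?k * bump_laplacian a r x)
        \<longlonglongrightarrow> 1 / norm (x - y) ^ ?k * bump_laplacian a r x"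
        using \<open>x \<noteq> y\<close> by (intro tendsto_intros) auto
    qed
    show "AE x in lborel. norm (1 / s n x ^ ?k * bump_laplacian a r x)
        \<le> norm (1 / norm (x - y) ^ ?k * bump_laplacian a r x)" for n
      using ae
    proof eventually_elim
      fix x assume "x \<noteq> y"
      then have "1 / s n x ^ ?k \<le> 1 / norm (x - y) ^ ?k"
        using s[where n = n and x = x] by (intro frac_le power_mono) auto
      then show "norm (1 / s n x ^ ?k * bump_laplacian a r x) \<le> norm (1 / norm (x - y) ^ ?k * bump_laplacian a r x)"
        using s(2)[of n x] by (simp only: norm_mult) (intro mult_right_mono, auto)
    qed
    show "integrable lborel (\<lambda>x. norm (1 / norm (x - y) ^ ?k * bump_laplacian a r x))"
      using int by (rule integrable_norm)
  qed (auto simp: s_def)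
  then have "(\<lambda>n. - (LINT x|lborel. 1 / s n x ^ ?k * bump_laplacian a r x))
      \<longlonglongrightarrow> - (LINT x|lborel. 1 / norm (x - y) ^ ?k * bump_laplacian a r x)"
    by (rule tendsto_minus)
  then show "?c \<le> - (LINT x|lborel. 1 / norm (x - y) ^ ?k * bump_laplacian a r x)"
    by (rule LIMSEQ_le_const) (use lower in auto)
qed

section \<open>Mass of a ball and deviation of the potential from affine functions\<close>

lemma pair_sigma_finite_lborel:
  fixes \<mu> :: "(real ^ 'd) measure"
  assumes "finite_measure \<mu>"
  shows "pair_sigma_finite (lborel :: (real ^ 'd) measure) \<mu>"
proof -
  interpret finite_measure \<mu> by fact
  show ?thesis by (intro pair_sigma_finite.intro sigma_finite_lborel) unfold_locales
qed

text \<open>The kernel in \<^typ>\<open>ennreal\<close> is infinite on the diagonal whereas the real quotient is \<open>0\<close> there; both agree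
almost everywhere, because a point at which the potential is finite carries no mass.\<close>

lemma newton_potential_finite:
  fixes \<mu> :: "(real ^ 'd) measure"
  assumes d: "CARD('d) \<ge> 3" and \<mu>: "sets \<mu> = sets borel" and fin: "newton_potential \<mu> x \<noteq> top"
  shows "AE y in \<mu>. y \<noteq> x"
    "integrable \<mu> (\<lambda>y. 1 / norm (x - y) ^ (CARD('d) - 2))"
    "enn2real (newton_potential \<mu> x) = (LINT y|\<mu>. 1 / norm (x - y) ^ (CARD('d) - 2))"
proof -
  let ?k = "CARD('d) - 2"
  have [measurable_cong]: "sets \<mu> = sets borel" by fact
  have "AE y in \<mu>. 1 / ennreal (norm (x - y) ^ ?k) \<noteq> \<infinity>"
    using fin unfolding newton_potential_def by (intro nn_integral_PInf_AE) auto
  then show ae: "AE y in \<mu>. y \<noteq> x"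
    by eventually_elim (use d in \<open>auto simp: power_0_left\<close>)
  have eq: "newton_potential \<mu> x = (\<integral>\<^sup>+ y. ennreal (1 / norm (x - y) ^ ?k) \<partial>\<mu>)"
    unfolding newton_potential_def using ae
    by (intro nn_integral_cong_AE, eventually_elim) (auto simp: one_divide_ennreal)
  then show "integrable \<mu> (\<lambda>y. 1 / norm (x - y) ^ ?k)"
    using fin by (intro integrableI_nonneg) (auto simp: less_top)
  show "enn2real (newton_potential \<mu> x) = (LINT y|\<mu>. 1 / norm (x - y) ^ ?k)"
    unfolding eq by (subst integral_eq_nn_integral) auto
qed

text \<open>By Tonelli's theorem the potential is integrable over balls.\<close>

lemma AE_newton_potential_finite:
  fixes \<mu> :: "(real ^ 'd) measure"
  assumes d: "CARD('d) \<ge> 3" and \<mu>: "finite_measure \<mu>" "sets \<mu> = sets borel" and r: "0 < r"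
  shows "AE x in lborel. x \<in> ball a r \<longrightarrow> newton_potential \<mu> x \<noteq> top"
proof -
  let ?k = "CARD('d) - 2"
  interpret finite_measure \<mu> by fact
  interpret P: pair_sigma_finite "lborel :: (real ^ 'd) measure" \<mu>
    by (rule pair_sigma_finite_lborel[OF \<mu>(1)])
  have [measurable_cong]: "sets \<mu> = sets borel" by fact
  have [measurable]: "ball a r \<in> sets borel" by simp
  let ?f = "\<lambda>x y. 1 / ennreal (norm (x - y) ^ ?k) * indicator (ball a r) x"
  let ?C = "ennreal (2 ^ CARD('d) * unit_ball_vol (real CARD('d)) * r\<^sup>2)
      + ennreal (1 / r ^ ?k) * emeasure lborel (ball a r)"
  have u: "newton_potential \<mu> \<in> borel_measurable borel" by (rule newton_potential_measurable[OF \<mu>])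
  have "(\<integral>\<^sup>+ x. newton_potential \<mu> x * indicator (ball a r) x \<partial>lborel) = (\<integral>\<^sup>+ x. (\<integral>\<^sup>+ y. ?f x y \<partial>\<mu>) \<partial>lborel)"
    unfolding newton_potential_def by (intro nn_integral_cong nn_integral_multc[symmetric]) measurable
  also have "\<dots> = (\<integral>\<^sup>+ y. (\<integral>\<^sup>+ x. ?f x y \<partial>lborel) \<partial>\<mu>)"
    by (rule P.Fubini'[symmetric]) measurable
  also have "\<dots> \<le> (\<integral>\<^sup>+ y. ?C \<partial>\<mu>)"
    using nn_integral_lborel_kernel_le[OF d, of "ball a r" r] r
    by (intro nn_integral_mono) (simp add: norm_minus_commute)
  also have "\<dots> < top"
    using r by (simp add: emeasure_lborel_ball ennreal_mult_less_top emeasure_eq_measure)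
  finally have "AE x in lborel. newton_potential \<mu> x * indicator (ball a r) x \<noteq> \<infinity>"
    using u by (intro nn_integral_PInf_AE) auto
  then show ?thesis by eventually_elim (auto simp: indicator_def)
qed

text \<open>Integrating \<open>u\<close> against the Laplacian of the bump and exchanging the integrals gives at least a
multiple of \<open>\<mu> (B(a,r/2))\<close> in absolute value; an affine function may be subtracted from \<open>u\<close> beforehand
without changing the integral.\<close>

lemma measure_ball_le_affine_deviation:
  fixes \<mu> :: "(real ^ 'd) measure"
  assumes d: "CARD('d) \<ge> 3" and \<mu>: "finite_measure \<mu>" "sets \<mu> = sets borel" and r: "0 < r" and \<delta>: "0 \<le> \<delta>"
    and dev: "(\<integral>\<^sup>+ x \<in> ball a r. ennreal (if newton_potential \<mu> x = top then 0
        else \<bar>enn2real (newton_potential \<mu> x) - (v \<bullet> x + c)\<bar>) \<partial>lborel) \<le> ennreal \<delta>"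
  shows "unit_ball_vol (real CARD('d)) / 2 ^ (CARD('d) + 10) * r ^ 6 * measure \<mu> (ball a (r / 2))
    \<le> (24 + 6 * real CARD('d)) * r ^ 4 * \<delta>"
proof -
  let ?k = "CARD('d) - 2"
  let ?b = "unit_ball_vol (real CARD('d)) / 2 ^ (CARD('d) + 10) * r ^ 6"
  let ?C = "(24 + 6 * real CARD('d)) * r ^ 4"
  let ?N = "\<lambda>x y :: real ^ 'd. 1 / norm (x - y) ^ ?k"
  let ?\<phi> = "bump_laplacian a r"
  interpret finite_measure \<mu> by fact
  interpret P: pair_sigma_finite "lborel :: (real ^ 'd) measure" \<mu>
    by (rule pair_sigma_finite_lborel[OF \<mu>(1)])
  have [measurable_cong]: "sets \<mu> = sets borel" by fact
  have [measurable]: "?\<phi> \<in> borel_measurable borel"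
    by (intro borel_measurable_continuous_onI continuous_intros)
  have C0: "0 \<le> ?C" using r by simp
  have int: "integrable (lborel \<Otimes>\<^sub>M \<mu>) (\<lambda>(x, y). ?N x y * ?\<phi> x)"
  proof (rule integrableI_bounded)
    show "(\<lambda>(x, y). ?N x y * ?\<phi> x) \<in> borel_measurable (lborel \<Otimes>\<^sub>M \<mu>)" by measurable
    have "(\<integral>\<^sup>+ p. ennreal (norm (case p of (x, y) \<Rightarrow> ?N x y * ?\<phi> x)) \<partial>(lborel \<Otimes>\<^sub>M \<mu>))
        = (\<integral>\<^sup>+ y. (\<integral>\<^sup>+ x. ennreal (?N x y * \<bar>?\<phi> x\<bar>) \<partial>lborel) \<partial>\<mu>)"
      by (subst P.nn_integral_snd[symmetric]) (auto simp: abs_mult)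
    also have "\<dots> \<le> (\<integral>\<^sup>+ y. ennreal (?C * ((2 ^ CARD('d) + 1) * unit_ball_vol (real CARD('d)) * r\<^sup>2)) \<partial>\<mu>)"
      by (intro nn_integral_mono nn_integral_kernel_bump_laplacian_le d r)
    also have "\<dots> < \<infinity>"
      by (simp add: emeasure_eq_measure ennreal_mult_less_top)
    finally show "(\<integral>\<^sup>+ p. ennreal (norm (case p of (x, y) \<Rightarrow> ?N x y * ?\<phi> x)) \<partial>(lborel \<Otimes>\<^sub>M \<mu>)) < \<infinity>" .
  qed
  define g where "g x = (LINT y|\<mu>. ?N x y)" for x
  have [measurable]: "g \<in> borel_measurable borel" unfolding g_def by measurable
  have fub: "(LINT y|\<mu>. (LINT x|lborel. ?N x y * ?\<phi> x)) = (LINT x|lborel. g x * ?\<phi> x)"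
    using P.Fubini_integral[OF int] by (simp only: g_def integral_mult_left_zero)
  have int_g: "integrable lborel (\<lambda>x. g x * ?\<phi> x)"
    using P.integrable_fst[OF int] by (simp only: g_def integral_mult_left_zero)
  have int_y: "integrable \<mu> (\<lambda>y. LINT x|lborel. ?N x y * ?\<phi> x)"
    using P.integrable_snd[OF int] by simp
  have int_aff: "integrable lborel (\<lambda>x. (v \<bullet> x + c) * ?\<phi> x)"
    by (rule continuous_compact_support_integrable[of _ a r])
      (auto intro!: continuous_intros simp: bump_laplacian_outside r)
  have "?b * measure \<mu> (ball a (r / 2)) = (LINT y|\<mu>. ?b * indicator (ball a (r / 2)) y)"
    using \<mu>(2) sets_eq_imp_space_eq[OF \<mu>(2)] by simp
  also have "\<dots> \<le> (LINT y|\<mu>. - (LINT x|lborel. ?N x y * ?\<phi> x))"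
    using int_y \<mu>(2) kernel_bump_laplacian_integral(2)[OF d r, of a]
    by (intro integral_mono integrable_mult_right integrable_real_indicator)
      (auto simp: emeasure_eq_measure)
  also have "\<dots> = - (LINT x|lborel. (g x - (v \<bullet> x + c)) * ?\<phi> x)"
    using int_g int_aff fub integral_affine_bump_laplacian[OF r, of v c a] by (simp add: left_diff_distrib)
  also have "\<dots> \<le> norm (LINT x|lborel. (g x - (v \<bullet> x + c)) * ?\<phi> x)" by simp
  finally have "ennreal (?b * measure \<mu> (ball a (r / 2))) \<le> ennreal (norm (LINT x|lborel. (g x - (v \<bullet> x + c)) * ?\<phi> x))"
    by (rule ennreal_leI)
  also have "\<dots> \<le> (\<integral>\<^sup>+ x. ennreal (norm ((g x - (v \<bullet> x + c)) * ?\<phi> x)) \<partial>lborel)"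
    using int_g int_aff by (intro integral_norm_bound_ennreal) (simp add: left_diff_distrib)
  also have "\<dots> \<le> (\<integral>\<^sup>+ x. ennreal ?C * (ennreal (if newton_potential \<mu> x = top then 0
        else \<bar>enn2real (newton_potential \<mu> x) - (v \<bullet> x + c)\<bar>) * indicator (ball a r) x) \<partial>lborel)"
  proof (rule nn_integral_mono_AE)
    show "AE x in lborel. ennreal (norm ((g x - (v \<bullet> x + c)) * ?\<phi> x))
      \<le> ennreal ?C * (ennreal (if newton_potential \<mu> x = top then 0
        else \<bar>enn2real (newton_potential \<mu> x) - (v \<bullet> x + c)\<bar>) * indicator (ball a r) x)"
      using AE_newton_potential_finite[OF d \<mu> r, of a]
    proof eventually_elim
      fix x assume fin: "x \<in> ball a r \<longrightarrow> newton_potential \<mu> x \<noteq> top"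
      show "ennreal (norm ((g x - (v \<bullet> x + c)) * ?\<phi> x))
      \<le> ennreal ?C * (ennreal (if newton_potential \<mu> x = top then 0
        else \<bar>enn2real (newton_potential \<mu> x) - (v \<bullet> x + c)\<bar>) * indicator (ball a r) x)"
      proof (cases "x \<in> ball a r")
        case True
        then have g: "enn2real (newton_potential \<mu> x) = g x" "newton_potential \<mu> x \<noteq> top"
          using fin newton_potential_finite(3)[OF d \<mu>(2)] by (auto simp: g_def)
        have "norm ((g x - (v \<bullet> x + c)) * ?\<phi> x) \<le> ?C * \<bar>g x - (v \<bullet> x + c)\<bar>"
          using mult_left_mono[OF bump_laplacian_bound[OF r, of a x], of "\<bar>g x - (v \<bullet> x + c)\<bar>"] True
          by (simp add: abs_mult mult_ac)
        then have "ennreal (norm ((g x - (v \<bullet> x + c)) * ?\<phi> x)) \<le> ennreal (?C * \<bar>g x - (v \<bullet> x + c)\<bar>)"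
          by (rule ennreal_leI)
        also have "\<dots> = ennreal ?C * ennreal \<bar>g x - (v \<bullet> x + c)\<bar>"
          by (rule ennreal_mult'[OF C0])
        finally show ?thesis using True g by simp
      qed (simp add: bump_laplacian_outside r)
    qed
  qed
  also have "\<dots> = ennreal ?C * (\<integral>\<^sup>+ x \<in> ball a r. ennreal (if newton_potential \<mu> x = top then 0
        else \<bar>enn2real (newton_potential \<mu> x) - (v \<bullet> x + c)\<bar>) \<partial>lborel)"
  proof (rule nn_integral_cmult)
    have [measurable]: "newton_potential \<mu> \<in> borel_measurable borel" by (rule newton_potential_measurable[OF \<mu>])
    have [measurable]: "ball a r \<in> sets borel" by simp
    show "(\<lambda>x. ennreal (if newton_potential \<mu> x = top then 0
        else \<bar>enn2real (newton_potential \<mu> x) - (v \<bullet> x + c)\<bar>) * indicator (ball a r) x) \<in> borel_measurable lborel"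
      by measurable
  qed
  also have "\<dots> \<le> ennreal ?C * ennreal \<delta>"
    by (intro mult_left_mono dev) auto
  also have "\<dots> = ennreal (?C * \<delta>)" by (rule ennreal_mult'[OF C0, symmetric])
  finally show ?thesis using C0 \<delta> by (subst (asm) ennreal_le_iff) auto
qed

section \<open>First-order expansion of the potential\<close>

text \<open>Induction on \<open>k\<close> avoids second derivatives: dividing by \<open>x\<close> once more adds exactly
\<open>(k + 1) (x - 1)^2 / x\<close>.\<close>

lemma inverse_power_taylor:
  fixes x :: real
  assumes "1 / 2 \<le> x"
  shows "\<bar>1 / x ^ k - 1 + real k * (x - 1)\<bar> \<le> real k * 2 ^ Suc k * (x - 1)\<^sup>2"
proof (induction k)
  case (Suc k)
  have x: "0 < x" "1 / x \<le> 2" using assms by (auto simp: field_simps)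
  have "1 / x ^ Suc k - 1 + real (Suc k) * (x - 1)
      = 1 / x * ((1 / x ^ k - 1 + real k * (x - 1)) + real (Suc k) * (x - 1)\<^sup>2)"
    using x by (simp add: field_simps power2_eq_square)
  also have "\<bar>\<dots>\<bar> \<le> 2 * (real k * 2 ^ Suc k * (x - 1)\<^sup>2 + real (Suc k) * (x - 1)\<^sup>2)"
    unfolding abs_mult using x Suc.IH by (intro mult_mono) (auto intro: order.trans[OF abs_triangle_ineq])
  also have "\<dots> = (real k * 2 ^ Suc (Suc k) + 2 * real (Suc k)) * (x - 1)\<^sup>2"
    by (simp add: algebra_simps)
  also have "\<dots> \<le> (real (Suc k) * 2 ^ Suc (Suc k)) * (x - 1)\<^sup>2"
  proof (intro mult_right_mono)
    have "real (Suc k) \<le> 2 ^ Suc k" using of_nat_less_two_power[of "Suc k", where 'a = real] by linarith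
    then show "real k * 2 ^ Suc (Suc k) + 2 * real (Suc k) \<le> real (Suc k) * 2 ^ Suc (Suc k)"
      by (simp add: algebra_simps)
  qed simp
  finally show ?case .
qed simp

text \<open>The one-variable estimate at \<open>x = |w + h| / |w|\<close>, combined with
\<open>|w| (|w + h| - |w|) - w \<bullet> h = (|h|^2 - (|w + h| - |w|)^2) / 2\<close>.\<close>

lemma kernel_taylor:
  fixes w h :: "'a :: real_inner"
  assumes w: "w \<noteq> 0" and h: "2 * norm h \<le> norm w"
  shows "\<bar>1 / norm (w + h) ^ k - 1 / norm w ^ k + real k * (w \<bullet> h) / norm w ^ (k + 2)\<bar>
    \<le> (real k * 2 ^ Suc k + real k) * (norm h)\<^sup>2 / norm w ^ (k + 2)"
proof -
  define \<alpha> \<beta> where "\<alpha> = norm w" and "\<beta> = norm (w + h)"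
  have a0: "0 < \<alpha>" using w by (simp add: \<alpha>_def)
  have diff: "\<bar>\<beta> - \<alpha>\<bar> \<le> norm h"
    using norm_triangle_ineq3[of "w + h" w] by (simp add: \<alpha>_def \<beta>_def)
  have b: "\<alpha> / 2 \<le> \<beta>" using diff h by (simp add: \<alpha>_def)
  have diff2: "(\<beta> - \<alpha>)\<^sup>2 \<le> (norm h)\<^sup>2" using diff by (simp add: abs_le_square_iff[symmetric])
  have "\<beta>\<^sup>2 = \<alpha>\<^sup>2 + 2 * (w \<bullet> h) + (norm h)\<^sup>2"
    unfolding \<alpha>_def \<beta>_def power2_norm_eq_inner by (simp add: inner_add_left inner_add_right inner_commute)
  then have wh: "w \<bullet> h = \<alpha> * (\<beta> - \<alpha>) - ((norm h)\<^sup>2 - (\<beta> - \<alpha>)\<^sup>2) / 2"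
    by (simp add: power2_eq_square field_simps)
  define x where "x = \<beta> / \<alpha>"
  have x: "1 / 2 \<le> x" using a0 b by (simp add: x_def field_simps)
  have x1: "x - 1 = (\<beta> - \<alpha>) / \<alpha>" using a0 by (simp add: x_def field_simps)
  have "1 / \<beta> ^ k - 1 / \<alpha> ^ k + real k * (w \<bullet> h) / \<alpha> ^ (k + 2)
      = 1 / \<alpha> ^ k * (1 / x ^ k - 1 + real k * (x - 1)) - real k * ((norm h)\<^sup>2 - (\<beta> - \<alpha>)\<^sup>2) / 2 / \<alpha> ^ (k + 2)"
  proof -
    have "1 / \<alpha> ^ k * (1 / x ^ k) = 1 / \<beta> ^ k" using a0 by (simp add: x_def power_divide)
    moreover have "1 / \<alpha> ^ k * (real k * (x - 1)) = real k * (\<alpha> * (\<beta> - \<alpha>)) / \<alpha> ^ (k + 2)"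
      using a0 by (simp add: x1 power_add power2_eq_square)
    moreover have "real k * (w \<bullet> h) / \<alpha> ^ (k + 2) = real k * (\<alpha> * (\<beta> - \<alpha>)) / \<alpha> ^ (k + 2)
        - real k * ((norm h)\<^sup>2 - (\<beta> - \<alpha>)\<^sup>2) / 2 / \<alpha> ^ (k + 2)"
      unfolding wh by (simp add: right_diff_distrib diff_divide_distrib)
    ultimately show ?thesis by (simp add: distrib_left right_diff_distrib)
  qed
  also have "\<bar>\<dots>\<bar> \<le> \<bar>1 / \<alpha> ^ k * (1 / x ^ k - 1 + real k * (x - 1))\<bar>
      + \<bar>real k * ((norm h)\<^sup>2 - (\<beta> - \<alpha>)\<^sup>2) / 2 / \<alpha> ^ (k + 2)\<bar>"
    by (rule abs_triangle_ineq4)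
  also have "\<dots> \<le> real k * 2 ^ Suc k * (norm h)\<^sup>2 / \<alpha> ^ (k + 2) + real k * (norm h)\<^sup>2 / \<alpha> ^ (k + 2)"
  proof (rule add_mono)
    have "\<bar>1 / \<alpha> ^ k * (1 / x ^ k - 1 + real k * (x - 1))\<bar> \<le> 1 / \<alpha> ^ k * (real k * 2 ^ Suc k * (x - 1)\<^sup>2)"
      unfolding abs_mult using a0 inverse_power_taylor[OF x, of k] by (intro mult_mono) auto
    also have "\<dots> = real k * 2 ^ Suc k * (\<beta> - \<alpha>)\<^sup>2 / \<alpha> ^ (k + 2)"
      using a0 by (simp add: x1 power_divide power_add power2_eq_square)
    also have "\<dots> \<le> real k * 2 ^ Suc k * (norm h)\<^sup>2 / \<alpha> ^ (k + 2)"
      using a0 diff2 by (intro divide_right_mono mult_left_mono) auto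
    finally show "\<bar>1 / \<alpha> ^ k * (1 / x ^ k - 1 + real k * (x - 1))\<bar> \<le> real k * 2 ^ Suc k * (norm h)\<^sup>2 / \<alpha> ^ (k + 2)" .
    have "\<bar>real k * ((norm h)\<^sup>2 - (\<beta> - \<alpha>)\<^sup>2) / 2 / \<alpha> ^ (k + 2)\<bar> = real k * (((norm h)\<^sup>2 - (\<beta> - \<alpha>)\<^sup>2) / 2) / \<alpha> ^ (k + 2)"
      using a0 diff2 by (simp add: abs_mult)
    also have "\<dots> \<le> real k * (norm h)\<^sup>2 / \<alpha> ^ (k + 2)"
    proof (intro divide_right_mono mult_left_mono)
      show "((norm h)\<^sup>2 - (\<beta> - \<alpha>)\<^sup>2) / 2 \<le> (norm h)\<^sup>2"
      proof -
        have "(A - B) / 2 \<le> A" if "0 \<le> A" "0 \<le> B" for A B :: real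
          using that by (simp add: field_simps)
        then show ?thesis by (simp only: zero_le_power2)
      qed
    qed (use a0 in auto)
    finally show "\<bar>real k * ((norm h)\<^sup>2 - (\<beta> - \<alpha>)\<^sup>2) / 2 / \<alpha> ^ (k + 2)\<bar> \<le> real k * (norm h)\<^sup>2 / \<alpha> ^ (k + 2)" .
  qed
  finally show ?thesis by (simp add: \<alpha>_def \<beta>_def distrib_right add_divide_distrib)
qed

definition truncated_field :: "(real ^ 'd) measure \<Rightarrow> real ^ 'd \<Rightarrow> real \<Rightarrow> real ^ 'd" where
  "truncated_field \<mu> a \<epsilon> = (LINT y:{y. norm (y - a) > \<epsilon>}|\<mu>. (1 / norm (a - y) ^ CARD('d)) *\<^sub>R (a - y))"

definition balls_bounded_by :: "(real ^ 'd) measure \<Rightarrow> real ^ 'd \<Rightarrow> real \<Rightarrow> real \<Rightarrow> bool" where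
  "balls_bounded_by \<mu> a e s\<^sub>0 \<longleftrightarrow>
    (\<forall>s. 0 < s \<longrightarrow> s \<le> s\<^sub>0 \<longrightarrow> emeasure \<mu> (ball a s) \<le> ennreal (e * s ^ (CARD('d) - 1)))"

lemma truncated_field_measurable:
  fixes \<mu> :: "(real ^ 'd) measure"
  assumes \<mu>: "finite_measure \<mu>" "sets \<mu> = sets borel"
  shows "truncated_field \<mu> a \<in> borel_measurable borel"
proof -
  interpret finite_measure \<mu> by fact
  have [measurable_cong]: "sets \<mu> = sets borel" by fact
  have "truncated_field \<mu> a = (\<lambda>\<epsilon>. LINT y|\<mu>. (if norm (y - a) > \<epsilon> then (1 / norm (a - y) ^ CARD('d)) *\<^sub>R (a - y) else 0))"
    unfolding truncated_field_def set_lebesgue_integral_def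
    by (intro ext Bochner_Integration.integral_cong) (auto simp: indicator_def)
  also have "\<dots> \<in> borel_measurable borel" by measurable
  finally show ?thesis .
qed

lemma norm_inverse_power_field:
  fixes w :: "'a :: real_normed_vector"
  assumes "w \<noteq> 0"
  shows "norm ((1 / norm w ^ Suc n) *\<^sub>R w) = 1 / norm w ^ n"
  using assms by simp

lemma truncated_field_integrable:
  fixes \<mu> :: "(real ^ 'd) measure"
  assumes \<mu>: "finite_measure \<mu>" "sets \<mu> = sets borel" and e: "0 < \<epsilon>"
  shows "set_integrable \<mu> {y. norm (y - a) > \<epsilon>} (\<lambda>y. (1 / norm (a - y) ^ CARD('d)) *\<^sub>R (a - y))"
proof -
  interpret finite_measure \<mu> by fact
  have [measurable_cong]: "sets \<mu> = sets borel" by fact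
  obtain n where n: "CARD('d) = Suc n" using not0_implies_Suc[of "CARD('d)"] by auto
  have "norm (indicator {y. norm (y - a) > \<epsilon>} y *\<^sub>R ((1 / norm (a - y) ^ CARD('d)) *\<^sub>R (a - y))) \<le> 1 / \<epsilon> ^ n" for y
  proof (cases "\<epsilon> < norm (y - a)")
    case True
    then have "a - y \<noteq> 0" "\<epsilon> \<le> norm (a - y)" using e by (auto simp: norm_minus_commute)
    then have "norm ((1 / norm (a - y) ^ Suc n) *\<^sub>R (a - y)) \<le> 1 / \<epsilon> ^ n"
      using e by (subst norm_inverse_power_field) (auto intro!: frac_le power_mono)
    then show ?thesis using True n by simp
  qed (use e in auto)
  then show ?thesis
    unfolding set_integrable_def by (intro integrable_const_bound) auto
qed

text \<open>Between two radii the integrand is at most \<open>s^(1-d)\<close>, so under the density condition the truncated field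
varies little from one dyadic scale to the next.\<close>

lemma truncated_field_diff_le:
  fixes \<mu> :: "(real ^ 'd) measure"
  assumes \<mu>: "finite_measure \<mu>" "sets \<mu> = sets borel" and s: "0 < s" "s \<le> t"
  shows "norm (truncated_field \<mu> a s - truncated_field \<mu> a t) \<le> measure \<mu> (cball a t) / s ^ (CARD('d) - 1)"
proof -
  interpret finite_measure \<mu> by fact
  have [measurable_cong]: "sets \<mu> = sets borel" by fact
  obtain n where n: "CARD('d) = Suc n" using not0_implies_Suc[of "CARD('d)"] by auto
  let ?F = "\<lambda>\<epsilon> y. indicator {y. norm (y - a) > \<epsilon>} y *\<^sub>R ((1 / norm (a - y) ^ CARD('d)) *\<^sub>R (a - y))"
  have int: "integrable \<mu> (?F s)" "integrable \<mu> (?F t)"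
    using truncated_field_integrable[OF \<mu>, of s a] truncated_field_integrable[OF \<mu>, of t a] s
    by (auto simp: set_integrable_def)
  have ptw: "norm (?F s y - ?F t y) \<le> 1 / s ^ n * indicator (cball a t) y" for y
  proof (cases "s < norm (y - a) \<and> norm (y - a) \<le> t")
    case True
    then have "a - y \<noteq> 0" "s \<le> norm (a - y)" using s by (auto simp: norm_minus_commute)
    then have "norm ((1 / norm (a - y) ^ Suc n) *\<^sub>R (a - y)) \<le> 1 / s ^ n"
      using s by (subst norm_inverse_power_field) (auto intro!: frac_le power_mono)
    then show ?thesis using True n by (simp add: dist_norm norm_minus_commute)
  next
    case False
    then have "?F s y - ?F t y = 0" using s by (auto simp: indicator_def)
    then have "norm (?F s y - ?F t y) = 0" by (simp only: norm_zero)
    moreover have "0 \<le> 1 / s ^ n * indicator (cball a t) y" using s by simp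
    ultimately show ?thesis by linarith
  qed
  have "truncated_field \<mu> a s - truncated_field \<mu> a t = (LINT y|\<mu>. ?F s y - ?F t y)"
    unfolding truncated_field_def set_lebesgue_integral_def using int by simp
  then have "norm (truncated_field \<mu> a s - truncated_field \<mu> a t) \<le> (LINT y|\<mu>. norm (?F s y - ?F t y))"
    by simp
  also have "\<dots> \<le> (LINT y|\<mu>. 1 / s ^ n * indicator (cball a t) y)"
    using int ptw by (intro integral_mono integrable_norm Bochner_Integration.integrable_diff
      integrable_mult_right integrable_real_indicator) (auto simp: emeasure_eq_measure)
  also have "\<dots> = measure \<mu> (cball a t) / s ^ (CARD('d) - 1)"
    using n \<mu>(2) sets_eq_imp_space_eq[OF \<mu>(2)] by simp
  finally show ?thesis .
qed

text \<open>The measure is controlled only up to radius \<open>s\<^sub>0\<close>; beyond it the total mass is used, the rest is the dyadic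
estimate for the restriction of \<open>\<mu>\<close> to the ball of radius \<open>s\<^sub>0\<close>.\<close>

lemma nn_integral_far_le:
  fixes \<mu> :: "(real ^ 'd) measure"
  assumes \<mu>: "finite_measure \<mu>" "sets \<mu> = sets borel" and b: "balls_bounded_by \<mu> a e s\<^sub>0"
    and e: "0 \<le> e" and R: "0 < R" "R \<le> s\<^sub>0"
  shows "(\<integral>\<^sup>+ y \<in> - ball a R. 1 / ennreal (norm (a - y) ^ CARD('d)) \<partial>\<mu>)
    \<le> ennreal (2 ^ CARD('d) * e / R + measure \<mu> UNIV / s\<^sub>0 ^ CARD('d))"
proof -
  interpret finite_measure \<mu> by fact
  have [measurable_cong]: "sets \<mu> = sets borel" by fact
  have [measurable]: "\<And>t. ball a t \<in> sets borel" by simp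
  \<comment> \<open>For the restricted measure the bound on balls holds at all radii from \<open>R\<close> on.\<close>
  let ?\<mu>' = "density \<mu> (indicator (ball a s\<^sub>0))"
  let ?f = "\<lambda>y. 1 / ennreal (norm (a - y) ^ CARD('d))"
  obtain n where n: "CARD('d) = Suc n" using not0_implies_Suc[of "CARD('d)"] by auto
  have s0: "0 < s\<^sub>0" using R by simp
  have em: "emeasure ?\<mu>' (ball a t) \<le> ennreal (e * t ^ n)" if t: "R \<le> t" for t
  proof -
    have "emeasure ?\<mu>' (ball a t) = (\<integral>\<^sup>+ y. indicator (ball a s\<^sub>0) y * indicator (ball a t) y \<partial>\<mu>)"
      by (subst emeasure_density) auto
    also have "\<dots> = (\<integral>\<^sup>+ y. indicator (ball a (min t s\<^sub>0)) y \<partial>\<mu>)"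
      by (intro nn_integral_cong) (auto split: split_indicator)
    also have "\<dots> = emeasure \<mu> (ball a (min t s\<^sub>0))" by simp
    also have "\<dots> \<le> ennreal (e * min t s\<^sub>0 ^ n)"
      using b R t s0 unfolding balls_bounded_by_def n by simp
    also have "\<dots> \<le> ennreal (e * t ^ n)"
      using e R t s0 by (intro ennreal_leI mult_left_mono power_mono) auto
    finally show ?thesis .
  qed
  have "(\<integral>\<^sup>+ y \<in> - ball a R. ?f y \<partial>\<mu>)
      \<le> (\<integral>\<^sup>+ y. indicator (ball a s\<^sub>0) y * (?f y * indicator (- ball a R) y) + ennreal (1 / s\<^sub>0 ^ CARD('d)) \<partial>\<mu>)"
  proof (intro nn_integral_mono)
    fix y
    show "?f y * indicator (- ball a R) y \<le> indicator (ball a s\<^sub>0) y * (?f y * indicator (- ball a R) y) + ennreal (1 / s\<^sub>0 ^ CARD('d))"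
    proof (cases "y \<in> ball a s\<^sub>0")
      case False
      then have "s\<^sub>0 \<le> norm (a - y)" by (simp add: dist_norm)
      then have "?f y \<le> ennreal (1 / s\<^sub>0 ^ CARD('d))"
        using s0 order.strict_trans2[OF s0, of "norm (a - y)"]
        by (subst one_divide_ennreal) (auto intro!: ennreal_leI zero_less_power frac_le power_mono)
      then show ?thesis by (auto simp: indicator_def)
    qed auto
  qed
  also have "\<dots> = (\<integral>\<^sup>+ y. indicator (ball a s\<^sub>0) y * (?f y * indicator (- ball a R) y) \<partial>\<mu>)
      + ennreal (1 / s\<^sub>0 ^ CARD('d)) * emeasure \<mu> UNIV"
  proof -
    have "(\<lambda>y. indicator (ball a s\<^sub>0) y * (?f y * indicator (- ball a R) y)) \<in> borel_measurable \<mu>"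
      by measurable
    then show ?thesis
      using sets_eq_imp_space_eq[OF \<mu>(2)] by (simp add: nn_integral_add)
  qed
  also have "(\<integral>\<^sup>+ y. indicator (ball a s\<^sub>0) y * (?f y * indicator (- ball a R) y) \<partial>\<mu>)
      = (\<integral>\<^sup>+ y \<in> - ball a R. ?f y \<partial>?\<mu>')"
    by (subst nn_integral_density) auto
  also have "\<dots> \<le> ennreal (2 * (2 ^ n * e / R))"
    using em \<mu>(2) by (intro nn_integral_power_far_le e R n) auto
  also have "2 * (2 ^ n * e / R) = 2 ^ CARD('d) * e / R" by (simp add: n)
  also have "ennreal (1 / s\<^sub>0 ^ CARD('d)) * emeasure \<mu> UNIV = ennreal (measure \<mu> UNIV / s\<^sub>0 ^ CARD('d))"
    using s0 by (simp add: emeasure_eq_measure flip: ennreal_mult')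
  finally show ?thesis using e R s0 by (simp flip: ennreal_plus)
qed

lemma newton_potential_center_finite:
  fixes \<mu> :: "(real ^ 'd) measure"
  assumes d: "CARD('d) \<ge> 3" and \<mu>: "finite_measure \<mu>" "sets \<mu> = sets borel"
    and b: "balls_bounded_by \<mu> a e s\<^sub>0" and e: "0 \<le> e" and s0: "0 < s\<^sub>0"
  shows "newton_potential \<mu> a \<noteq> top"
proof -
  let ?k = "CARD('d) - 2"
  interpret finite_measure \<mu> by fact
  have [measurable_cong]: "sets \<mu> = sets borel" by fact
  have [measurable]: "ball a s\<^sub>0 \<in> sets borel" by simp
  let ?f = "\<lambda>y. 1 / ennreal (norm (a - y) ^ ?k)"
  have "newton_potential \<mu> a \<le> (\<integral>\<^sup>+ y. ?f y * indicator (ball a s\<^sub>0) y + ennreal (1 / s\<^sub>0 ^ ?k) \<partial>\<mu>)"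
    unfolding newton_potential_def
  proof (intro nn_integral_mono)
    fix y
    show "?f y \<le> ?f y * indicator (ball a s\<^sub>0) y + ennreal (1 / s\<^sub>0 ^ ?k)"
    proof (cases "y \<in> ball a s\<^sub>0")
      case False
      then have "s\<^sub>0 \<le> norm (a - y)" by (simp add: dist_norm)
      then have "?f y \<le> ennreal (1 / s\<^sub>0 ^ ?k)"
        using s0 order.strict_trans2[OF s0, of "norm (a - y)"]
        by (subst one_divide_ennreal) (auto intro!: ennreal_leI zero_less_power frac_le power_mono)
      then show ?thesis by (auto simp: indicator_def)
    qed auto
  qed
  also have "\<dots> = (\<integral>\<^sup>+ y \<in> ball a s\<^sub>0. ?f y \<partial>\<mu>) + ennreal (1 / s\<^sub>0 ^ ?k) * emeasure \<mu> UNIV"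
  proof -
    have "(\<lambda>y. ?f y * indicator (ball a s\<^sub>0) y) \<in> borel_measurable \<mu>"
      by measurable
    then show ?thesis
      using sets_eq_imp_space_eq[OF \<mu>(2)] by (simp add: nn_integral_add)
  qed
  also have "\<dots> \<le> ennreal (2 * (2 ^ ?k * e * s\<^sub>0 ^ (CARD('d) - 1 - ?k))) + ennreal (1 / s\<^sub>0 ^ ?k) * emeasure \<mu> UNIV"
    using d b e s0 \<mu>(2) by (intro add_right_mono nn_integral_power_ball_le) (auto simp: balls_bounded_by_def)
  also have "\<dots> < top" by (simp add: emeasure_eq_measure ennreal_mult_less_top)
  finally show ?thesis by simp
qed

text \<open>Points \<open>y\<close> at distance more than \<open>2|x - a|\<close> from \<open>a\<close> contribute the Taylor remainder of the kernel. For the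
nearer ones the linear term is absent from the truncated field and the two kernels are estimated separately.\<close>

lemma first_order_remainder_le:
  fixes \<mu> :: "(real ^ 'd) measure"
  assumes d: "CARD('d) \<ge> 3" and \<mu>: "finite_measure \<mu>" "sets \<mu> = sets borel"
    and fin: "newton_potential \<mu> a \<noteq> top" "newton_potential \<mu> x \<noteq> top" and xa: "x \<noteq> a"
  shows "ennreal \<bar>enn2real (newton_potential \<mu> x) - enn2real (newton_potential \<mu> a)
      + real (CARD('d) - 2) * (truncated_field \<mu> a (2 * norm (x - a)) \<bullet> (x - a))\<bar>
    \<le> ennreal ((real (CARD('d) - 2) * 2 ^ Suc (CARD('d) - 2) + real (CARD('d) - 2)) * (norm (x - a))\<^sup>2)
        * (\<integral>\<^sup>+ y \<in> - ball a (2 * norm (x - a)). 1 / ennreal (norm (a - y) ^ CARD('d)) \<partial>\<mu>)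
      + (\<integral>\<^sup>+ y \<in> cball a (2 * norm (x - a)). 1 / ennreal (norm (x - y) ^ (CARD('d) - 2)) \<partial>\<mu>)
      + (\<integral>\<^sup>+ y \<in> cball a (2 * norm (x - a)). 1 / ennreal (norm (a - y) ^ (CARD('d) - 2)) \<partial>\<mu>)"
    (is "_ \<le> ennreal ?T * (\<integral>\<^sup>+ y \<in> _. ?fd y \<partial>_) + (\<integral>\<^sup>+ y \<in> _. ?fx y \<partial>_) + (\<integral>\<^sup>+ y \<in> _. ?fa y \<partial>_)")
proof -
  let ?k = "CARD('d) - 2"
  let ?h = "x - a" and ?R = "2 * norm (x - a)"
  interpret finite_measure \<mu> by fact
  have [measurable_cong]: "sets \<mu> = sets borel" by fact
  have [measurable]: "ball a ?R \<in> sets borel" "cball a ?R \<in> sets borel" by simp_all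
  have R: "0 < ?R" using xa by simp
  have dk: "CARD('d) = ?k + 2" using d by simp
  let ?N = "\<lambda>x y :: real ^ 'd. 1 / norm (x - y) ^ ?k"
  let ?F = "\<lambda>y. indicator {y. norm (y - a) > ?R} y *\<^sub>R ((1 / norm (a - y) ^ CARD('d)) *\<^sub>R (a - y))"
  define D where "D y = ?N x y - ?N a y + real ?k * (?F y \<bullet> ?h)" for y
  have int_F: "integrable \<mu> ?F"
    using truncated_field_integrable[OF \<mu> R] by (simp add: set_integrable_def)
  note nx = newton_potential_finite[OF d \<mu>(2) fin(2)] and na = newton_potential_finite[OF d \<mu>(2) fin(1)]
  have int_D: "integrable \<mu> D"
    unfolding D_def by (intro Bochner_Integration.integrable_add Bochner_Integration.integrable_diff
      nx(2) na(2) integrable_mult_right integrable_inner_left int_F)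
  have "(LINT y|\<mu>. D y) = (LINT y|\<mu>. ?N x y - ?N a y) + (LINT y|\<mu>. real ?k * (?F y \<bullet> ?h))"
    unfolding D_def by (intro Bochner_Integration.integral_add Bochner_Integration.integrable_diff
      nx(2) na(2) integrable_mult_right integrable_inner_left int_F)
  also have "(LINT y|\<mu>. ?N x y - ?N a y) = enn2real (newton_potential \<mu> x) - enn2real (newton_potential \<mu> a)"
    unfolding nx(3) na(3) by (intro Bochner_Integration.integral_diff nx(2) na(2))
  also have "(LINT y|\<mu>. real ?k * (?F y \<bullet> ?h)) = real ?k * (truncated_field \<mu> a ?R \<bullet> ?h)"
    unfolding truncated_field_def set_lebesgue_integral_def
    by (simp only: integral_mult_right_zero integral_inner_left[OF int_F])
  finally have "ennreal \<bar>enn2real (newton_potential \<mu> x) - enn2real (newton_potential \<mu> a)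
      + real ?k * (truncated_field \<mu> a ?R \<bullet> ?h)\<bar> = ennreal (norm (LINT y|\<mu>. D y))" by simp
  also have "\<dots> \<le> (\<integral>\<^sup>+ y. ennreal (norm (D y)) \<partial>\<mu>)" by (rule integral_norm_bound_ennreal[OF int_D])
  also have "\<dots> \<le> (\<integral>\<^sup>+ y. ennreal ?T * (?fd y * indicator (- ball a ?R) y)
      + ?fx y * indicator (cball a ?R) y + ?fa y * indicator (cball a ?R) y \<partial>\<mu>)"
  proof (rule nn_integral_mono_AE)
    show "AE y in \<mu>. ennreal (norm (D y)) \<le> ennreal ?T * (?fd y * indicator (- ball a ?R) y)
      + ?fx y * indicator (cball a ?R) y + ?fa y * indicator (cball a ?R) y"
      using nx(1) na(1)
    proof eventually_elim
      fix y assume y: "y \<noteq> x" "y \<noteq> a"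
      show "ennreal (norm (D y)) \<le> ennreal ?T * (?fd y * indicator (- ball a ?R) y)
        + ?fx y * indicator (cball a ?R) y + ?fa y * indicator (cball a ?R) y"
      proof (cases "norm (y - a) > ?R")
        case True
        have "norm (D y) \<le> ?T * (1 / norm (a - y) ^ CARD('d))"
        proof -
          have "\<bar>1 / norm (a - y + ?h) ^ ?k - 1 / norm (a - y) ^ ?k + real ?k * ((a - y) \<bullet> ?h) / norm (a - y) ^ (?k + 2)\<bar>
              \<le> (real ?k * 2 ^ Suc ?k + real ?k) * (norm ?h)\<^sup>2 / norm (a - y) ^ (?k + 2)"
            using True y by (intro kernel_taylor) (auto simp: norm_minus_commute)
          moreover have "a - y + ?h = x - y" by simp
          moreover have "norm (a - y) ^ (?k + 2) = norm (a - y) ^ CARD('d)"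
            by (rule arg_cong[OF dk[symmetric]])
          moreover have "D y = ?N x y - ?N a y + real ?k * ((a - y) \<bullet> ?h) / norm (a - y) ^ CARD('d)"
            using True by (simp add: D_def)
          ultimately show ?thesis by simp
        qed
        then have "ennreal (norm (D y)) \<le> ennreal (?T * (1 / norm (a - y) ^ CARD('d)))" by (rule ennreal_leI)
        also have "\<dots> = ennreal ?T * ?fd y"
          using y by (subst ennreal_mult') (auto simp: one_divide_ennreal)
        also have "\<dots> = ennreal ?T * (?fd y * indicator (- ball a ?R) y)"
          using True by (auto simp: dist_norm norm_minus_commute)
        finally show ?thesis by (rule order_trans) (simp add: add.assoc)
      next
        case False
        then have "D y = ?N x y - ?N a y" by (simp add: D_def)
        moreover have "0 \<le> ?N x y" "0 \<le> ?N a y" by simp_all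
        ultimately have "norm (D y) \<le> ?N x y + ?N a y" unfolding real_norm_def by linarith
        then have "ennreal (norm (D y)) \<le> ennreal (?N x y + ?N a y)" by (rule ennreal_leI)
        also have "\<dots> = ?fx y + ?fa y" using y by (simp add: one_divide_ennreal)
        also have "\<dots> = ?fx y * indicator (cball a ?R) y + ?fa y * indicator (cball a ?R) y"
          using False by (auto simp: dist_norm norm_minus_commute)
        finally show ?thesis by (rule order_trans) (simp add: add.assoc add_increasing)
      qed
    qed
  qed
  also have "\<dots> = ennreal ?T * (\<integral>\<^sup>+ y \<in> - ball a ?R. ?fd y \<partial>\<mu>)
      + (\<integral>\<^sup>+ y \<in> cball a ?R. ?fx y \<partial>\<mu>) + (\<integral>\<^sup>+ y \<in> cball a ?R. ?fa y \<partial>\<mu>)"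
  proof -
    have m: "(\<lambda>y. ?fd y * indicator (- ball a ?R) y) \<in> borel_measurable \<mu>"
      "(\<lambda>y. ?fx y * indicator (cball a ?R) y) \<in> borel_measurable \<mu>"
      "(\<lambda>y. ?fa y * indicator (cball a ?R) y) \<in> borel_measurable \<mu>" by measurable
    then have "(\<lambda>y. ennreal ?T * (?fd y * indicator (- ball a ?R) y)) \<in> borel_measurable \<mu>"
      by (intro borel_measurable_times_ennreal) auto
    then show ?thesis using m
      by (simp only: nn_integral_add nn_integral_cmult borel_measurable_add)
  qed
  finally show ?thesis .
qed

text \<open>The error of the expansion that takes \<open>- k\<close> times the field truncated at \<open>2|x - a|\<close> as its linear part, relative to
\<open>|x - a|\<close>. The value \<open>0\<close> at points of infinite potential keeps them out of every integral and level set.\<close>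

definition field_remainder :: "(real ^ 'd) measure \<Rightarrow> real ^ 'd \<Rightarrow> real ^ 'd \<Rightarrow> real" where
  "field_remainder \<mu> a x = (if newton_potential \<mu> x = top then 0 else
    \<bar>enn2real (newton_potential \<mu> x) - enn2real (newton_potential \<mu> a)
      + real (CARD('d) - 2) * (truncated_field \<mu> a (2 * norm (x - a)) \<bullet> (x - a))\<bar> / norm (x - a))"

text \<open>The quotient \<open>Q\<close> of differentiability in the capacity sense, with the same convention.\<close>

definition affine_remainder :: "(real ^ 'd) measure \<Rightarrow> real ^ 'd \<Rightarrow> real ^ 'd \<Rightarrow> real ^ 'd \<Rightarrow> real" where
  "affine_remainder \<mu> a A x = (if newton_potential \<mu> x = top then 0 else
    \<bar>enn2real (newton_potential \<mu> x) - enn2real (newton_potential \<mu> a) - A \<bullet> (x - a)\<bar> / norm (x - a))"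

lemma remainders_nonneg: "0 \<le> field_remainder \<mu> a x" "0 \<le> affine_remainder \<mu> a A x"
  by (simp_all add: field_remainder_def affine_remainder_def)

lemma remainders_measurable:
  fixes \<mu> :: "(real ^ 'd) measure"
  assumes \<mu>: "finite_measure \<mu>" "sets \<mu> = sets borel"
  shows "field_remainder \<mu> a \<in> borel_measurable borel" "affine_remainder \<mu> a A \<in> borel_measurable borel"
proof -
  have [measurable]: "newton_potential \<mu> \<in> borel_measurable borel" "truncated_field \<mu> a \<in> borel_measurable borel"
    by (rule newton_potential_measurable[OF \<mu>] truncated_field_measurable[OF \<mu>])+
  show "field_remainder \<mu> a \<in> borel_measurable borel" "affine_remainder \<mu> a A \<in> borel_measurable borel"
    unfolding field_remainder_def[abs_def] affine_remainder_def[abs_def] by measurable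
qed

text \<open>The two expansions differ only in their linear parts, whose difference is \<open>(A + k G(2|x-a|)) \<bullet> (x - a)\<close>.\<close>

lemma remainders_difference:
  fixes \<mu> :: "(real ^ 'd) measure"
  assumes "newton_potential \<mu> x \<noteq> top"
  shows "\<bar>(A + real (CARD('d) - 2) *\<^sub>R truncated_field \<mu> a (2 * norm (x - a))) \<bullet> (x - a)\<bar>
      \<le> (affine_remainder \<mu> a A x + field_remainder \<mu> a x) * norm (x - a)"
    and "affine_remainder \<mu> a A x \<le> field_remainder \<mu> a x
      + norm (A + real (CARD('d) - 2) *\<^sub>R truncated_field \<mu> a (2 * norm (x - a)))"
proof -
  let ?h = "x - a" and ?k = "real (CARD('d) - 2)"
  let ?G = "truncated_field \<mu> a (2 * norm (x - a))"
  define p where "p = enn2real (newton_potential \<mu> x) - enn2real (newton_potential \<mu> a) - A \<bullet> ?h"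
  define q where "q = enn2real (newton_potential \<mu> x) - enn2real (newton_potential \<mu> a) + ?k * (?G \<bullet> ?h)"
  have V: "(A + ?k *\<^sub>R ?G) \<bullet> ?h = q - p"
    by (simp add: p_def q_def inner_add_left)
  have r: "affine_remainder \<mu> a A x = \<bar>p\<bar> / norm ?h" "field_remainder \<mu> a x = \<bar>q\<bar> / norm ?h"
    using assms by (simp_all add: affine_remainder_def field_remainder_def p_def q_def)
  have z: "p = 0 \<and> q = 0" if "norm ?h = 0" using that by (simp add: p_def q_def)
  show "\<bar>(A + ?k *\<^sub>R ?G) \<bullet> ?h\<bar> \<le> (affine_remainder \<mu> a A x + field_remainder \<mu> a x) * norm ?h"
  proof (cases "norm ?h = 0")
    case False
    then have eq: "(\<bar>p\<bar> / norm ?h + \<bar>q\<bar> / norm ?h) * norm ?h = \<bar>p\<bar> + \<bar>q\<bar>"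
      by (simp add: distrib_right)
    then show ?thesis unfolding V r eq by linarith
  qed (use z in \<open>simp add: V\<close>)
  show "affine_remainder \<mu> a A x \<le> field_remainder \<mu> a x + norm (A + ?k *\<^sub>R ?G)"
  proof (cases "norm ?h = 0")
    case False
    have "\<bar>q - p\<bar> \<le> norm (A + ?k *\<^sub>R ?G) * norm ?h"
      unfolding V[symmetric] by (rule Cauchy_Schwarz_ineq2)
    then have "\<bar>p\<bar> \<le> \<bar>q\<bar> + norm (A + ?k *\<^sub>R ?G) * norm ?h" by linarith
    then have "\<bar>p\<bar> / norm ?h \<le> (\<bar>q\<bar> + norm (A + ?k *\<^sub>R ?G) * norm ?h) / norm ?h"
      by (intro divide_right_mono) auto
    also have "\<dots> = \<bar>q\<bar> / norm ?h + norm (A + ?k *\<^sub>R ?G)"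
      using False by (simp add: add_divide_distrib)
    finally show ?thesis by (simp only: r)
  qed (simp add: affine_remainder_def field_remainder_def)
qed

text \<open>In the region of integration \<open>1 / |x - a| \<le> 2 / |y - a|\<close>. Once this factor no longer depends on \<open>x\<close>, the
integral over \<open>x\<close> is the potential of \<open>\<nu>\<close> at \<open>y\<close>, at most \<open>1\<close>.\<close>

lemma near_part_integral_le:
  fixes \<mu> \<nu> :: "(real ^ 'd) measure"
  assumes d: "CARD('d) \<ge> 3" and \<mu>: "finite_measure \<mu>" "sets \<mu> = sets borel"
    and b: "balls_bounded_by \<mu> a e s\<^sub>0" and e: "0 \<le> e" and r: "0 < r" "3 * r \<le> s\<^sub>0"
    and \<nu>: "admissible \<nu>"
  shows "(\<integral>\<^sup>+ x \<in> ball a r. (1 / ennreal (norm (x - a)))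
      * (\<integral>\<^sup>+ y \<in> cball a (2 * norm (x - a)). 1 / ennreal (norm (x - y) ^ (CARD('d) - 2)) \<partial>\<mu>) \<partial>\<nu>)
    \<le> ennreal (8 * 3 ^ (CARD('d) - 2) * e * r ^ (CARD('d) - 2))"
proof -
  let ?k = "CARD('d) - 2"
  interpret \<mu>: finite_measure \<mu> by fact
  interpret \<nu>: finite_measure \<nu> using \<nu> by (simp add: admissible_def)
  interpret P: pair_sigma_finite \<nu> \<mu> ..
  have [measurable_cong]: "sets \<mu> = sets borel" "sets \<nu> = sets borel"
    using \<mu> \<nu> by (auto simp: admissible_def)
  have [measurable]: "\<And>t. ball a t \<in> sets borel" by simp
  let ?f = "\<lambda>x y. indicator (ball a r) x * (1 / ennreal (norm (x - a)))
    * (if norm (y - a) \<le> 2 * norm (x - a) then 1 / ennreal (norm (x - y) ^ ?k) else 0)"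
  have "(\<integral>\<^sup>+ x \<in> ball a r. (1 / ennreal (norm (x - a)))
      * (\<integral>\<^sup>+ y \<in> cball a (2 * norm (x - a)). 1 / ennreal (norm (x - y) ^ ?k) \<partial>\<mu>) \<partial>\<nu>)
    = (\<integral>\<^sup>+ x. (\<integral>\<^sup>+ y. ?f x y \<partial>\<mu>) \<partial>\<nu>)"
  proof (intro nn_integral_cong)
    fix x
    have "(\<integral>\<^sup>+ y. ?f x y \<partial>\<mu>) = indicator (ball a r) x * (1 / ennreal (norm (x - a)))
      * (\<integral>\<^sup>+ y. (if norm (y - a) \<le> 2 * norm (x - a) then 1 / ennreal (norm (x - y) ^ ?k) else 0) \<partial>\<mu>)"
      by (intro nn_integral_cmult) measurable
    also have "(\<integral>\<^sup>+ y. (if norm (y - a) \<le> 2 * norm (x - a) then 1 / ennreal (norm (x - y) ^ ?k) else 0) \<partial>\<mu>)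
      = (\<integral>\<^sup>+ y \<in> cball a (2 * norm (x - a)). 1 / ennreal (norm (x - y) ^ ?k) \<partial>\<mu>)"
      by (intro nn_integral_cong) (auto simp: dist_norm norm_minus_commute)
    finally show "(1 / ennreal (norm (x - a)))
      * (\<integral>\<^sup>+ y \<in> cball a (2 * norm (x - a)). 1 / ennreal (norm (x - y) ^ ?k) \<partial>\<mu>) * indicator (ball a r) x
      = (\<integral>\<^sup>+ y. ?f x y \<partial>\<mu>)" by (simp only: ac_simps)
  qed
  also have "\<dots> = (\<integral>\<^sup>+ y. (\<integral>\<^sup>+ x. ?f x y \<partial>\<nu>) \<partial>\<mu>)"
    by (rule P.Fubini'[symmetric]) measurable
  also have "\<dots> \<le> (\<integral>\<^sup>+ y. 2 * (1 / ennreal (norm (a - y) ^ 1) * indicator (ball a (3 * r)) y) \<partial>\<mu>)"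
  proof (intro nn_integral_mono)
    fix y
    let ?w = "2 * (1 / ennreal (norm (a - y) ^ 1) * indicator (ball a (3 * r)) y)"
    have "(\<integral>\<^sup>+ x. ?f x y \<partial>\<nu>) \<le> (\<integral>\<^sup>+ x. ?w * (1 / ennreal (norm (y - x) ^ ?k)) \<partial>\<nu>)"
    proof (intro nn_integral_mono)
      fix x
      show "?f x y \<le> ?w * (1 / ennreal (norm (y - x) ^ ?k))"
      proof (cases "x \<in> ball a r \<and> norm (y - a) \<le> 2 * norm (x - a)")
        case True
        then have y3: "y \<in> ball a (3 * r)"
          using r by (auto simp: dist_norm norm_minus_commute)
        have "1 / ennreal (norm (x - a)) \<le> 2 * (1 / ennreal (norm (a - y)))"
        proof (cases "y = a")
          case True
          then show ?thesis by (simp add: ennreal_mult_top)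
        next
          case False
          then have pos: "0 < norm (x - a)" "0 < norm (a - y)" "norm (a - y) \<le> 2 * norm (x - a)"
            using True by (auto simp: norm_minus_commute)
          then have "1 / norm (x - a) \<le> 2 * (1 / norm (a - y))" by (simp add: field_simps)
          then have "ennreal (1 / norm (x - a)) \<le> ennreal (2 * (1 / norm (a - y)))" by (rule ennreal_leI)
          also have "\<dots> = 2 * ennreal (1 / norm (a - y))" by (subst ennreal_mult') auto
          finally show ?thesis using pos by (simp add: one_divide_ennreal)
        qed
        then have "1 / ennreal (norm (x - a)) * (1 / ennreal (norm (x - y) ^ ?k))
          \<le> 2 * (1 / ennreal (norm (a - y))) * (1 / ennreal (norm (x - y) ^ ?k))"
          by (rule mult_right_mono) simp
        then show ?thesis using True y3 by (simp add: norm_minus_commute)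
      qed auto
    qed
    also have "\<dots> = ?w * newton_potential \<nu> y"
      unfolding newton_potential_def by (rule nn_integral_cmult) measurable
    also have "\<dots> \<le> ?w * 1"
      using \<nu> by (intro mult_left_mono) (auto simp: admissible_def)
    finally show "(\<integral>\<^sup>+ x. ?f x y \<partial>\<nu>) \<le> ?w" by simp
  qed
  also have "\<dots> = 2 * (\<integral>\<^sup>+ y \<in> ball a (3 * r). 1 / ennreal (norm (a - y) ^ 1) \<partial>\<mu>)"
    by (intro nn_integral_cmult) measurable
  also have "\<dots> \<le> 2 * ennreal (2 * (2 ^ 1 * e * (3 * r) ^ (CARD('d) - 1 - 1)))"
    using d b e r \<mu>(2) by (intro mult_left_mono nn_integral_power_ball_le) (auto simp: balls_bounded_by_def)
  also have "\<dots> = ennreal (2 * (2 * (2 ^ 1 * e * (3 * r) ^ (CARD('d) - 1 - 1))))"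
    by (simp add: ennreal_mult')
  also have "2 * (2 * (2 ^ 1 * e * (3 * r) ^ (CARD('d) - 1 - 1))) = 8 * 3 ^ ?k * e * r ^ ?k"
  proof -
    have "CARD('d) - 1 - 1 = ?k" by simp
    then show ?thesis by (simp only: power_mult_distrib) simp
  qed
  finally show ?thesis .
qed

text \<open>The far part and the kernel at \<open>a\<close> are bounded pointwise by multiples of \<open>e\<close>, and \<open>\<nu> (B(a,r)) \<le> r^k\<close>; the near
part is bounded after integration.\<close>

lemma field_remainder_integral_le:
  fixes \<mu> \<nu> :: "(real ^ 'd) measure"
  defines "K \<equiv> real (CARD('d) - 2) * 2 ^ Suc (CARD('d) - 2) + real (CARD('d) - 2)"
  assumes d: "CARD('d) \<ge> 3" and \<mu>: "finite_measure \<mu>" "sets \<mu> = sets borel"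
    and b: "balls_bounded_by \<mu> a e s\<^sub>0" and e: "0 \<le> e" and r: "0 < r" "3 * r \<le> s\<^sub>0"
    and mass: "r * measure \<mu> UNIV / s\<^sub>0 ^ CARD('d) \<le> e"
    and \<nu>: "admissible \<nu>"
  shows "(\<integral>\<^sup>+ x \<in> ball a r. ennreal (field_remainder \<mu> a x) \<partial>\<nu>)
    \<le> ennreal ((K * 2 ^ CARD('d) + 6 * 2 ^ (CARD('d) - 2) + 8 * 3 ^ (CARD('d) - 2)) * e * r ^ (CARD('d) - 2))"
proof -
  let ?k = "CARD('d) - 2"
  interpret \<mu>: finite_measure \<mu> by fact
  have s\<mu>: "sets \<mu> = sets borel" by fact
  have s\<nu>: "sets \<nu> = sets borel" using \<nu> by (simp add: admissible_def)
  have [measurable_cong]: "sets \<mu> = sets borel" "sets \<nu> = sets borel" by fact+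
  have [measurable]: "\<And>t. ball a t \<in> sets borel" by simp
  have K: "0 \<le> K" by (simp add: K_def)
  have s0: "0 < s\<^sub>0" using r by simp
  have fin_a: "newton_potential \<mu> a \<noteq> top"
    by (rule newton_potential_center_finite[OF d \<mu> b e s0])
  define near where "near x = (\<integral>\<^sup>+ y \<in> cball a (2 * norm (x - a)). 1 / ennreal (norm (x - y) ^ ?k) \<partial>\<mu>)" for x
  let ?c = "(K * 2 ^ CARD('d) + 6 * 2 ^ ?k) * e"
  have ptw: "ennreal (field_remainder \<mu> a x) \<le> ennreal ?c + 1 / ennreal (norm (x - a)) * near x"
    if x: "x \<in> ball a r" for x
  proof (cases "x = a \<or> newton_potential \<mu> x = top")
    case True
    then show ?thesis by (auto simp: field_remainder_def)
  next
    case False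
    define \<rho> where "\<rho> = norm (x - a)"
    have \<rho>: "0 < \<rho>" "\<rho> < r" using False x by (auto simp: \<rho>_def dist_norm norm_minus_commute)
    define E where "E = enn2real (newton_potential \<mu> x) - enn2real (newton_potential \<mu> a)
      + real ?k * (truncated_field \<mu> a (2 * norm (x - a)) \<bullet> (x - a))"
    have "ennreal \<bar>E\<bar> \<le> ennreal (K * \<rho>\<^sup>2)
          * (\<integral>\<^sup>+ y \<in> - ball a (2 * \<rho>). 1 / ennreal (norm (a - y) ^ CARD('d)) \<partial>\<mu>)
        + near x + (\<integral>\<^sup>+ y \<in> cball a (2 * \<rho>). 1 / ennreal (norm (a - y) ^ ?k) \<partial>\<mu>)"
      using first_order_remainder_le[OF d \<mu> fin_a, of x] False
      unfolding E_def K_def \<rho>_def near_def by blast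
    also have "\<dots> \<le> ennreal (K * \<rho>\<^sup>2) * ennreal (2 ^ CARD('d) * e / (2 * \<rho>) + measure \<mu> UNIV / s\<^sub>0 ^ CARD('d))
        + near x + ennreal (2 * (2 ^ ?k * e * (3 * \<rho>) ^ (CARD('d) - 1 - ?k)))"
    proof (intro add_mono mult_left_mono order_refl)
      show "(\<integral>\<^sup>+ y \<in> - ball a (2 * \<rho>). 1 / ennreal (norm (a - y) ^ CARD('d)) \<partial>\<mu>)
        \<le> ennreal (2 ^ CARD('d) * e / (2 * \<rho>) + measure \<mu> UNIV / s\<^sub>0 ^ CARD('d))"
        using \<rho> r by (intro nn_integral_far_le[OF \<mu> b e]) auto
      have "(\<integral>\<^sup>+ y \<in> cball a (2 * \<rho>). 1 / ennreal (norm (a - y) ^ ?k) \<partial>\<mu>)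
        \<le> (\<integral>\<^sup>+ y \<in> ball a (3 * \<rho>). 1 / ennreal (norm (a - y) ^ ?k) \<partial>\<mu>)"
        using \<rho> by (intro nn_integral_mono) (auto simp: indicator_def)
      also have "\<dots> \<le> ennreal (2 * (2 ^ ?k * e * (3 * \<rho>) ^ (CARD('d) - 1 - ?k)))"
        using d b e r \<rho> s\<mu> by (intro nn_integral_power_ball_le) (auto simp: balls_bounded_by_def)
      finally show "(\<integral>\<^sup>+ y \<in> cball a (2 * \<rho>). 1 / ennreal (norm (a - y) ^ ?k) \<partial>\<mu>)
        \<le> ennreal (2 * (2 ^ ?k * e * (3 * \<rho>) ^ (CARD('d) - 1 - ?k)))" .
    qed auto
    also have "\<dots> = ennreal (K * \<rho>\<^sup>2 * (2 ^ CARD('d) * e / (2 * \<rho>) + measure \<mu> UNIV / s\<^sub>0 ^ CARD('d))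
        + 2 * (2 ^ ?k * e * (3 * \<rho>) ^ (CARD('d) - 1 - ?k))) + near x"
      using K e \<rho> s0 by (subst ennreal_plus) (auto simp: ennreal_mult' ac_simps)
    also have "K * \<rho>\<^sup>2 * (2 ^ CARD('d) * e / (2 * \<rho>) + measure \<mu> UNIV / s\<^sub>0 ^ CARD('d))
        + 2 * (2 ^ ?k * e * (3 * \<rho>) ^ (CARD('d) - 1 - ?k)) \<le> ?c * \<rho>"
    proof -
      have "K * \<rho>\<^sup>2 * (2 ^ CARD('d) * e / (2 * \<rho>) + measure \<mu> UNIV / s\<^sub>0 ^ CARD('d))
        = K * \<rho> * (2 ^ CARD('d) * e / 2 + \<rho> * measure \<mu> UNIV / s\<^sub>0 ^ CARD('d))"
        using \<rho> by (simp add: power2_eq_square field_simps)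
      also have "\<dots> \<le> K * \<rho> * (2 ^ CARD('d) * e / 2 + 2 ^ CARD('d) * e / 2)"
      proof (intro mult_left_mono add_left_mono)
        have "\<rho> * measure \<mu> UNIV / s\<^sub>0 ^ CARD('d) \<le> r * measure \<mu> UNIV / s\<^sub>0 ^ CARD('d)"
          using \<rho> s0 by (intro divide_right_mono mult_right_mono) auto
        also note mass
        also have "e \<le> 2 ^ CARD('d) * e / 2"
        proof -
          have "(2 :: real) ^ 1 \<le> 2 ^ CARD('d)" using d by (intro power_increasing) auto
          then have "2 * e \<le> 2 ^ CARD('d) * e" using e by (intro mult_right_mono) auto
          then show ?thesis by simp
        qed
        finally show "\<rho> * measure \<mu> UNIV / s\<^sub>0 ^ CARD('d) \<le> 2 ^ CARD('d) * e / 2" .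
      qed (use K \<rho> in auto)
      finally have "K * \<rho>\<^sup>2 * (2 ^ CARD('d) * e / (2 * \<rho>) + measure \<mu> UNIV / s\<^sub>0 ^ CARD('d))
        \<le> K * 2 ^ CARD('d) * e * \<rho>" by (simp add: mult_ac)
      moreover have "2 * (2 ^ ?k * e * (3 * \<rho>) ^ (CARD('d) - 1 - ?k)) = 6 * 2 ^ ?k * e * \<rho>"
      proof -
        have "CARD('d) - 1 - ?k = 1" using d by simp
        then show ?thesis by (simp only:) simp
      qed
      ultimately show ?thesis by (simp only: distrib_right)
    qed
    finally have le: "ennreal \<bar>E\<bar> \<le> ennreal (?c * \<rho>) + near x" by (simp add: ennreal_leI)
    have "ennreal (field_remainder \<mu> a x) = ennreal (1 / \<rho> * \<bar>E\<bar>)"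
      using False by (simp add: field_remainder_def E_def \<rho>_def)
    also have "\<dots> = ennreal (1 / \<rho>) * ennreal \<bar>E\<bar>" using \<rho> by (intro ennreal_mult') auto
    also have "\<dots> \<le> ennreal (1 / \<rho>) * (ennreal (?c * \<rho>) + near x)"
      by (intro mult_left_mono le) auto
    also have "\<dots> = ennreal (1 / \<rho> * (?c * \<rho>)) + ennreal (1 / \<rho>) * near x"
      using \<rho> by (subst ennreal_mult') (auto simp: distrib_left)
    also have "1 / \<rho> * (?c * \<rho>) = ?c" using \<rho> by simp
    also have "ennreal (1 / \<rho>) = 1 / ennreal (norm (x - a))" using \<rho> by (simp add: one_divide_ennreal \<rho>_def)
    finally show ?thesis .
  qed
  have near_meas: "(\<lambda>x. 1 / ennreal (norm (x - a)) * near x * indicator (ball a r) x) \<in> borel_measurable \<nu>"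
  proof -
    have "near = (\<lambda>x. \<integral>\<^sup>+ y. (if norm (y - a) \<le> 2 * norm (x - a) then 1 / ennreal (norm (x - y) ^ ?k) else 0) \<partial>\<mu>)"
      unfolding near_def by (intro ext nn_integral_cong) (auto simp: dist_norm norm_minus_commute)
    also have "\<dots> \<in> borel_measurable borel" by measurable
    finally have [measurable]: "near \<in> borel_measurable borel" .
    show ?thesis by measurable
  qed
  have "(\<integral>\<^sup>+ x \<in> ball a r. ennreal (field_remainder \<mu> a x) \<partial>\<nu>)
    \<le> (\<integral>\<^sup>+ x. ennreal ?c * indicator (ball a r) x + 1 / ennreal (norm (x - a)) * near x * indicator (ball a r) x \<partial>\<nu>)"
    using ptw by (intro nn_integral_mono) (auto simp: indicator_def)
  also have "\<dots> = ennreal ?c * emeasure \<nu> (ball a r)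
    + (\<integral>\<^sup>+ x \<in> ball a r. 1 / ennreal (norm (x - a)) * near x \<partial>\<nu>)"
  proof -
    have "(\<lambda>x. ennreal ?c * indicator (ball a r) x) \<in> borel_measurable \<nu>" by measurable
    then show ?thesis using near_meas by (simp add: nn_integral_add nn_integral_cmult_indicator s\<nu>)
  qed
  also have "\<dots> \<le> ennreal ?c * ennreal (r ^ ?k) + ennreal (8 * 3 ^ ?k * e * r ^ ?k)"
    unfolding near_def
    by (intro add_mono mult_left_mono admissible_ball[OF \<nu> r(1)] near_part_integral_le[OF d \<mu> b e r \<nu>]) auto
  also have "\<dots> = ennreal (?c * r ^ ?k + 8 * 3 ^ ?k * e * r ^ ?k)"
    using e r K by (subst ennreal_plus) (auto simp: ennreal_mult'')
  also have "?c * r ^ ?k + 8 * 3 ^ ?k * e * r ^ ?k = (K * 2 ^ CARD('d) + 6 * 2 ^ ?k + 8 * 3 ^ ?k) * e * r ^ ?k"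
    by (simp add: distrib_right)
  finally show ?thesis .
qed

text \<open>The preceding bound for normalised Lebesgue measure on the ball.\<close>

lemma field_remainder_lborel_le:
  fixes \<mu> :: "(real ^ 'd) measure"
  defines "K \<equiv> real (CARD('d) - 2) * 2 ^ Suc (CARD('d) - 2) + real (CARD('d) - 2)"
  assumes d: "CARD('d) \<ge> 3" and \<mu>: "finite_measure \<mu>" "sets \<mu> = sets borel"
    and b: "balls_bounded_by \<mu> a e s\<^sub>0" and e: "0 \<le> e" and r: "0 < r" "3 * r \<le> s\<^sub>0"
    and mass: "r * measure \<mu> UNIV / s\<^sub>0 ^ CARD('d) \<le> e"
  shows "(\<integral>\<^sup>+ x \<in> ball a r. ennreal (field_remainder \<mu> a x) \<partial>lborel)
    \<le> ennreal ((2 ^ CARD('d) + 1) * unit_ball_vol (real CARD('d))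
      * (K * 2 ^ CARD('d) + 6 * 2 ^ (CARD('d) - 2) + 8 * 3 ^ (CARD('d) - 2)) * e * r ^ CARD('d))"
proof -
  let ?k = "CARD('d) - 2" and ?v = "unit_ball_vol (real CARD('d))"
  let ?p = "(2 ^ CARD('d) + 1) * ?v * r\<^sup>2"
  let ?\<nu> = "density lborel (\<lambda>y. ennreal (1 / ?p) * indicator (ball a r) y)"
  let ?C = "K * 2 ^ CARD('d) + 6 * 2 ^ ?k + 8 * 3 ^ ?k"
  have p: "0 < ?p" using r by (intro mult_pos_pos) (auto intro!: add_pos_pos)
  have [measurable]: "field_remainder \<mu> a \<in> borel_measurable borel" by (rule remainders_measurable[OF \<mu>])
  have [measurable]: "ball a r \<in> sets borel" by simp
  have "(\<integral>\<^sup>+ x \<in> ball a r. ennreal (field_remainder \<mu> a x) \<partial>?\<nu>)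
      = (\<integral>\<^sup>+ x. ennreal (1 / ?p) * (ennreal (field_remainder \<mu> a x) * indicator (ball a r) x) \<partial>lborel)"
    by (subst nn_integral_density) (auto intro!: nn_integral_cong simp: indicator_def)
  also have "\<dots> = ennreal (1 / ?p) * (\<integral>\<^sup>+ x \<in> ball a r. ennreal (field_remainder \<mu> a x) \<partial>lborel)"
    by (rule nn_integral_cmult) measurable
  finally have eq: "(\<integral>\<^sup>+ x \<in> ball a r. ennreal (field_remainder \<mu> a x) \<partial>?\<nu>)
      = ennreal (1 / ?p) * (\<integral>\<^sup>+ x \<in> ball a r. ennreal (field_remainder \<mu> a x) \<partial>lborel)" .
  have "ennreal (1 / ?p) * (\<integral>\<^sup>+ x \<in> ball a r. ennreal (field_remainder \<mu> a x) \<partial>lborel)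
      \<le> ennreal (?C * e * r ^ ?k)"
    unfolding eq[symmetric] K_def
    by (rule field_remainder_integral_le[OF d \<mu> b e r mass uniform_ball_admissible[OF d r(1)]])
  then have "ennreal ?p * (ennreal (1 / ?p) * (\<integral>\<^sup>+ x \<in> ball a r. ennreal (field_remainder \<mu> a x) \<partial>lborel))
      \<le> ennreal ?p * ennreal (?C * e * r ^ ?k)"
    by (rule mult_left_mono) simp
  moreover have "ennreal ?p * (ennreal (1 / ?p) * z) = z" for z
    using ennreal_one_divide_mult_cancel[OF p, of z] by (simp only: mult.left_commute)
  moreover have "ennreal ?p * ennreal (?C * e * r ^ ?k) = ennreal (?p * (?C * e * r ^ ?k))"
    using p by (intro ennreal_mult'[symmetric]) simp
  moreover have "?p * (?C * e * r ^ ?k) = (2 ^ CARD('d) + 1) * ?v * ?C * e * r ^ CARD('d)"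
    using d by (subst power_split_two[of "CARD('d)" r]) (auto simp only: mult_ac)
  ultimately show ?thesis by simp
qed

section \<open>Differentiability from density and principal value\<close>

lemma ennreal_divide_le:
  assumes "X \<le> ennreal p" "ennreal q \<le> Y" "0 < q" "0 \<le> p"
  shows "X / Y \<le> ennreal (p / q)"
proof (cases Y)
  case (real y)
  then have y: "q \<le> y" using assms by simp
  obtain x where x: "X = ennreal x" "0 \<le> x" using assms(1) by (cases X) (auto simp: top_unique)
  then have "x \<le> p" using assms by simp
  then show ?thesis using x y real assms by (auto simp: divide_ennreal intro!: ennreal_leI frac_le)
qed simp

lemma tendsto_zero_ennrealI:
  fixes X :: "'a \<Rightarrow> ennreal"
  assumes C: "0 < C" and le: "\<And>e. 0 < e \<Longrightarrow> eventually (\<lambda>r. X r \<le> ennreal (C * e)) F"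
  shows "(X \<longlongrightarrow> 0) F"
proof (rule order_tendstoI)
  fix z :: ennreal assume "0 < z"
  then obtain y where y: "0 < y" "y < z" using dense by blast
  then have "y < top" using le_less_trans[of y z top] top_greatest less_le_trans by blast
  then obtain c where c: "y = ennreal c" "0 < c" using y(1) by (cases y) auto
  have "eventually (\<lambda>r. X r \<le> ennreal (C * (c / C))) F" using c C by (intro le) auto
  then show "eventually (\<lambda>r. X r < z) F"
    by eventually_elim (use C y c in auto)
qed simp

lemma tendsto_normI:
  fixes f :: "'a \<Rightarrow> 'b :: real_normed_vector"
  assumes C: "0 < C" and le: "\<And>e. 0 < e \<Longrightarrow> eventually (\<lambda>r. norm (f r - l) \<le> C * e) F"
  shows "(f \<longlongrightarrow> l) F"
proof (rule tendstoI)
  fix e :: real assume e: "0 < e"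
  have "eventually (\<lambda>r. norm (f r - l) \<le> C * (e / (2 * C))) F" using e C by (intro le) auto
  then show "eventually (\<lambda>r. dist (f r) l < e) F"
    by eventually_elim (use C e in \<open>auto simp: dist_norm\<close>)
qed

lemma capacity_differentiable_potential_iff:
  fixes \<mu> :: "(real ^ 'd) measure"
  shows "capacity_differentiable_at (\<lambda>x. enn2ereal (newton_potential \<mu> x)) a \<longleftrightarrow>
    newton_potential \<mu> a \<noteq> top \<and>
    (\<exists>A. ((\<lambda>r. (SUP t\<in>{0<..}. ennreal t * capacity {x \<in> ball a r. affine_remainder \<mu> a A x > t})
      / capacity (ball a r)) \<longlongrightarrow> 0) (at_right 0))"
proof -
  have fin: "\<bar>enn2ereal v\<bar> \<noteq> \<infinity> \<longleftrightarrow> v \<noteq> top" for v :: ennreal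
    by (cases v) (auto simp: enn2ereal_ennreal)
  have cap_eq: "ennreal t * capacity {x \<in> ball a r. \<bar>enn2ereal (newton_potential \<mu> x)\<bar> \<noteq> \<infinity> \<and>
      \<bar>real_of_ereal (enn2ereal (newton_potential \<mu> x)) - real_of_ereal (enn2ereal (newton_potential \<mu> a))
        - (\<Sum>i\<in>UNIV. A $ i * (x $ i - a $ i))\<bar> / norm (x - a) > t}
    = ennreal t * capacity {x \<in> ball a r. affine_remainder \<mu> a A x > t}" if "0 < t" for t r and A :: "real ^ 'd"
  proof (rule arg_cong[where f = "\<lambda>S. ennreal t * capacity S"], rule Collect_cong)
    fix x
    have dot: "(\<Sum>i\<in>UNIV. A $ i * (x $ i - a $ i)) = A \<bullet> (x - a)" by (simp add: inner_vec_def)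
    show "x \<in> ball a r \<and> \<bar>enn2ereal (newton_potential \<mu> x)\<bar> \<noteq> \<infinity> \<and>
        t < \<bar>real_of_ereal (enn2ereal (newton_potential \<mu> x)) - real_of_ereal (enn2ereal (newton_potential \<mu> a))
          - (\<Sum>i\<in>UNIV. A $ i * (x $ i - a $ i))\<bar> / norm (x - a)
      \<longleftrightarrow> x \<in> ball a r \<and> t < affine_remainder \<mu> a A x"
      unfolding fin affine_remainder_def enn2real_def dot using that
      by (cases "newton_potential \<mu> x = top") (simp_all only: if_True if_False, auto)
  qed
  show ?thesis
    unfolding capacity_differentiable_at_def Let_def
    by (intro conj_cong fin refl ex_cong1 filterlim_cong always_eventually allI arg_cong2[where f = "(/)"] SUP_cong)
      (rule cap_eq, simp)
qed

lemma balls_bounded_of_tendsto: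
  fixes \<mu> :: "(real ^ 'd) measure"
  assumes \<mu>: "finite_measure \<mu>" and e: "0 < e"
    and lim: "((\<lambda>r. measure \<mu> (ball a r) / r ^ (CARD('d) - 1)) \<longlongrightarrow> 0) (at_right 0)"
  obtains s\<^sub>0 where "0 < s\<^sub>0" "balls_bounded_by \<mu> a e s\<^sub>0"
proof -
  interpret finite_measure \<mu> by fact
  obtain b where b: "0 < b" "\<And>s. 0 < s \<Longrightarrow> s < b \<Longrightarrow> measure \<mu> (ball a s) / s ^ (CARD('d) - 1) < e"
    using order_tendstoD(2)[OF lim e] by (auto simp: eventually_at_right_field)
  have "balls_bounded_by \<mu> a e (b / 2)"
    unfolding balls_bounded_by_def
  proof (intro allI impI)
    fix s :: real assume s: "0 < s" "s \<le> b / 2"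
    then have "measure \<mu> (ball a s) / s ^ (CARD('d) - 1) \<le> e" using b by (intro less_imp_le b(2)) auto
    then have "measure \<mu> (ball a s) \<le> e * s ^ (CARD('d) - 1)" using s by (simp add: pos_divide_le_eq)
    then show "emeasure \<mu> (ball a s) \<le> ennreal (e * s ^ (CARD('d) - 1))"
      by (simp add: emeasure_eq_measure ennreal_leI)
  qed
  then show ?thesis using b(1) that[of "b / 2"] by simp
qed

lemma eventually_small_radius:
  assumes s: "0 < s\<^sub>0" and e: "0 < (e :: real)"
  shows "eventually (\<lambda>r. 0 < r \<and> 3 * r \<le> s\<^sub>0 \<and> r * M / s\<^sub>0 ^ n \<le> e) (at_right 0)"
proof -
  have "((\<lambda>r. r * M / s\<^sub>0 ^ n) \<longlongrightarrow> 0 * M / s\<^sub>0 ^ n) (at_right 0)"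
    using s by (intro tendsto_intros) auto
  then have "eventually (\<lambda>r. r * M / s\<^sub>0 ^ n < e) (at_right 0)"
    using e by (intro order_tendstoD(2)) auto
  moreover have "eventually (\<lambda>r. r < s\<^sub>0 / 3) (at_right 0)"
    using s by (intro eventually_at_rightI[of 0 "s\<^sub>0 / 3"]) auto
  moreover have "eventually (\<lambda>r :: real. 0 < r) (at_right 0)"
    by (rule eventually_at_right_less)
  ultimately show ?thesis by eventually_elim auto
qed

text \<open>With \<open>A = - k L\<close>, the quotient \<open>Q\<close> exceeds the remainder of the field expansion by at most \<open>k |G - L|\<close>.\<close>

lemma capacity_differentiable_of_field_limit:
  fixes \<mu> :: "(real ^ 'd) measure"
  assumes d: "CARD('d) \<ge> 3" and \<mu>: "finite_measure \<mu>" "sets \<mu> = sets borel"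
    and dens: "((\<lambda>r. measure \<mu> (ball a r) / r ^ (CARD('d) - 1)) \<longlongrightarrow> 0) (at_right 0)"
    and L: "(truncated_field \<mu> a \<longlongrightarrow> L) (at_right 0)"
  shows "capacity_differentiable_at (\<lambda>x. enn2ereal (newton_potential \<mu> x)) a"
proof -
  let ?k = "CARD('d) - 2"
  define A where "A = - (real ?k *\<^sub>R L)"
  define K where "K = real ?k * 2 ^ Suc ?k + real ?k"
  define C where "C = K * 2 ^ CARD('d) + 6 * 2 ^ ?k + 8 * 3 ^ ?k"
  define R where "R r = (SUP t\<in>{0<..}. ennreal t * capacity {x \<in> ball a r. affine_remainder \<mu> a A x > t})" for r
  have K: "0 \<le> K" by (simp add: K_def)
  then have C: "0 < C" unfolding C_def by (intro add_nonneg_pos) auto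
  have fin: "newton_potential \<mu> a \<noteq> top"
  proof -
    obtain s\<^sub>0 where "0 < s\<^sub>0" "balls_bounded_by \<mu> a 1 s\<^sub>0"
      by (rule balls_bounded_of_tendsto[OF \<mu>(1) zero_less_one dens])
    then show ?thesis by (intro newton_potential_center_finite[OF d \<mu>]) auto
  qed
  have "((\<lambda>r. R r / capacity (ball a r)) \<longlongrightarrow> 0) (at_right 0)"
  proof (rule tendsto_zero_ennrealI)
    show "0 < (C + real ?k) * (2 ^ CARD('d) + 1)" using C by (intro mult_pos_pos add_pos_nonneg) auto
    fix e :: real assume e: "0 < e"
    obtain s\<^sub>0 where s0: "0 < s\<^sub>0" "balls_bounded_by \<mu> a e s\<^sub>0"
      by (rule balls_bounded_of_tendsto[OF \<mu>(1) e dens])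
    obtain \<epsilon>\<^sub>0 where \<epsilon>0: "0 < \<epsilon>\<^sub>0" "\<And>\<epsilon>. 0 < \<epsilon> \<Longrightarrow> \<epsilon> < \<epsilon>\<^sub>0 \<Longrightarrow> dist (truncated_field \<mu> a \<epsilon>) L < e"
      using tendstoD[OF L e] by (auto simp: eventually_at_right_field)
    have "eventually (\<lambda>r. r < \<epsilon>\<^sub>0 / 2) (at_right 0)"
      using \<epsilon>0 by (intro eventually_at_rightI[of 0 "\<epsilon>\<^sub>0 / 2"]) auto
    then show "eventually (\<lambda>r. R r / capacity (ball a r) \<le> ennreal ((C + real ?k) * (2 ^ CARD('d) + 1) * e)) (at_right 0)"
      using eventually_small_radius[OF s0(1) e, of "measure \<mu> UNIV" "CARD('d)"]
    proof eventually_elim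
      fix r assume r\<epsilon>: "r < \<epsilon>\<^sub>0 / 2" and "0 < r \<and> 3 * r \<le> s\<^sub>0 \<and> r * measure \<mu> UNIV / s\<^sub>0 ^ CARD('d) \<le> e"
      then have r: "0 < r" "3 * r \<le> s\<^sub>0" "r * measure \<mu> UNIV / s\<^sub>0 ^ CARD('d) \<le> e" by auto
      have int: "(\<integral>\<^sup>+ x \<in> ball a r. ennreal (affine_remainder \<mu> a A x) \<partial>\<nu>) \<le> ennreal ((C + real ?k) * e * r ^ ?k)"
        if \<nu>: "admissible \<nu>" for \<nu>
      proof -
        have s\<nu>: "sets \<nu> = sets borel" using \<nu> by (simp add: admissible_def)
        have [measurable_cong]: "sets \<nu> = sets borel" by fact
        have [measurable]: "ball a r \<in> sets borel" "field_remainder \<mu> a \<in> borel_measurable borel"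
          by (simp_all add: remainders_measurable[OF \<mu>])
        have ptw: "affine_remainder \<mu> a A x \<le> field_remainder \<mu> a x + real ?k * e" if x: "x \<in> ball a r" for x
        proof (cases "x = a \<or> newton_potential \<mu> x = top")
          case True
          then show ?thesis using e by (auto simp: affine_remainder_def field_remainder_def)
        next
          case False
          have "A + real ?k *\<^sub>R truncated_field \<mu> a (2 * norm (x - a))
            = real ?k *\<^sub>R (truncated_field \<mu> a (2 * norm (x - a)) - L)"
            by (simp add: A_def scaleR_diff_right)
          moreover have "norm (truncated_field \<mu> a (2 * norm (x - a)) - L) \<le> e"
            using \<epsilon>0(2)[of "2 * norm (x - a)"] False x r\<epsilon> by (auto simp: dist_norm norm_minus_commute)
          ultimately have "norm (A + real ?k *\<^sub>R truncated_field \<mu> a (2 * norm (x - a))) \<le> real ?k * e"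
            by (simp add: mult_left_mono)
          then show ?thesis using remainders_difference(2)[of \<mu> x a A] False by linarith
        qed
        have "(\<integral>\<^sup>+ x \<in> ball a r. ennreal (affine_remainder \<mu> a A x) \<partial>\<nu>)
          \<le> (\<integral>\<^sup>+ x. ennreal (field_remainder \<mu> a x) * indicator (ball a r) x
            + ennreal (real ?k * e) * indicator (ball a r) x \<partial>\<nu>)"
        proof (intro nn_integral_mono)
          fix x
          show "ennreal (affine_remainder \<mu> a A x) * indicator (ball a r) x
            \<le> ennreal (field_remainder \<mu> a x) * indicator (ball a r) x + ennreal (real ?k * e) * indicator (ball a r) x"
            using ptw[of x] e remainders_nonneg(1)[of \<mu> a x]
            by (cases "x \<in> ball a r") (simp_all add: ennreal_leI flip: ennreal_plus)
        qed
        also have "\<dots> = (\<integral>\<^sup>+ x \<in> ball a r. ennreal (field_remainder \<mu> a x) \<partial>\<nu>)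
          + ennreal (real ?k * e) * emeasure \<nu> (ball a r)"
        proof -
          have "(\<lambda>x. ennreal (field_remainder \<mu> a x) * indicator (ball a r) x) \<in> borel_measurable \<nu>"
            "(\<lambda>x. ennreal (real ?k * e) * indicator (ball a r) x) \<in> borel_measurable \<nu>" by measurable
          then show ?thesis by (simp add: nn_integral_add nn_integral_cmult_indicator s\<nu>)
        qed
        also have "\<dots> \<le> ennreal (C * e * r ^ ?k) + ennreal (real ?k * e) * ennreal (r ^ ?k)"
          using field_remainder_integral_le[OF d \<mu> s0(2) less_imp_le[OF e] r \<nu>] e
          unfolding C_def K_def by (intro add_mono mult_left_mono admissible_ball[OF \<nu> r(1)]) auto
        also have "\<dots> = ennreal (C * e * r ^ ?k + real ?k * e * r ^ ?k)"
          using e r C by (subst ennreal_plus) (auto simp: ennreal_mult'')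
        also have "C * e * r ^ ?k + real ?k * e * r ^ ?k = (C + real ?k) * e * r ^ ?k"
          by (simp add: distrib_right)
        finally show ?thesis .
      qed
      have "R r \<le> ennreal ((C + real ?k) * e * r ^ ?k)"
        unfolding R_def
      proof (rule SUP_least)
        fix t :: real
        show "ennreal t * capacity {x \<in> ball a r. affine_remainder \<mu> a A x > t} \<le> ennreal ((C + real ?k) * e * r ^ ?k)"
          by (rule times_capacity_le[OF int]) (auto intro: ennreal_leI)
      qed
      moreover have "ennreal (r ^ ?k / (2 ^ CARD('d) + 1)) \<le> capacity (ball a r)"
        by (rule capacity_ball_ge[OF d r(1)])
      ultimately have "R r / capacity (ball a r)
          \<le> ennreal ((C + real ?k) * e * r ^ ?k / (r ^ ?k / (2 ^ CARD('d) + 1)))"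
        using r e C by (intro ennreal_divide_le) (auto intro!: divide_pos_pos add_pos_pos)
      also have "(C + real ?k) * e * r ^ ?k / (r ^ ?k / (2 ^ CARD('d) + 1)) = (C + real ?k) * (2 ^ CARD('d) + 1) * e"
        using r by simp
      finally show "R r / capacity (ball a r) \<le> ennreal ((C + real ?k) * (2 ^ CARD('d) + 1) * e)" .
    qed
  qed
  then show ?thesis
    unfolding capacity_differentiable_potential_iff R_def using fin by blast
qed

section \<open>Density and principal value from differentiability\<close>

lemma eventually_mean_affine_remainder_le:
  fixes \<mu> :: "(real ^ 'd) measure"
  assumes d: "CARD('d) \<ge> 3" and \<mu>: "finite_measure \<mu>" "sets \<mu> = sets borel" and e: "0 < e"
    and lim: "((\<lambda>r. (SUP t\<in>{0<..}. ennreal t * capacity {x \<in> ball a r. affine_remainder \<mu> a A x > t})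
      / capacity (ball a r)) \<longlongrightarrow> 0) (at_right 0)"
  shows "eventually (\<lambda>r. (\<integral>\<^sup>+ x \<in> ball a r. ennreal (affine_remainder \<mu> a A x) \<partial>lborel)
    \<le> ennreal (4 ^ (CARD('d) + 1) * unit_ball_vol (real CARD('d)) * e * r ^ CARD('d))) (at_right 0)"
proof -
  let ?k = "CARD('d) - 2"
  have "eventually (\<lambda>r. (SUP t\<in>{0<..}. ennreal t * capacity {x \<in> ball a r. affine_remainder \<mu> a A x > t})
      / capacity (ball a r) < ennreal e) (at_right 0)"
    using e by (intro order_tendstoD(2)[OF lim]) simp
  moreover have "eventually (\<lambda>r :: real. 0 < r) (at_right 0)" by (rule eventually_at_right_less)
  ultimately show ?thesis
  proof eventually_elim
    fix r :: real
    let ?R = "SUP t\<in>{0<..}. ennreal t * capacity {x \<in> ball a r. affine_remainder \<mu> a A x > t}"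
    let ?Y = "capacity (ball a r)"
    assume lt: "?R / ?Y < ennreal e" and r: "0 < r"
    have "0 < ennreal (r ^ ?k / (2 ^ CARD('d) + 1))" using r by (auto intro!: divide_pos_pos add_pos_pos)
    also have "\<dots> \<le> ?Y" by (rule capacity_ball_ge[OF d r])
    finally have Y0: "0 < ?Y" .
    have Y1: "?Y \<le> ennreal (r ^ ?k)" by (rule capacity_ball_le[OF r])
    then have "?Y < top" by (rule le_less_trans) simp
    with Y0 have "?R = ?R / ?Y * ?Y" by (simp add: ennreal_divide_times)
    also have "\<dots> \<le> ennreal e * ennreal (r ^ ?k)"
      using lt Y1 by (intro mult_mono) auto
    also have "\<dots> = ennreal (e * r ^ ?k)" using e by (simp add: ennreal_mult')
    finally have R: "?R \<le> ennreal (e * r ^ ?k)" .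
    show "(\<integral>\<^sup>+ x \<in> ball a r. ennreal (affine_remainder \<mu> a A x) \<partial>lborel)
      \<le> ennreal (4 ^ (CARD('d) + 1) * unit_ball_vol (real CARD('d)) * e * r ^ CARD('d))"
    proof (rule nn_integral_lborel_le_of_weak_capacity[OF d remainders_measurable(2)[OF \<mu>] e r])
      fix t :: real assume "0 < t"
      then have "ennreal t * capacity {x \<in> ball a r. affine_remainder \<mu> a A x > t} \<le> ?R"
        by (intro SUP_upper) simp
      also note R
      finally show "ennreal t * capacity {x \<in> ball a r. affine_remainder \<mu> a A x > t} \<le> ennreal (e * r ^ ?k)" .
    qed
  qed
qed

text \<open>On \<open>B(a,r)\<close> the deviation of \<open>u\<close> from the affine function is at most \<open>r Q\<close>, with integral \<open>o(r^(d+1))\<close>;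
testing with the bump costs the factor \<open>r^(-2)\<close>.\<close>

lemma density_limit_of_mean_remainder:
  fixes \<mu> :: "(real ^ 'd) measure"
  assumes d: "CARD('d) \<ge> 3" and \<mu>: "finite_measure \<mu>" "sets \<mu> = sets borel"
    and mean: "\<And>e. 0 < e \<Longrightarrow> eventually (\<lambda>r. (\<integral>\<^sup>+ x \<in> ball a r. ennreal (affine_remainder \<mu> a A x) \<partial>lborel)
      \<le> ennreal (4 ^ (CARD('d) + 1) * unit_ball_vol (real CARD('d)) * e * r ^ CARD('d))) (at_right 0)"
  shows "((\<lambda>r. measure \<mu> (ball a r) / r ^ (CARD('d) - 1)) \<longlongrightarrow> 0) (at_right 0)"
proof (rule tendsto_normI)
  let ?n = "CARD('d) - 1" and ?v = "unit_ball_vol (real CARD('d))"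
  let ?C = "4 ^ (CARD('d) + 1) * ?v" and ?b = "?v / 2 ^ (CARD('d) + 10)" and ?T = "24 + 6 * real CARD('d)"
  have b: "0 < ?b" by simp
  have n: "r ^ CARD('d) = r ^ ?n * r" for r :: real
    by (metis power_minus_mult zero_less_card_finite mult.commute)
  have [measurable]: "affine_remainder \<mu> a A \<in> borel_measurable borel"
    by (rule remainders_measurable[OF \<mu>])
  show "0 < ?T * ?C * 2 ^ ?n / ?b" by (intro divide_pos_pos mult_pos_pos b) auto
  fix e :: real assume e: "0 < e"
  obtain t where t: "0 < t" "\<And>r. 0 < r \<Longrightarrow> r < t \<Longrightarrow>
    (\<integral>\<^sup>+ x \<in> ball a r. ennreal (affine_remainder \<mu> a A x) \<partial>lborel) \<le> ennreal (?C * e * r ^ CARD('d))"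
    using mean[OF e] by (auto simp: eventually_at_right_field)
  show "eventually (\<lambda>s. norm (measure \<mu> (ball a s) / s ^ ?n - 0) \<le> ?T * ?C * 2 ^ ?n / ?b * e) (at_right 0)"
  proof (rule eventually_at_rightI[of 0 "t / 2"])
    fix s assume "s \<in> {0<..<t / 2}"
    then have s: "0 < s" "2 * s < t" by auto
    \<comment> \<open>The bump of radius \<open>r\<close> sees the mass of the ball of radius \<open>r / 2\<close>.\<close>
    define r where "r = 2 * s"
    have r: "0 < r" "r < t" "r / 2 = s" using s by (auto simp: r_def)
    let ?u = "newton_potential \<mu>"
    let ?c = "enn2real (?u a) - A \<bullet> a"
    have "(\<integral>\<^sup>+ x \<in> ball a r. ennreal (if ?u x = top then 0 else \<bar>enn2real (?u x) - (A \<bullet> x + ?c)\<bar>) \<partial>lborel)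
      \<le> (\<integral>\<^sup>+ x. ennreal r * (ennreal (affine_remainder \<mu> a A x) * indicator (ball a r) x) \<partial>lborel)"
    proof (intro nn_integral_mono)
      fix x
      show "ennreal (if ?u x = top then 0 else \<bar>enn2real (?u x) - (A \<bullet> x + ?c)\<bar>) * indicator (ball a r) x
        \<le> ennreal r * (ennreal (affine_remainder \<mu> a A x) * indicator (ball a r) x)"
      proof (cases "x \<in> ball a r \<and> ?u x \<noteq> top")
        case True
        have "\<bar>enn2real (?u x) - (A \<bullet> x + ?c)\<bar> = \<bar>enn2real (?u x) - enn2real (?u a) - A \<bullet> (x - a)\<bar>"
          by (simp add: inner_diff_right algebra_simps)
        also have "\<dots> = norm (x - a) * affine_remainder \<mu> a A x"
          using True by (cases "x = a") (auto simp: affine_remainder_def)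
        also have "\<dots> \<le> r * affine_remainder \<mu> a A x"
          using True remainders_nonneg(2)[of \<mu> a A x] by (intro mult_right_mono) (auto simp: dist_norm norm_minus_commute)
        finally have "ennreal \<bar>enn2real (?u x) - (A \<bullet> x + ?c)\<bar> \<le> ennreal (r * affine_remainder \<mu> a A x)"
          by (rule ennreal_leI)
        then show ?thesis using True r by (simp add: ennreal_mult')
      qed (auto simp: indicator_def)
    qed
    also have "\<dots> = ennreal r * (\<integral>\<^sup>+ x \<in> ball a r. ennreal (affine_remainder \<mu> a A x) \<partial>lborel)"
    proof (rule nn_integral_cmult)
      have [measurable]: "ball a r \<in> sets borel" by simp
      show "(\<lambda>x. ennreal (affine_remainder \<mu> a A x) * indicator (ball a r) x) \<in> borel_measurable lborel"
        by measurable
    qed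
    also have "\<dots> \<le> ennreal r * ennreal (?C * e * r ^ CARD('d))"
      using t(2)[OF r(1,2)] by (rule mult_left_mono) simp
    also have "\<dots> = ennreal (r * (?C * e * r ^ CARD('d)))"
      using r by (intro ennreal_mult'[symmetric]) simp
    finally have "?b * r ^ 6 * measure \<mu> (ball a (r / 2)) \<le> ?T * r ^ 4 * (r * (?C * e * r ^ CARD('d)))"
      using e r by (intro measure_ball_le_affine_deviation[OF d \<mu> r(1)]) auto
    then have "r ^ 6 * (?b * measure \<mu> (ball a s)) \<le> r ^ 6 * (?T * ?C * e * r ^ ?n)"
      unfolding n r(3) by (simp add: mult_ac numeral_eq_Suc)
    then have "?b * measure \<mu> (ball a s) \<le> ?T * ?C * e * r ^ ?n"
      using r by (subst (asm) mult_le_cancel_left_pos) auto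
    then have "measure \<mu> (ball a s) \<le> ?T * ?C * e * r ^ ?n / ?b"
      using b by (subst pos_le_divide_eq) (auto simp: mult.commute)
    then have "measure \<mu> (ball a s) / s ^ ?n \<le> ?T * ?C * e * r ^ ?n / ?b / s ^ ?n"
      using s by (intro divide_right_mono) auto
    also have "\<dots> = ?T * ?C * 2 ^ ?n / ?b * e * (s ^ ?n / s ^ ?n)"
      unfolding r_def power_mult_distrib by simp
    also have "s ^ ?n / s ^ ?n = 1" using s by simp
    finally show "norm (measure \<mu> (ball a s) / s ^ ?n - 0) \<le> ?T * ?C * 2 ^ ?n / ?b * e"
      using s by simp
  qed (use t in auto)
qed

text \<open>A vector \<open>V\<close> is recovered from averages of \<open>|V \<bullet> (x - a)| / |x - a|\<close> by looking only at a small ball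
placed in the direction of \<open>V\<close>, where this quotient is at least \<open>5/8\<close> of \<open>|V|\<close>.\<close>

lemma norm_le_of_directional_average:
  fixes f :: "real ^ 'd \<Rightarrow> real" and V :: "real ^ 'd"
  assumes r: "0 < r" and M: "0 \<le> M" and c: "0 \<le> c"
    and V: "AE x in lborel. x \<in> ball a r \<longrightarrow> r / 2 \<le> norm (x - a) \<longrightarrow> \<bar>V \<bullet> (x - a)\<bar> \<le> (f x + c) * norm (x - a)"
    and f: "(\<integral>\<^sup>+ x \<in> ball a r. ennreal (f x) \<partial>lborel) \<le> ennreal (unit_ball_vol (real CARD('d)) * M * r ^ CARD('d))"
  shows "5 / 8 * norm V - c \<le> 8 ^ CARD('d) * M"
proof (cases "5 / 8 * norm V - c \<le> 0")
  case True
  also have "0 \<le> 8 ^ CARD('d) * M" using M by simp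
  finally show ?thesis .
next
  case False
  let ?v = "unit_ball_vol (real CARD('d))"
  \<comment> \<open>The ball of radius \<open>r / 8\<close> around \<open>z\<close> lies in the shell between \<open>r / 2\<close> and \<open>r\<close>.\<close>
  define z where "z = a + (3 / 4 * r / norm V) *\<^sub>R V"
  define \<eta> where "\<eta> = 5 / 8 * norm V - c"
  have \<eta>: "0 < \<eta>" using False by (simp add: \<eta>_def)
  have V0: "0 < norm V" using False c by (cases "V = 0") auto
  have geom: "x \<in> ball a r" "r / 2 \<le> norm (x - a)" "5 / 8 * norm V * norm (x - a) \<le> V \<bullet> (x - a)"
    if x: "x \<in> ball z (r / 8)" for x
  proof -
    have az: "norm (z - a) = 3 / 4 * r" using V0 r by (simp add: z_def)
    have xz: "norm (x - z) \<le> r / 8" using x by (simp add: dist_norm norm_minus_commute)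
    have "norm (x - a) \<le> norm (x - z) + norm (z - a)" using norm_triangle_ineq[of "x - z" "z - a"] by simp
    then have upper: "norm (x - a) \<le> 7 / 8 * r" using az xz by simp
    then show "x \<in> ball a r" using r by (simp add: dist_norm norm_minus_commute)
    have "norm (z - a) \<le> norm (x - z) + norm (x - a)"
      using norm_triangle_ineq[of "z - x" "x - a"] by (simp add: norm_minus_commute)
    then show "r / 2 \<le> norm (x - a)" using az xz r by simp
    have "V \<bullet> (x - a) = V \<bullet> (z - a) + V \<bullet> (x - z)" by (simp add: inner_diff_right)
    moreover have "V \<bullet> (z - a) = 3 / 4 * r * norm V"
      using V0 by (simp add: z_def dot_square_norm power2_eq_square)
    moreover have "\<bar>V \<bullet> (x - z)\<bar> \<le> norm V * (r / 8)"
      by (rule order.trans[OF Cauchy_Schwarz_ineq2]) (intro mult_left_mono xz norm_ge_zero)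
    ultimately have "5 / 8 * (norm V * r) \<le> V \<bullet> (x - a)" by (simp add: abs_le_iff mult_ac)
    moreover have "norm V * norm (x - a) \<le> norm V * r"
      using upper r by (intro mult_left_mono) auto
    ultimately show "5 / 8 * norm V * norm (x - a) \<le> V \<bullet> (x - a)" by simp
  qed
  have "ennreal (\<eta> * (?v * (r / 8) ^ CARD('d))) = ennreal \<eta> * emeasure lborel (ball z (r / 8))"
    using r \<eta> by (subst emeasure_lborel_ball) (auto simp: ennreal_mult')
  also have "\<dots> = (\<integral>\<^sup>+ x \<in> ball z (r / 8). ennreal \<eta> \<partial>lborel)"
    by (simp add: nn_integral_cmult_indicator)
  also have "\<dots> \<le> (\<integral>\<^sup>+ x \<in> ball a r. ennreal (f x) \<partial>lborel)"
  proof (rule nn_integral_mono_AE)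
    show "AE x in lborel. ennreal \<eta> * indicator (ball z (r / 8)) x \<le> ennreal (f x) * indicator (ball a r) x"
      using V
    proof eventually_elim
      fix x assume V: "x \<in> ball a r \<longrightarrow> r / 2 \<le> norm (x - a) \<longrightarrow> \<bar>V \<bullet> (x - a)\<bar> \<le> (f x + c) * norm (x - a)"
      show "ennreal \<eta> * indicator (ball z (r / 8)) x \<le> ennreal (f x) * indicator (ball a r) x"
      proof (cases "x \<in> ball z (r / 8)")
        case True
        note g = geom[OF True]
        have "5 / 8 * norm V * norm (x - a) \<le> (f x + c) * norm (x - a)"
          using g V by linarith
        moreover have "0 < norm (x - a)" using g(2) r by linarith
        ultimately have "5 / 8 * norm V \<le> f x + c" by (rule mult_right_le_imp_le)
        then show ?thesis using True g(1) by (auto simp: \<eta>_def intro: ennreal_leI)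
      qed simp
    qed
  qed
  also note f
  finally have "\<eta> * (?v * (r / 8) ^ CARD('d)) \<le> ?v * M * r ^ CARD('d)"
    using r M by (subst (asm) ennreal_le_iff) auto
  then have "(?v * r ^ CARD('d)) * (\<eta> / 8 ^ CARD('d)) \<le> (?v * r ^ CARD('d)) * M"
    by (simp add: power_divide mult_ac)
  then have "\<eta> / 8 ^ CARD('d) \<le> M"
    using r by (subst (asm) mult_le_cancel_left_pos) auto
  then show ?thesis unfolding \<eta>_def by (simp add: field_simps)
qed

text \<open>Subtracting the two expansions bounds \<open>(A + k G(2|x-a|)) \<bullet> (x - a)\<close> in the mean. For \<open>|x - a|\<close> between
\<open>r / 2\<close> and \<open>r\<close> the field may be replaced by \<open>G(2r)\<close>, and then the vector \<open>A + k G(2r)\<close> itself is small.\<close>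

lemma field_limit_of_mean_remainder:
  fixes \<mu> :: "(real ^ 'd) measure"
  assumes d: "CARD('d) \<ge> 3" and \<mu>: "finite_measure \<mu>" "sets \<mu> = sets borel"
    and dens: "((\<lambda>r. measure \<mu> (ball a r) / r ^ (CARD('d) - 1)) \<longlongrightarrow> 0) (at_right 0)"
    and mean: "\<And>e. 0 < e \<Longrightarrow> eventually (\<lambda>r. (\<integral>\<^sup>+ x \<in> ball a r. ennreal (affine_remainder \<mu> a A x) \<partial>lborel)
      \<le> ennreal (4 ^ (CARD('d) + 1) * unit_ball_vol (real CARD('d)) * e * r ^ CARD('d))) (at_right 0)"
  shows "(truncated_field \<mu> a \<longlongrightarrow> - ((1 / real (CARD('d) - 2)) *\<^sub>R A)) (at_right 0)"
proof (rule tendsto_normI)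
  let ?k = "CARD('d) - 2" and ?v = "unit_ball_vol (real CARD('d))"
  define K where "K = real ?k * 2 ^ Suc ?k + real ?k"
  define C\<^sub>1 :: real where "C\<^sub>1 = 4 ^ (CARD('d) + 1)"
  define C\<^sub>2 where "C\<^sub>2 = (2 ^ CARD('d) + 1) * (K * 2 ^ CARD('d) + 6 * 2 ^ ?k + 8 * 3 ^ ?k)"
  define C where "C = 8 / 5 * (8 ^ CARD('d) * (C\<^sub>1 + C\<^sub>2) + real ?k * 3 ^ (CARD('d) - 1))"
  interpret finite_measure \<mu> by fact
  have k: "0 < real ?k" using d by simp
  have C12: "0 < C\<^sub>1" "0 \<le> C\<^sub>2" unfolding C\<^sub>1_def C\<^sub>2_def K_def by simp_all
  have C: "0 < C" unfolding C_def using C12 by (intro mult_pos_pos add_pos_nonneg) auto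
  show "0 < C / real ?k" using C k by simp
  fix e :: real assume e: "0 < e"
  obtain s\<^sub>0 where s0: "0 < s\<^sub>0" "balls_bounded_by \<mu> a e s\<^sub>0"
    by (rule balls_bounded_of_tendsto[OF \<mu>(1) e dens])
  have "eventually (\<lambda>r. norm (A + real ?k *\<^sub>R truncated_field \<mu> a (2 * r)) \<le> C * e) (at_right 0)"
    using mean[OF e] eventually_small_radius[OF s0(1) e, of "measure \<mu> UNIV" "CARD('d)"]
  proof eventually_elim
    fix r
    assume m: "(\<integral>\<^sup>+ x \<in> ball a r. ennreal (affine_remainder \<mu> a A x) \<partial>lborel)
        \<le> ennreal (4 ^ (CARD('d) + 1) * ?v * e * r ^ CARD('d))"
      and "0 < r \<and> 3 * r \<le> s\<^sub>0 \<and> r * measure \<mu> UNIV / s\<^sub>0 ^ CARD('d) \<le> e"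
    then have r: "0 < r" "3 * r \<le> s\<^sub>0" "r * measure \<mu> UNIV / s\<^sub>0 ^ CARD('d) \<le> e" by auto
    let ?V = "A + real ?k *\<^sub>R truncated_field \<mu> a (2 * r)"
    let ?f = "\<lambda>x. affine_remainder \<mu> a A x + field_remainder \<mu> a x"
    have [measurable]: "ball a r \<in> sets borel" "field_remainder \<mu> a \<in> borel_measurable borel"
      "affine_remainder \<mu> a A \<in> borel_measurable borel"
      by (simp_all add: remainders_measurable[OF \<mu>])
    have osc: "norm (truncated_field \<mu> a (2 * norm (x - a)) - truncated_field \<mu> a (2 * r)) \<le> 3 ^ (CARD('d) - 1) * e"
      if x: "x \<in> ball a r" "r / 2 \<le> norm (x - a)" for x
    proof -
      have "norm (x - a) < r" using x(1) by (simp add: dist_norm norm_minus_commute)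
      then have "norm (truncated_field \<mu> a (2 * norm (x - a)) - truncated_field \<mu> a (2 * r))
          \<le> measure \<mu> (cball a (2 * r)) / (2 * norm (x - a)) ^ (CARD('d) - 1)"
        using x r by (intro truncated_field_diff_le[OF \<mu>]) auto
      also have "\<dots> \<le> (e * (3 * r) ^ (CARD('d) - 1)) / r ^ (CARD('d) - 1)"
      proof (intro frac_le power_mono)
        have "measure \<mu> (cball a (2 * r)) \<le> measure \<mu> (ball a (3 * r))"
          using r \<mu>(2) by (intro finite_measure_mono) auto
        also have "\<dots> \<le> e * (3 * r) ^ (CARD('d) - 1)"
          using s0(2)[unfolded balls_bounded_by_def, rule_format, of "3 * r"] r e
          by (simp add: emeasure_eq_measure)
        finally show "measure \<mu> (cball a (2 * r)) \<le> e * (3 * r) ^ (CARD('d) - 1)" .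
      qed (use x r e in auto)
      also have "\<dots> = 3 ^ (CARD('d) - 1) * e" using r by (simp add: power_mult_distrib)
      finally show ?thesis .
    qed
    have "5 / 8 * norm ?V - real ?k * (3 ^ (CARD('d) - 1) * e) \<le> 8 ^ CARD('d) * ((C\<^sub>1 + C\<^sub>2) * e)"
    proof (rule norm_le_of_directional_average[OF r(1)])
      show "0 \<le> (C\<^sub>1 + C\<^sub>2) * e" "0 \<le> real ?k * (3 ^ (CARD('d) - 1) * e)" using C12 e by simp_all
      show "AE x in lborel. x \<in> ball a r \<longrightarrow> r / 2 \<le> norm (x - a) \<longrightarrow>
          \<bar>?V \<bullet> (x - a)\<bar> \<le> (?f x + real ?k * (3 ^ (CARD('d) - 1) * e)) * norm (x - a)"
        using AE_newton_potential_finite[OF d \<mu> r(1), of a]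
      proof (eventually_elim, intro impI)
        fix x
        assume fin: "x \<in> ball a r \<longrightarrow> newton_potential \<mu> x \<noteq> top" and x: "x \<in> ball a r" "r / 2 \<le> norm (x - a)"
        let ?h = "x - a"
        \<comment> \<open>The linear parts of the two expansions differ by \<open>W\<close> at \<open>x\<close>; \<open>?V\<close> is \<open>W\<close> with the field taken at \<open>2r\<close>.\<close>
        define W where "W = A + real ?k *\<^sub>R truncated_field \<mu> a (2 * norm ?h)"
        have "norm (?V - W) \<le> real ?k * (3 ^ (CARD('d) - 1) * e)"
        proof -
          have "?V - W = - (real ?k *\<^sub>R (truncated_field \<mu> a (2 * norm ?h) - truncated_field \<mu> a (2 * r)))"
            by (simp add: W_def scaleR_diff_right)
          then show ?thesis using osc[OF x] by (simp add: mult_left_mono)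
        qed
        then have "\<bar>(?V - W) \<bullet> ?h\<bar> \<le> real ?k * (3 ^ (CARD('d) - 1) * e) * norm ?h"
          by (intro order.trans[OF Cauchy_Schwarz_ineq2] mult_right_mono) auto
        moreover have "\<bar>W \<bullet> ?h\<bar> \<le> ?f x * norm ?h"
          unfolding W_def using fin x by (intro remainders_difference(1)) auto
        moreover have "?V \<bullet> ?h = (?V - W) \<bullet> ?h + W \<bullet> ?h" by (simp add: inner_diff_left)
        ultimately show "\<bar>?V \<bullet> ?h\<bar> \<le> (?f x + real ?k * (3 ^ (CARD('d) - 1) * e)) * norm ?h"
          unfolding distrib_right[of "?f x"] by linarith
      qed
      have "(\<integral>\<^sup>+ x \<in> ball a r. ennreal (?f x) \<partial>lborel)
        = (\<integral>\<^sup>+ x. ennreal (affine_remainder \<mu> a A x) * indicator (ball a r) x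
            + ennreal (field_remainder \<mu> a x) * indicator (ball a r) x \<partial>lborel)"
        by (intro nn_integral_cong) (simp add: remainders_nonneg distrib_right)
      also have "\<dots> = (\<integral>\<^sup>+ x \<in> ball a r. ennreal (affine_remainder \<mu> a A x) \<partial>lborel)
          + (\<integral>\<^sup>+ x \<in> ball a r. ennreal (field_remainder \<mu> a x) \<partial>lborel)"
        by (rule nn_integral_add) measurable
      also have "\<dots> \<le> ennreal (C\<^sub>1 * ?v * e * r ^ CARD('d)) + ennreal (C\<^sub>2 * ?v * e * r ^ CARD('d))"
      proof (rule add_mono)
        show "(\<integral>\<^sup>+ x \<in> ball a r. ennreal (affine_remainder \<mu> a A x) \<partial>lborel) \<le> ennreal (C\<^sub>1 * ?v * e * r ^ CARD('d))"
          using m unfolding C\<^sub>1_def .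
        show "(\<integral>\<^sup>+ x \<in> ball a r. ennreal (field_remainder \<mu> a x) \<partial>lborel) \<le> ennreal (C\<^sub>2 * ?v * e * r ^ CARD('d))"
          using field_remainder_lborel_le[OF d \<mu> s0(2) less_imp_le[OF e] r]
          unfolding C\<^sub>2_def K_def by (simp only: mult_ac)
      qed
      also have "\<dots> = ennreal (?v * ((C\<^sub>1 + C\<^sub>2) * e) * r ^ CARD('d))"
        using C12 e r by (subst ennreal_plus[symmetric]) (auto simp: algebra_simps)
      finally show "(\<integral>\<^sup>+ x \<in> ball a r. ennreal (?f x) \<partial>lborel) \<le> ennreal (?v * ((C\<^sub>1 + C\<^sub>2) * e) * r ^ CARD('d))" .
    qed
    then show "norm ?V \<le> C * e" unfolding C_def by (simp add: algebra_simps)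
  qed
  then obtain b where b: "0 < b" "\<And>r. 0 < r \<Longrightarrow> r < b \<Longrightarrow> norm (A + real ?k *\<^sub>R truncated_field \<mu> a (2 * r)) \<le> C * e"
    by (auto simp: eventually_at_right_field)
  show "eventually (\<lambda>\<epsilon>. norm (truncated_field \<mu> a \<epsilon> - - ((1 / real ?k) *\<^sub>R A)) \<le> C / real ?k * e) (at_right 0)"
  proof (rule eventually_at_rightI[of 0 "2 * b"])
    fix \<epsilon> assume "\<epsilon> \<in> {0<..<2 * b}"
    then have "norm (A + real ?k *\<^sub>R truncated_field \<mu> a (2 * (\<epsilon> / 2))) \<le> C * e" by (intro b(2)) auto
    moreover have "truncated_field \<mu> a \<epsilon> - - ((1 / real ?k) *\<^sub>R A)
        = (1 / real ?k) *\<^sub>R (A + real ?k *\<^sub>R truncated_field \<mu> a (2 * (\<epsilon> / 2)))"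
      using k by (simp add: scaleR_add_right)
    ultimately show "norm (truncated_field \<mu> a \<epsilon> - - ((1 / real ?k) *\<^sub>R A)) \<le> C / real ?k * e"
      using k by (simp add: divide_right_mono)
  qed (use b in auto)
qed

theorem theorem1:
  fixes \<mu> :: "(real ^ 'd) measure" and a :: "real ^ 'd"
  assumes "CARD('d) \<ge> 3"
    and "finite_measure \<mu>"
    and "sets \<mu> = sets borel"
  shows "capacity_differentiable_at (\<lambda>x. enn2ereal (newton_potential \<mu> x)) a \<longleftrightarrow>
    ((\<lambda>r. measure \<mu> (ball a r) / r ^ (CARD('d) - 1)) \<longlongrightarrow> 0) (at_right 0) \<and>
    (\<exists>L :: real ^ 'd.
      ((\<lambda>\<epsilon>. LINT y:{y. norm (y - a) > \<epsilon>}|\<mu>. (1 / norm (a - y) ^ CARD('d)) *\<^sub>R (a - y))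
        \<longlongrightarrow> L) (at_right 0))"
    (is "_ \<longleftrightarrow> ?density \<and> ?pv")
proof
  assume "capacity_differentiable_at (\<lambda>x. enn2ereal (newton_potential \<mu> x)) a"
  then obtain A where A: "((\<lambda>r. (SUP t\<in>{0<..}. ennreal t * capacity {x \<in> ball a r. affine_remainder \<mu> a A x > t})
      / capacity (ball a r)) \<longlongrightarrow> 0) (at_right 0)"
    unfolding capacity_differentiable_potential_iff by blast
  note mean = eventually_mean_affine_remainder_le[OF assms _ A]
  have density: ?density
    by (rule density_limit_of_mean_remainder[OF assms mean])
  moreover have ?pv
    using field_limit_of_mean_remainder[OF assms density mean]
    unfolding truncated_field_def[abs_def] by blast
  ultimately show "?density \<and> ?pv" ..
next
  assume "?density \<and> ?pv"
  then show "capacity_differentiable_at (\<lambda>x. enn2ereal (newton_potential \<mu> x)) a"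
    using capacity_differentiable_of_field_limit[OF assms]
    unfolding truncated_field_def[abs_def] by blast
qed

end
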